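(* Let $a,b\in\hat{\mathbb R}$ with $b\ne a$. The family of maps $\{B^{b,a}_t\}_{t\ge0}$ forms a semigroup on $\mathrm{FID}(a,\hat{\mathbb R})\setminus\{\delta_a\}$, namely $$B^{b,a}_t\circ B^{b,a}_s=B^{b,a}_{t+s}\qquad\text{for all }t,s\ge0.$$
   Context: $\hat{\mathbb R}=\mathbb R\cup\{\infty\}$, viewed inside the Riemann sphere $\hat{\mathbb C}$. For Borel $K\subset\hat{\mathbb R}$, $\mathcal M(K)$ is the set of Borel probability measures on $\hat{\mathbb C}$ vanishing outside $K$. For a Möbius transformation $T$, $T_*\mu(E)=\mu(T^{-1}(E))$. For $\mu\in\mathcal M(\mathbb R)$ and $t\ge1$, $\mu^{\boxplus t}$ is the fractional free additive convolution power, determined by $R_{\mu^{\boxplus t}}=tR_\mu$, where $R_\mu(z)=G_\mu^{\langle-1\rangle}(z)-\frac1z$ and $G_\mu(z)=\int\frac{1}{z-x}\,d\mu(x)$. Then $F^t\mu\in\mathcal M(\mathbb R)$ is the pushforward of $\mu^{\boxplus t}$ under $x\mapsto x/t$. For $\mu=r\delta_\infty+(1-r)\nu\in\mathcal M(\hat{\mathbb R})$ with $\nu\in\mathcal M(\mathbb R)$, $0\le r\le1$, set $F^t\mu=tr\,\delta_\infty+(1-tr)F^{\frac{t-tr}{1-tr}}\nu$ if $tr<1$ and $F^t\mu=\delta_\infty$ if $tr\ge1$. For $a\in\hat{\mathbb R}$ and $t\ge 1$, $F_a^t\mu:=T^{-1}_*F^tT_*\mu$, where $T(z)=\frac1{z-a}$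 if $a\in\mathbb R$ and $T(z)=z$ if $a=\infty$. $\mu\in\mathcal M(\hat{\mathbb R})$ is $a$-free infinitely divisible if for every $0<t<1$ there is $\mu_t\in\mathcal M(\hat{\mathbb R})$ with $F_a^{1/t}\mu_t=\mu$; $\mathrm{FID}(a,\hat{\mathbb R})$ is the set of such $\mu$. If $\mu\ne\delta_a$ and, for a given $t\in(0,1)$, such a $\mu_t$ exists, then it is unique and one writes $F_a^t\mu:=\mu_t$. For $a\neq b$ and $t\ge0$, the map $B_t^{b,a}:\mathrm{FID}(a,\hat{\mathbb R})\setminus\{\delta_a\}\to\mathrm{FID}(a,\hat{\mathbb R})\setminus\{\delta_a\}$ is defined by $$B_t^{b,a}\mu:=F_b^{1+t}F_a^{\frac1{1+t}}\mu .$$ *)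

theory Defs
  imports "HOL-Probability.Probability"
begin

text \<open>
  The Riemann sphere is the one-point compactification of the complex plane:
  \<^term>\<open>None\<close> is the point at infinity.
\<close>

type_synonym sphere = "complex option"

definition sphere_borel :: "sphere measure" where
  "sphere_borel = sigma UNIV {U. openin (Alexandroff_compactification (euclidean :: complex topology)) U}"

definition real_line :: "sphere set" where
  "real_line = Some ` \<real>"

definition ext_real_line :: "sphere set" where
  "ext_real_line = insert None real_line"

definition prob_measures :: "sphere set \<Rightarrow> sphere measure set" where
  "prob_measures K =
     {\<mu>. prob_space \<mu> \<and> sets \<mu> = sets sphere_borel \<and> emeasure \<mu> (UNIV - K) = 0}"

definition dirac :: "sphere \<Rightarrow> sphere measure" where
  "dirac a = return sphere_borel a"

definition mixture :: "real \<Rightarrow> sphere measure \<Rightarrow> sphere measure \<Rightarrow> sphere measure" where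
  "mixture r \<mu> \<nu> = measure_of UNIV (sets sphere_borel)
     (\<lambda>A. ennreal r * emeasure \<mu> A + ennreal (1 - r) * emeasure \<nu> A)"

definition pushforward :: "(sphere \<Rightarrow> sphere) \<Rightarrow> sphere measure \<Rightarrow> sphere measure" where
  "pushforward T \<mu> = distr \<mu> sphere_borel T"

definition cauchy_transform :: "sphere measure \<Rightarrow> complex \<Rightarrow> complex" where
  "cauchy_transform \<mu> z = (LINT p|\<mu>. (case p of None \<Rightarrow> 0 | Some x \<Rightarrow> 1 / (z - x)))"

text \<open>
  For a measure without compact support, \<open>G\<close> has no inverse in a full neighbourhood of \<open>0\<close>.
  As usual (Bercovici--Voiculescu), \<open>G\<close> is inverted on a truncated Stolz angle at infinity on
  which it is injective, and the inverse is considered on a truncated Stolz angle at \<open>0\<close> in the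
  lower half-plane.  The \<open>R\<close>-transform is the resulting germ: any two admissible choices of
  angles agree near \<open>0\<close>.
\<close>

definition stolz_infinity :: "real \<Rightarrow> real \<Rightarrow> complex set" where
  "stolz_infinity \<alpha> \<beta> = {z. Im z > \<beta> \<and> \<bar>Re z\<bar> < \<alpha> * Im z}"

definition stolz_zero :: "real \<Rightarrow> real \<Rightarrow> complex set" where
  "stolz_zero \<alpha> \<beta> = {z. 1 / z \<in> stolz_infinity \<alpha> \<beta>}"

definition is_R_transform_on :: "sphere measure \<Rightarrow> complex set \<Rightarrow> (complex \<Rightarrow> complex) \<Rightarrow> bool" where
  "is_R_transform_on \<mu> D R \<longleftrightarrow>
     (\<exists>\<alpha>>0. \<exists>\<beta>>0. inj_on (cauchy_transform \<mu>) (stolz_infinity \<alpha> \<beta>) \<and>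
        D \<subseteq> cauchy_transform \<mu> ` stolz_infinity \<alpha> \<beta> \<and>
        (\<forall>z\<in>D. R z = the_inv_into (stolz_infinity \<alpha> \<beta>) (cauchy_transform \<mu>) z - 1 / z))"

definition is_free_power :: "real \<Rightarrow> sphere measure \<Rightarrow> sphere measure \<Rightarrow> bool" where
  "is_free_power t \<mu> \<nu> \<longleftrightarrow> \<nu> \<in> prob_measures real_line \<and>
     (\<exists>\<gamma>>0. \<exists>\<delta>>0. \<exists>R. is_R_transform_on \<mu> (stolz_zero \<gamma> \<delta>) R \<and>
        is_R_transform_on \<nu> (stolz_zero \<gamma> \<delta>) (\<lambda>z. of_real t * R z))"

definition free_power :: "real \<Rightarrow> sphere measure \<Rightarrow> sphere measure" where
  "free_power t \<mu> = (THE \<nu>. is_free_power t \<mu> \<nu>)"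

definition F_real :: "real \<Rightarrow> sphere measure \<Rightarrow> sphere measure" where
  "F_real t \<mu> = pushforward (map_option (\<lambda>x. x / of_real t)) (free_power t \<mu>)"

text \<open>
  In the decomposition \<open>\<mu> = r \<delta>\<^sub>\<infinity> + (1 - r) \<nu>\<close> the weight \<open>r\<close> is the mass at infinity and, for
  \<open>r < 1\<close>, \<open>\<nu>\<close> is \<open>\<mu>\<close> conditioned on the real line; see \<open>mixture_infinity_decomposition\<close> below.
\<close>

definition F_infinity :: "real \<Rightarrow> sphere measure \<Rightarrow> sphere measure" where
  "F_infinity t \<mu> =
     (let r = measure \<mu> {None}; \<nu> = uniform_measure \<mu> real_line in
      if t * r < 1
      then mixture (t * r) (dirac None) (F_real ((t - t * r) / (1 - t * r)) \<nu>)
      else dirac None)"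

fun moebius_to_infinity :: "sphere \<Rightarrow> sphere \<Rightarrow> sphere" where
  "moebius_to_infinity None p = p"
| "moebius_to_infinity (Some a) None = Some 0"
| "moebius_to_infinity (Some a) (Some z) = (if z = a then None else Some (1 / (z - a)))"

definition F_ge1 :: "sphere \<Rightarrow> real \<Rightarrow> sphere measure \<Rightarrow> sphere measure" where
  "F_ge1 a t \<mu> = pushforward (inv (moebius_to_infinity a))
     (F_infinity t (pushforward (moebius_to_infinity a) \<mu>))"

definition FID :: "sphere \<Rightarrow> sphere measure set" where
  "FID a = {\<mu> \<in> prob_measures ext_real_line.
     \<forall>t. 0 < t \<and> t < 1 \<longrightarrow> (\<exists>\<nu> \<in> prob_measures ext_real_line. F_ge1 a (1 / t) \<nu> = \<mu>)}"

text \<open>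
  The extension to exponents \<open>0 < t < 1\<close> is meaningful only when \<open>\<mu>\<close> is not \<open>\<delta>\<^sub>a\<close> and has a
  preimage under \<open>F_ge1 a (1 / t)\<close>.
\<close>

definition F_pow :: "sphere \<Rightarrow> real \<Rightarrow> sphere measure \<Rightarrow> sphere measure" where
  "F_pow a t \<mu> =
     (if t \<ge> 1 then F_ge1 a t \<mu>
      else (THE \<nu>. \<nu> \<in> prob_measures ext_real_line \<and> F_ge1 a (1 / t) \<nu> = \<mu>))"

definition B_map :: "sphere \<Rightarrow> sphere \<Rightarrow> real \<Rightarrow> sphere measure \<Rightarrow> sphere measure" where
  "B_map b a t \<mu> = F_pow b (1 + t) (F_pow a (1 / (1 + t)) \<mu>)"

lemma space_sphere_borel [simp]: "space sphere_borel = UNIV"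
  by (simp add: sphere_borel_def)

lemma sets_sphere_borel_open:
  assumes "openin (Alexandroff_compactification (euclidean :: complex topology)) U"
  shows "U \<in> sets sphere_borel"
  using assms by (auto simp: sphere_borel_def)

lemma plane_sets: "range Some \<in> sets sphere_borel"
  by (rule sets_sphere_borel_open, unfold openin_Alexandroff_compactification)
     (intro disjI1 exI[of _ UNIV], auto)

lemma infinity_sets: "{None} \<in> sets sphere_borel"
proof -
  have "{None} = space sphere_borel - range Some" by (auto simp: notin_range_Some)
  then show ?thesis using plane_sets by (metis sets.compl_sets)
qed

lemma real_line_sets: "real_line \<in> sets sphere_borel"
proof -
  have "Some ` (- \<real>) \<in> sets sphere_borel"
    by (rule sets_sphere_borel_open, unfold openin_Alexandroff_compactification)
       (intro disjI1 exI[of _ "- \<real>"], auto simp: open_Compl closed_complex_Reals)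
  then have "range Some - Some ` (- \<real>) \<in> sets sphere_borel"
    using plane_sets by blast
  moreover have "range Some - Some ` (- \<real>) = real_line"
    by (auto simp: real_line_def)
  ultimately show ?thesis by simp
qed

lemma mixture_infinity_decomposition:
  assumes \<mu>: "\<mu> \<in> prob_measures ext_real_line" and r: "measure \<mu> {None} < 1"
  shows "uniform_measure \<mu> real_line \<in> prob_measures real_line"
    and "mixture (measure \<mu> {None}) (dirac None) (uniform_measure \<mu> real_line) = \<mu>"
proof -
  interpret prob_space \<mu> using \<mu> by (simp add: prob_measures_def)
  have sets: "sets \<mu> = sets sphere_borel" using \<mu> by (simp add: prob_measures_def)
  have space: "space \<mu> = UNIV" using sets_eq_imp_space_eq[OF sets] by simp
  have null: "UNIV - ext_real_line \<in> null_sets \<mu>"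
    using \<mu> real_line_sets infinity_sets sets.compl_sets[of ext_real_line sphere_borel]
      sets.Un[of "{None}" sphere_borel real_line]
    by (auto simp: prob_measures_def ext_real_line_def null_sets_def)
  have L: "real_line \<in> sets \<mu>" and I: "{None} \<in> sets \<mu>"
    using real_line_sets infinity_sets sets by auto
  have disj: "{None} \<inter> real_line = {}" by (auto simp: real_line_def)
  have split: "emeasure \<mu> A = emeasure \<mu> (A \<inter> {None}) + emeasure \<mu> (A \<inter> real_line)"
    if A: "A \<in> sets \<mu>" for A
  proof -
    have "emeasure \<mu> A = emeasure \<mu> (A - (UNIV - ext_real_line))"
      using null A by (simp add: emeasure_Diff_null_set)
    also have "A - (UNIV - ext_real_line) = (A \<inter> {None}) \<union> (A \<inter> real_line)"
      by (auto simp: ext_real_line_def)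
    also have "emeasure \<mu> \<dots> = emeasure \<mu> (A \<inter> {None}) + emeasure \<mu> (A \<inter> real_line)"
      using A L I disj by (intro plus_emeasure[symmetric]) auto
    finally show ?thesis .
  qed
  have "emeasure \<mu> UNIV = 1" using emeasure_space_1 space by simp
  then have "ennreal (measure \<mu> {None}) + ennreal (measure \<mu> real_line) = ennreal 1"
    using split[of UNIV] space sets.top[of \<mu>] by (simp add: emeasure_eq_measure)
  then have mL: "measure \<mu> real_line = 1 - measure \<mu> {None}"
    by (simp add: ennreal_plus[symmetric] ennreal_eq_1 del: ennreal_plus)
  then have pos: "measure \<mu> real_line > 0" using r by simp
  have "emeasure (uniform_measure \<mu> real_line) (UNIV - real_line) = 0"
    using L sets.compl_sets[OF L] space by simp
  moreover have "prob_space (uniform_measure \<mu> real_line)"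
    using pos by (intro prob_space_uniform_measure) (auto simp: emeasure_eq_measure)
  ultimately show "uniform_measure \<mu> real_line \<in> prob_measures real_line"
    using sets by (simp add: prob_measures_def)
  have "ennreal (measure \<mu> {None}) * emeasure (dirac None) A
      + ennreal (1 - measure \<mu> {None}) * emeasure (uniform_measure \<mu> real_line) A = emeasure \<mu> A"
    if A: "A \<in> sets \<mu>" for A
  proof -
    have "ennreal (measure \<mu> {None}) * emeasure (dirac None) A = emeasure \<mu> (A \<inter> {None})"
      using A sets by (cases "None \<in> A") (auto simp: dirac_def emeasure_eq_measure)
    moreover have "ennreal (1 - measure \<mu> {None}) * emeasure (uniform_measure \<mu> real_line) A
        = emeasure \<mu> (A \<inter> real_line)"
      using A L pos
      by (simp add: mL[symmetric] emeasure_eq_measure divide_ennreal ennreal_mult[symmetric] Int_commute)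
    ultimately show ?thesis using split[OF A] by simp
  qed
  then have "mixture (measure \<mu> {None}) (dirac None) (uniform_measure \<mu> real_line)
      = measure_of (space \<mu>) (sets \<mu>) (emeasure \<mu>)"
    unfolding mixture_def sets[symmetric] space
    by (intro measure_of_eq) (use sets.sigma_sets_eq[of \<mu>] space in auto)
  then show "mixture (measure \<mu> {None}) (dirac None) (uniform_measure \<mu> real_line) = \<mu>"
    by (simp add: measure_of_of_measure)
qed

end

theory Submission
  imports Defs "HOL-Complex_Analysis.Complex_Analysis" "HOL-Real_Asymp.Real_Asymp"
begin

text \<open>
  A measure \<open>\<mu>\<close> on the extended real line, other than the Dirac measure at infinity, is encoded by its
  barycentre map \<open>w \<mapsto> w - 1 / G \<mu> w\<close>. Unlike \<open>G\<close>, this map is equivariant under real Moebius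
  transformations, and it gives all the operations \<open>F\<close> a uniform geometric meaning: if \<open>F\<close> with fixed
  point \<open>a\<close> and exponent \<open>t\<close> takes \<open>\<mu>\<close> to \<open>\<nu>\<close>, and \<open>k\<close> is the barycentre of \<open>\<nu>\<close> seen from \<open>z\<close>, then \<open>k\<close> is
  also the barycentre of \<open>\<mu>\<close> seen from \<open>w\<close>, where \<open>w\<close> is the image of \<open>z\<close> under the Moebius
  transformation with fixed points \<open>a\<close> and \<open>k\<close> that stretches by the factor \<open>t\<close> at \<open>k\<close>. It is enough to treat
  the fixed points infinity and zero, since a real Moebius transformation takes \<open>a\<close>, \<open>b\<close> there.

  For a fixed barycentre \<open>k\<close> the transformations that occur are affine in the coordinate \<open>1 / (z - k)\<close>.
  Comparing them gives the exchange law \<open>F_infinity_F_origin\<close>, in the general case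
  \<open>F\<^sub>a\<^sup>u F\<^sub>b\<^sup>v = F\<^sub>b\<^sup>v\<^sup>' F\<^sub>a\<^sup>u\<^sup>'\<close> with \<open>v' = 1 + u (v - 1)\<close> and \<open>u' v' = u v\<close>. The semigroup property is a formal
  consequence. If \<open>\<mu> = F\<^sub>a\<^sup>p \<sigma>\<close> with \<open>p = 1 + t + s\<close>, then the exchange law shows that the map with
  parameter \<open>s\<close> takes \<open>\<mu>\<close> to \<open>F\<^sub>a\<^sup>q F\<^sub>b\<^sup>r \<sigma>\<close> with \<open>q = 1 + t\<close> and \<open>r = p / q\<close>. The map with parameter \<open>t\<close>
  removes \<open>F\<^sub>a\<^sup>q\<close> and applies \<open>F\<^sub>b\<^sup>q\<close>, and \<open>F\<^sub>b\<^sup>q F\<^sub>b\<^sup>r = F\<^sub>b\<^sup>p\<close>. The same identity shows that the image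
  stays infinitely divisible.

  The analytic part consists in justifying the description by stretching. Measures are determined by
  their Cauchy transforms (Stieltjes inversion, \<open>cauchy_transform_inj\<close>). The barycentre map satisfies
  the Schwarz--Pick inequality \<open>barycentre_Pick\<close>, a case of Cauchy--Schwarz, from which every \<open>z\<close> has
  exactly one partner \<open>w\<close>, depending holomorphically on \<open>z\<close> (\<open>pick_map\<close>). Every holomorphic map from the
  upper to the closed lower half-plane is a barycentre map (\<open>measure_with_barycentre\<close>, by the Herglotz
  representation), which provides the measures themselves. That they are the free powers defined by
  germs of R-transforms follows from the behaviour of the barycentre in Stolz angles
  (\<open>barycentre_stolz\<close>). The exceptional results, Dirac measures at the fixed points, are governed by the
  masses at these points (\<open>F_infinity_atom\<close>).
\<close>

section \<open>Measures on the Riemann sphere\<close>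

lemma Some_measurable [measurable]: "Some \<in> measurable borel sphere_borel"
  unfolding sphere_borel_def
proof (rule measurable_measure_of)
  fix U assume "U \<in> {U. openin (Alexandroff_compactification (euclidean :: complex topology)) U}"
  then consider V where "open V" "U = Some ` V"
    | C where "compact C" "U = insert None (Some ` (UNIV - C))"
    by (auto simp: openin_Alexandroff_compactification)
  then show "Some -` U \<inter> space borel \<in> sets borel"
  proof cases
    case 1
    then have "Some -` U = V" by auto
    then show ?thesis using 1 by simp
  next
    case 2
    then have "Some -` U = - C" by auto
    then show ?thesis using 2 by (simp add: compact_imp_closed borel_closed)
  qed
qed auto

lemma Some_image_sets:
  assumes "B \<in> sets borel" shows "Some ` B \<in> sets sphere_borel"
proof -
  have "B \<in> sigma_sets UNIV {S. open S}" using assms by (simp add: borel_def)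
  then show ?thesis
  proof (induct rule: sigma_sets.induct)
    case (Basic a)
    then show ?case by (intro sets_sphere_borel_open) (auto)
  next
    case (Compl a)
    have "Some ` (UNIV - a) = range Some - Some ` a" by auto
    then show ?case using Compl plane_sets by auto
  next
    case (Union a)
    then show ?case by (simp add: image_UN sets.countable_UN)
  qed auto
qed

text \<open>
  Measurability on the sphere reduces to measurability on the plane, because the point at infinity
  is itself a measurable set. Measurability of maps on the sphere is proved through this fact.
\<close>

lemma sets_sphere_borel_iff: "A \<in> sets sphere_borel \<longleftrightarrow> Some -` A \<in> sets borel"
proof
  assume "A \<in> sets sphere_borel"
  from measurable_sets[OF Some_measurable this] show "Some -` A \<in> sets borel" by simp
next
  assume "Some -` A \<in> sets borel"
  then have "Some ` (Some -` A) \<in> sets sphere_borel" by (rule Some_image_sets)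
  then have "Some ` (Some -` A) \<union> (if None \<in> A then {None} else {}) \<in> sets sphere_borel"
    by (rule sets.Un) (use infinity_sets in auto)
  moreover have "Some ` (Some -` A) \<union> (if None \<in> A then {None} else {}) = A"
    by (auto simp: image_iff) (metis option.exhaust)
  ultimately show "A \<in> sets sphere_borel" by simp
qed

lemma measurable_sphereI:
  assumes "(\<lambda>z. f (Some z)) \<in> measurable borel N" "f None \<in> space N"
  shows "f \<in> measurable sphere_borel N"
proof (rule measurableI)
  fix x :: sphere
  show "f x \<in> space N"
    using assms measurable_space[OF assms(1)] by (cases x) auto
next
  fix A assume "A \<in> sets N"
  from measurable_sets[OF assms(1) this]
  have "Some -` (f -` A) \<in> sets borel" by (simp add: vimage_def)
  then show "f -` A \<inter> space sphere_borel \<in> sets sphere_borel"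
    by (simp add: sets_sphere_borel_iff)
qed

lemma map_option_measurable:
  assumes "f \<in> measurable borel borel"
  shows "map_option f \<in> measurable sphere_borel sphere_borel"
  using measurable_compose[OF assms Some_measurable] by (intro measurable_sphereI) auto

lemma moebius_measurable [measurable]: "moebius_to_infinity a \<in> measurable sphere_borel sphere_borel"
proof (cases a)
  case None
  have "moebius_to_infinity None = (\<lambda>x. x)" by auto
  then show ?thesis using None by simp
next
  case (Some c)
  have "(\<lambda>z. if z = c then None else Some (1 / (z - c))) \<in> measurable borel sphere_borel"
    by (intro measurable_If) (auto intro!: measurable_compose[OF _ Some_measurable])
  then show ?thesis unfolding Some by (intro measurable_sphereI) auto
qed

abbreviation PM :: "sphere measure set" where "PM \<equiv> prob_measures ext_real_line"

lemma prob_measures_sets: "\<mu> \<in> prob_measures K \<Longrightarrow> sets \<mu> = sets sphere_borel"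
  by (simp add: prob_measures_def)

lemma prob_measures_space: "\<mu> \<in> prob_measures K \<Longrightarrow> space \<mu> = UNIV"
  using sets_eq_imp_space_eq[OF prob_measures_sets] by simp

lemma prob_measures_prob: "\<mu> \<in> prob_measures K \<Longrightarrow> prob_space \<mu>"
  by (simp add: prob_measures_def)

lemma ext_real_line_sets: "ext_real_line \<in> sets sphere_borel"
  using sets.Un[OF infinity_sets real_line_sets] by (simp add: ext_real_line_def)

lemma prob_measuresI:
  assumes "prob_space \<mu>" "sets \<mu> = sets sphere_borel" "K \<in> sets sphere_borel" "AE p in \<mu>. p \<in> K"
  shows "\<mu> \<in> prob_measures K"
proof -
  have "space \<mu> = UNIV" using sets_eq_imp_space_eq[OF assms(2)] by simp
  moreover have "UNIV - K \<in> sets \<mu>" using sets.compl_sets[OF assms(3)] assms(2) by simp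
  ultimately have "emeasure \<mu> (UNIV - K) = 0"
    using assms(4) by (subst AE_iff_measurable[symmetric, where P="\<lambda>p. p \<in> K"]) auto
  then show ?thesis using assms by (simp add: prob_measures_def)
qed

lemma prob_measures_AE:
  assumes "\<mu> \<in> prob_measures K" "K \<in> sets sphere_borel" shows "AE p in \<mu>. p \<in> K"
proof -
  have "UNIV - K \<in> null_sets \<mu>"
    using assms sets.compl_sets[OF assms(2)] by (auto simp: prob_measures_def null_sets_def)
  from AE_not_in[OF this] show ?thesis by simp
qed

text \<open>
  The measures live on the extended real line, so an almost sure statement needs to be checked only
  at infinity and at real points. This is how the bound \<open>|1 / (z - x)| \<le> 1 / |Im z|\<close> is made available.
\<close>

lemma PM_AE:
  assumes "\<mu> \<in> PM" and "P None" and "\<And>x::real. P (Some (of_real x))"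
  shows "AE p in \<mu>. P p"
  using prob_measures_AE[OF assms(1) ext_real_line_sets]
  by eventually_elim (auto simp: ext_real_line_def real_line_def Reals_def assms)

lemma prob_measures_mono:
  "K \<in> sets sphere_borel \<Longrightarrow> L \<in> sets sphere_borel \<Longrightarrow> K \<subseteq> L \<Longrightarrow> \<mu> \<in> prob_measures K \<Longrightarrow> \<mu> \<in> prob_measures L"
proof (rule prob_measuresI)
  assume a: "K \<in> sets sphere_borel" "K \<subseteq> L" "\<mu> \<in> prob_measures K"
  show "AE p in \<mu>. p \<in> L"
    using prob_measures_AE[OF a(3,1)] by eventually_elim (use a in auto)
qed (simp_all add: prob_measures_prob prob_measures_sets)

lemma real_imp_PM: "\<mu> \<in> prob_measures real_line \<Longrightarrow> \<mu> \<in> PM"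
  using prob_measures_mono[OF real_line_sets ext_real_line_sets] by (auto simp: ext_real_line_def)

lemma pushforward_prob_measures:
  assumes "\<mu> \<in> prob_measures K" "T \<in> measurable sphere_borel sphere_borel"
    "K \<in> sets sphere_borel" "L \<in> sets sphere_borel" "T ` K \<subseteq> L"
  shows "pushforward T \<mu> \<in> prob_measures L"
proof -
  have [measurable]: "T \<in> measurable \<mu> sphere_borel"
    using assms(2) measurable_cong_sets[OF prob_measures_sets[OF assms(1)] refl] by blast
  show ?thesis
  proof (rule prob_measuresI)
    show "prob_space (pushforward T \<mu>)"
      unfolding pushforward_def
      by (rule prob_space.prob_space_distr) (use assms in \<open>auto intro: prob_measures_prob\<close>)
    have "AE p in \<mu>. T p \<in> L" using prob_measures_AE[OF assms(1,3)] assms(5) by auto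
    then show "AE p in pushforward T \<mu>. p \<in> L"
      unfolding pushforward_def by (subst AE_distr_iff) (use assms in auto)
  qed (use assms in \<open>auto simp: pushforward_def\<close>)
qed

lemma pushforward_pushforward:
  assumes "\<mu> \<in> prob_measures K" "S \<in> measurable sphere_borel sphere_borel"
    "T \<in> measurable sphere_borel sphere_borel"
  shows "pushforward S (pushforward T \<mu>) = pushforward (S \<circ> T) \<mu>"
  unfolding pushforward_def
  by (rule distr_distr) (use assms measurable_cong_sets[OF prob_measures_sets[OF assms(1)] refl] in auto)

lemma pushforward_id:
  assumes "\<mu> \<in> prob_measures K" "\<And>p. T p = p"
  shows "pushforward T \<mu> = \<mu>"
proof -
  have "T = (\<lambda>p. p)" using assms(2) by auto
  then show ?thesis
    unfolding pushforward_def using distr_id2[OF prob_measures_sets[OF assms(1), symmetric]] by simp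
qed

lemma dirac_PM: "a \<in> ext_real_line \<Longrightarrow> dirac a \<in> PM"
proof (rule prob_measuresI)
  assume "a \<in> ext_real_line"
  then show "AE p in dirac a. p \<in> ext_real_line"
    unfolding dirac_def using ext_real_line_sets by (subst AE_return) (auto simp: pred_def)
qed (simp_all add: dirac_def prob_space_return ext_real_line_sets)

lemma pushforward_dirac:
  "T \<in> measurable sphere_borel sphere_borel \<Longrightarrow> pushforward T (dirac a) = dirac (T a)"
  unfolding pushforward_def dirac_def by (rule distr_return) auto

lemma measure_pushforward:
  assumes "\<mu> \<in> prob_measures K" "T \<in> measurable sphere_borel sphere_borel" "A \<in> sets sphere_borel"
  shows "measure (pushforward T \<mu>) A = measure \<mu> (T -` A)"
  unfolding pushforward_def
  using measure_distr[of T \<mu> sphere_borel A] assms measurable_cong_sets[OF prob_measures_sets[OF assms(1)] refl]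
    prob_measures_space[OF assms(1)] by auto

lemma singleton_sets: "{p} \<in> sets sphere_borel"
  by (cases p) (auto simp: sets_sphere_borel_iff vimage_def)

lemma eq_dirac:
  assumes "\<mu> \<in> prob_measures K" "measure \<mu> {a} \<ge> 1"
  shows "\<mu> = dirac a"
proof -
  interpret prob_space \<mu> using assms by (simp add: prob_measures_prob)
  have s: "sets \<mu> = sets sphere_borel" using assms by (simp add: prob_measures_sets)
  have a: "{a} \<in> events" using singleton_sets s by simp
  have "prob {a} = 1" using assms prob_le_1 by (meson antisym)
  then have ae: "AE p in \<mu>. p = a" using prob_eq_1[OF a] by simp
  show ?thesis
  proof (rule measure_eqI)
    show "sets \<mu> = sets (dirac a)" by (simp add: dirac_def s)
    fix A assume A: "A \<in> events"
    have "prob A = indicator A a"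
    proof (cases "a \<in> A")
      case True
      then have "AE p in \<mu>. p \<in> A" using ae by auto
      then show ?thesis using prob_eq_1[OF A] True by simp
    next
      case False
      then have "AE p in \<mu>. p \<notin> A" using ae by auto
      then show ?thesis using prob_eq_0[OF A] False by simp
    qed
    then show "emeasure \<mu> A = emeasure (dirac a) A"
      using A s by (auto simp: dirac_def emeasure_eq_measure indicator_def)
  qed
qed

lemma dirac_eq_iff: "dirac a = dirac b \<longleftrightarrow> a = b"
proof
  assume "dirac a = dirac b"
  then have "emeasure (dirac a) {a} = emeasure (dirac b) {a}" by simp
  then show "a = b" using singleton_sets[of a] by (auto simp: dirac_def indicator_def split: if_splits)
qed simp

section \<open>The Cauchy transform\<close>

definition ker :: "complex \<Rightarrow> sphere \<Rightarrow> complex" where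
  "ker z p = (case p of None \<Rightarrow> 0 | Some x \<Rightarrow> 1 / (z - x))"

lemma ker_simps [simp]: "ker z None = 0" "ker z (Some x) = 1 / (z - x)"
  by (simp_all add: ker_def)

lemma ker_measurable [measurable]: "ker z \<in> borel_measurable sphere_borel"
  by (intro measurable_sphereI) auto

abbreviation G :: "sphere measure \<Rightarrow> complex \<Rightarrow> complex" where "G \<equiv> cauchy_transform"

lemma cauchy_ker: "G \<mu> z = (LINT p|\<mu>. ker z p)"
  by (simp add: cauchy_transform_def ker_def)

lemma PM_measurable: "\<mu> \<in> prob_measures K \<Longrightarrow> f \<in> borel_measurable sphere_borel \<Longrightarrow> f \<in> borel_measurable \<mu>"
  using measurable_cong_sets[OF prob_measures_sets refl] by blast

lemma cmod_ge_Im: "\<bar>Im z\<bar> \<le> cmod (z - of_real x)"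
  using abs_Im_le_cmod[of "z - of_real x"] by simp

lemma ker_bound_real: "Im z \<noteq> 0 \<Longrightarrow> cmod (1 / (z - of_real x)) \<le> 1 / \<bar>Im z\<bar>"
  using cmod_ge_Im[of z x] by (simp add: norm_divide frac_le)

lemma PM_integrable:
  fixes f :: "sphere \<Rightarrow> 'b::{banach, second_countable_topology}"
  assumes "\<mu> \<in> PM" "f \<in> borel_measurable sphere_borel" "norm (f None) \<le> B" "\<And>x::real. norm (f (Some (of_real x))) \<le> B"
  shows "integrable \<mu> f"
proof -
  interpret prob_space \<mu> using assms by (simp add: prob_measures_prob)
  have "AE p in \<mu>. norm (f p) \<le> B" using assms by (intro PM_AE) auto
  then show ?thesis by (rule integrable_const_bound) (rule PM_measurable[OF assms(1,2)])
qed

lemma PM_norm_integral_le: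
  fixes f :: "sphere \<Rightarrow> 'b::{banach, second_countable_topology}"
  assumes "\<mu> \<in> PM" "f \<in> borel_measurable sphere_borel" "norm (f None) \<le> B" "\<And>x::real. norm (f (Some (of_real x))) \<le> B"
  shows "norm (integral\<^sup>L \<mu> f) \<le> B"
proof -
  interpret prob_space \<mu> using assms by (simp add: prob_measures_prob)
  have i: "integrable \<mu> f" by (rule PM_integrable) fact+
  have "norm (integral\<^sup>L \<mu> f) \<le> (\<integral>p. norm (f p) \<partial>\<mu>)" by (rule integral_norm_bound)
  also have "\<dots> \<le> (\<integral>p. B \<partial>\<mu>)"
    using assms i by (intro integral_mono_AE) (auto intro!: PM_AE)
  also have "\<dots> = B" by (simp add: prob_space)
  finally show ?thesis .
qed

lemma ker_integrable: "\<mu> \<in> PM \<Longrightarrow> Im z \<noteq> 0 \<Longrightarrow> integrable \<mu> (ker z)"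
  by (rule PM_integrable[where B="1/\<bar>Im z\<bar>"]) (auto simp: ker_bound_real)

lemma ker2_bound: "Im z \<noteq> 0 \<Longrightarrow> Im w \<noteq> 0 \<Longrightarrow> cmod (1 / (z - of_real x) * (1 / (w - of_real x))) \<le> (1 / \<bar>Im z\<bar>) * (1 / \<bar>Im w\<bar>)"
  unfolding norm_mult by (intro mult_mono ker_bound_real) auto

lemma ker2_integrable: "\<mu> \<in> PM \<Longrightarrow> Im z \<noteq> 0 \<Longrightarrow> Im w \<noteq> 0 \<Longrightarrow> integrable \<mu> (\<lambda>p. ker z p * ker w p)"
  by (rule PM_integrable[where B="(1/\<bar>Im z\<bar>) * (1/\<bar>Im w\<bar>)"]) (use ker2_bound in auto)

text \<open>
  The resolvent identity, integrated. It yields the derivative of the Cauchy transform here and the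
  Schwarz--Pick inequality further on.
\<close>

lemma cauchy_diff:
  assumes "\<mu> \<in> PM" "Im z \<noteq> 0" "Im w \<noteq> 0"
  shows "G \<mu> z - G \<mu> w = (w - z) * (LINT p|\<mu>. ker z p * ker w p)"
proof -
  have nz: "z \<noteq> of_real x" "w \<noteq> of_real x" for x using assms by auto
  have "G \<mu> z - G \<mu> w = (LINT p|\<mu>. ker z p - ker w p)"
    unfolding cauchy_ker using assms by (simp add: ker_integrable)
  also have "\<dots> = (LINT p|\<mu>. (w - z) * (ker z p * ker w p))"
  proof (rule integral_cong_AE)
    show "AE p in \<mu>. ker z p - ker w p = (w - z) * (ker z p * ker w p)"
      using assms(1) by (rule PM_AE) (use nz in \<open>auto simp: field_simps\<close>)
  qed (auto intro!: PM_measurable[OF assms(1)])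
  finally show ?thesis by simp
qed

lemma cauchy_cnj:
  assumes "\<mu> \<in> PM" shows "G \<mu> (cnj z) = cnj (G \<mu> z)"
proof -
  have "G \<mu> (cnj z) = (LINT p|\<mu>. cnj (ker z p))"
    unfolding cauchy_ker
    by (rule integral_cong_AE) (auto intro!: PM_measurable[OF assms] PM_AE[OF assms] measurable_compose[OF ker_measurable]
        borel_measurable_continuous_onI continuous_on_cnj)
  then show ?thesis unfolding cauchy_ker by simp
qed

text \<open>
  The resolvent identity used twice bounds the error of the difference quotient by a multiple of
  \<open>|z - w|\<close>.
\<close>

lemma cauchy_has_field_derivative:
  assumes "\<mu> \<in> PM" "Im w \<noteq> 0"
  shows "(G \<mu> has_field_derivative - (LINT p|\<mu>. ker w p * ker w p)) (at w)"
proof -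
  define r where "r = \<bar>Im w\<bar> / 2"
  have r: "r > 0" using assms by (simp add: r_def)
  have near: "\<bar>Im z\<bar> \<ge> r \<and> Im z \<noteq> 0" if "dist z w < r" for z
  proof -
    have "\<bar>Im z - Im w\<bar> < r" using that abs_Im_le_cmod[of "z - w"] by (simp add: dist_norm)
    then show ?thesis using r by (auto simp: r_def abs_if split: if_splits)
  qed
  have w: "\<bar>Im w\<bar> \<ge> r" using r by (simp add: r_def)
  let ?D = "LINT p|\<mu>. ker w p * ker w p"
  have est: "cmod ((G \<mu> z - G \<mu> w) / (z - w) - (- ?D)) \<le> cmod (z - w) * (1 / r) ^ 3"
    if z: "dist z w < r" "z \<noteq> w" for z
  proof -
    have zi: "Im z \<noteq> 0" using near z by auto
    have nz: "z - of_real x \<noteq> 0" "w - of_real x \<noteq> 0" for x using assms zi by auto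
    have alg: "1 / v * (1 / v) - 1 / u * (1 / v) = (u - v) * (1 / u * (1 / v) * (1 / v))"
      if "u \<noteq> 0" "v \<noteq> 0" for u v :: complex
      using that by (simp add: field_simps)
    have "(G \<mu> z - G \<mu> w) / (z - w) - (- ?D)
        = ?D - (LINT p|\<mu>. ker z p * ker w p)"
      using z cauchy_diff[OF assms(1) zi assms(2)] by (simp add: field_simps)
    also have "\<dots> = (LINT p|\<mu>. ker w p * ker w p - ker z p * ker w p)"
      using assms zi by (simp add: ker2_integrable)
    also have "\<dots> = (LINT p|\<mu>. (z - w) * (ker z p * ker w p * ker w p))"
    proof (rule integral_cong_AE)
      show "AE p in \<mu>. ker w p * ker w p - ker z p * ker w p = (z - w) * (ker z p * ker w p * ker w p)"
        using assms(1) by (rule PM_AE) (use alg[OF nz] in auto)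
    qed (auto intro!: PM_measurable[OF assms(1)])
    finally have eq: "(G \<mu> z - G \<mu> w) / (z - w) - (- ?D)
        = (z - w) * (LINT p|\<mu>. ker z p * ker w p * ker w p)" by simp
    have b: "cmod (1 / (z - of_real x) * (1 / (w - of_real x)) * (1 / (w - of_real x))) \<le> (1 / r) ^ 3" for x
    proof -
      have "cmod (1 / (z - of_real x)) \<le> 1 / r"
        using ker_bound_real[OF zi, of x] near[OF z(1)] r by (meson frac_le order.trans zero_le_one order_refl)
      moreover have "cmod (1 / (w - of_real x)) \<le> 1 / r"
        using ker_bound_real[OF assms(2), of x] w r by (meson frac_le order.trans zero_le_one order_refl)
      ultimately have "cmod (1 / (z - of_real x)) * cmod (1 / (w - of_real x)) * cmod (1 / (w - of_real x)) \<le> (1 / r) * (1 / r) * (1 / r)"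
        using r by (intro mult_mono) auto
      then show ?thesis unfolding norm_mult power3_eq_cube .
    qed
    have "cmod (LINT p|\<mu>. ker z p * ker w p * ker w p) \<le> (1 / r) ^ 3"
      by (rule PM_norm_integral_le[OF assms(1)]) (use b r in auto)
    then show ?thesis unfolding eq norm_mult by (intro mult_left_mono) auto
  qed
  have "((\<lambda>z. (G \<mu> z - G \<mu> w) / (z - w) - (- ?D)) \<longlongrightarrow> 0) (at w)"
  proof (rule Lim_null_comparison)
    show "\<forall>\<^sub>F z in at w. cmod ((G \<mu> z - G \<mu> w) / (z - w) - (- ?D)) \<le> cmod (z - w) * (1 / r) ^ 3"
      unfolding eventually_at using r est by blast
    have "((\<lambda>z. cmod (z - w) * (1 / r) ^ 3) \<longlongrightarrow> cmod (w - w) * (1 / r) ^ 3) (at w)"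
      by (intro tendsto_intros)
    then show "((\<lambda>z. cmod (z - w) * (1 / r) ^ 3) \<longlongrightarrow> 0) (at w)" by simp
  qed
  then show ?thesis
    unfolding has_field_derivative_iff using LIM_zero_iff by blast
qed

lemma cauchy_holomorphic:
  "\<mu> \<in> PM \<Longrightarrow> G \<mu> holomorphic_on {z. Im z \<noteq> 0}"
  unfolding holomorphic_on_def field_differentiable_def
  using cauchy_has_field_derivative has_field_derivative_at_within by blast

lemma Im_ker: "Im (1 / (z - of_real x)) = - Im z * (cmod (1 / (z - of_real x)))\<^sup>2"
  by (simp add: Im_divide norm_divide power_divide cmod_power2)

lemma ker_sq_integrable: "\<mu> \<in> PM \<Longrightarrow> Im z \<noteq> 0 \<Longrightarrow> integrable \<mu> (\<lambda>p. (cmod (ker z p))\<^sup>2)"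
  by (rule PM_integrable[where B="(1/\<bar>Im z\<bar>)^2"]) (use ker_bound_real in \<open>auto intro!: power_mono\<close>)

lemma Im_cauchy:
  assumes "\<mu> \<in> PM" "Im z \<noteq> 0"
  shows "Im (G \<mu> z) = - Im z * (LINT p|\<mu>. (cmod (ker z p))\<^sup>2)"
proof -
  have "Im (G \<mu> z) = (LINT p|\<mu>. Im (ker z p))"
    unfolding cauchy_ker using assms by (simp add: ker_integrable)
  also have "\<dots> = (LINT p|\<mu>. - Im z * (cmod (ker z p))\<^sup>2)"
  proof (rule integral_cong_AE)
    show "AE p in \<mu>. Im (ker z p) = - Im z * (cmod (ker z p))\<^sup>2"
      using assms(1) by (rule PM_AE) (auto simp: Im_ker)
  qed (auto intro!: PM_measurable[OF assms(1)])
  finally show ?thesis by simp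
qed

text \<open>
  The imaginary part of \<open>G\<close> integrates a function of one strict sign on the real line, so a
  single zero off the real axis forces all mass to sit at infinity.
\<close>

lemma cauchy_eq_0_imp:
  assumes "\<mu> \<in> PM" "Im z \<noteq> 0" "G \<mu> z = 0"
  shows "\<mu> = dirac None"
proof -
  interpret prob_space \<mu> using assms by (simp add: prob_measures_prob)
  have "(LINT p|\<mu>. (cmod (ker z p))\<^sup>2) = 0"
    using Im_cauchy[OF assms(1,2)] assms by simp
  then have "AE p in \<mu>. (cmod (ker z p))\<^sup>2 = 0"
    using integral_nonneg_eq_0_iff_AE[OF ker_sq_integrable[OF assms(1,2)]] by simp
  moreover have "AE p in \<mu>. p = None \<or> (cmod (ker z p))\<^sup>2 \<noteq> 0"
    using assms(1) by (rule PM_AE) (use assms in auto)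
  ultimately have "AE p in \<mu>. p \<in> {None}" by eventually_elim auto
  then have "prob {None} = 1"
    using prob_eq_1[of "{None}"] infinity_sets prob_measures_sets[OF assms(1)] by auto
  then show ?thesis using eq_dirac[OF assms(1)] by simp
qed

lemma cauchy_dirac: "G (dirac p) z = ker z p"
  unfolding cauchy_ker dirac_def by (rule integral_return) auto

section \<open>Stieltjes inversion\<close>

definition real_point :: "sphere \<Rightarrow> real" where
  "real_point p = (case p of None \<Rightarrow> 0 | Some z \<Rightarrow> Re z)"

lemma real_point_simps [simp]: "real_point (Some z) = Re z"
  by (simp add: real_point_def)

lemma real_point_measurable [measurable]: "real_point \<in> borel_measurable sphere_borel"
  by (intro measurable_sphereI) auto

definition real_line_part :: "sphere measure \<Rightarrow> real measure" where
  "real_line_part \<mu> = distr (density \<mu> (indicator real_line)) borel real_point"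

lemma sets_real_line_part [simp, measurable_cong]: "sets (real_line_part \<mu>) = sets borel"
  by (simp add: real_line_part_def)

lemma space_real_line_part [simp]: "space (real_line_part \<mu>) = UNIV"
  by (simp add: real_line_part_def)

lemma density_measurable:
  "\<mu> \<in> prob_measures K \<Longrightarrow> f \<in> measurable sphere_borel N \<Longrightarrow> f \<in> measurable (density \<mu> g) N"
  using measurable_cong_sets[of "density \<mu> g" sphere_borel N N] by (simp add: prob_measures_sets)

lemma emeasure_real_line_part:
  assumes "\<mu> \<in> PM" "B \<in> sets borel"
  shows "emeasure (real_line_part \<mu>) B = emeasure \<mu> (real_line \<inter> real_point -` B)"
proof -
  have B: "real_point -` B \<in> sets \<mu>"
    using measurable_sets[OF real_point_measurable assms(2)] prob_measures_sets[OF assms(1)] by simp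
  have L: "real_line \<in> sets \<mu>" using real_line_sets prob_measures_sets[OF assms(1)] by simp
  have "emeasure (real_line_part \<mu>) B = emeasure (density \<mu> (indicator real_line)) (real_point -` B)"
    unfolding real_line_part_def
    using emeasure_distr[OF density_measurable[OF assms(1) real_point_measurable] assms(2)]
      prob_measures_space[OF assms(1)] by simp
  also have "\<dots> = emeasure \<mu> (real_line \<inter> real_point -` B)"
    using B L by (subst emeasure_density) (auto simp: indicator_inter_arith[symmetric])
  finally show ?thesis .
qed

lemma finite_real_line_part:
  assumes "\<mu> \<in> PM" shows "finite_measure (real_line_part \<mu>)"
proof
  interpret prob_space \<mu> using assms by (simp add: prob_measures_prob)
  show "emeasure (real_line_part \<mu>) (space (real_line_part \<mu>)) \<noteq> \<infinity>"
    using emeasure_real_line_part[OF assms, of UNIV] by (simp add: emeasure_eq_measure)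
qed

lemma integral_real_line_part:
  fixes f :: "real \<Rightarrow> real"
  assumes "\<mu> \<in> PM" "f \<in> borel_measurable borel"
  shows "integral\<^sup>L (real_line_part \<mu>) f = (LINT p|\<mu>. indicator real_line p * f (real_point p))"
proof -
  have m: "(\<lambda>p. f (real_point p)) \<in> borel_measurable \<mu>"
    by (intro PM_measurable[OF assms(1)] measurable_compose[OF real_point_measurable assms(2)])
  have L: "real_line \<in> sets \<mu>" using real_line_sets prob_measures_sets[OF assms(1)] by simp
  have "integral\<^sup>L (real_line_part \<mu>) f = (LINT p|density \<mu> (indicator real_line). f (real_point p))"
    unfolding real_line_part_def
    by (rule integral_distr[OF density_measurable[OF assms(1) real_point_measurable] assms(2)])
  also have "density \<mu> (indicator real_line) = density \<mu> (\<lambda>p. ennreal (indicator real_line p))"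
    by (simp add: ennreal_indicator)
  also have "(LINT p|\<dots>. f (real_point p)) = (LINT p|\<mu>. indicator real_line p * f (real_point p))"
    using m L by (subst integral_density) auto
  finally show ?thesis .
qed

definition poisson :: "real measure \<Rightarrow> real \<Rightarrow> real \<Rightarrow> real" where
  "poisson M x y = (LINT u|M. y / ((x - u)\<^sup>2 + y\<^sup>2))"

lemma poisson_cauchy:
  assumes "\<mu> \<in> PM" "y > 0"
  shows "poisson (real_line_part \<mu>) x y = - Im (G \<mu> (Complex x y))"
proof -
  have "- Im (G \<mu> (Complex x y)) = (LINT p|\<mu>. - Im (ker (Complex x y) p))"
    unfolding cauchy_ker using assms by (simp add: ker_integrable)
  also have "\<dots> = (LINT p|\<mu>. indicator real_line p * (y / ((x - real_point p)\<^sup>2 + y\<^sup>2)))"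
  proof (rule integral_cong_AE)
    show "AE p in \<mu>. - Im (ker (Complex x y) p) = indicator real_line p * (y / ((x - real_point p)\<^sup>2 + y\<^sup>2))"
      using assms(1)
      by (rule PM_AE) (auto simp: real_line_def Im_divide Complex_eq)
  qed (use real_line_sets in \<open>auto intro!: PM_measurable[OF assms(1)]\<close>)
  also have "\<dots> = poisson (real_line_part \<mu>) x y"
    unfolding poisson_def by (rule integral_real_line_part[OF assms(1), symmetric]) measurable
  finally show ?thesis by simp
qed

text \<open>
  Stieltjes inversion: integrating the Poisson kernel over \<open>[a, b]\<close> produces arctangents, which
  approximate the indicator function of the interval as the height \<open>y\<close> tends to zero.
\<close>

lemma stieltjes_integral:
  assumes fin: "finite_measure M" and [measurable_cong]: "sets M = sets borel" and "a \<le> b" "y > 0"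
  shows "(LINT u|M. arctan ((b - u) / y) - arctan ((a - u) / y))
       = (LINT x|lborel. indicator {a..b} x * poisson M x y)"
proof -
  interpret finite_measure M by fact
  interpret pair_sigma_finite M lborel
    by (intro pair_sigma_finite.intro sigma_finite_measure_axioms lborel.sigma_finite_measure_axioms)
  define f where "f u x = indicator {a..b} x * (y / ((x - u)\<^sup>2 + y\<^sup>2))" for u x :: real
  have sp: "space M = UNIV" using sets_eq_imp_space_eq[OF assms(2)] by simp
  have int: "integrable (M \<Otimes>\<^sub>M lborel) (case_prod f)"
  proof (rule integrableI_bounded_set[where A="space M \<times> {a..b}" and B="1/y"])
    show "case_prod f \<in> borel_measurable (M \<Otimes>\<^sub>M lborel)" unfolding f_def by measurable
    show "emeasure (M \<Otimes>\<^sub>M lborel) (space M \<times> {a..b}) < \<infinity>"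
      using \<open>a \<le> b\<close> by (subst lborel.emeasure_pair_measure_Times) (auto simp: emeasure_eq_measure ennreal_mult_less_top)
    have "y / ((x - u)\<^sup>2 + y\<^sup>2) \<le> 1 / y" for x u :: real
    proof -
      have "y / ((x - u)\<^sup>2 + y\<^sup>2) \<le> y / (y\<^sup>2)"
        using \<open>y > 0\<close> by (intro divide_left_mono) (auto intro!: mult_pos_pos add_nonneg_pos)
      also have "\<dots> = 1 / y" by (simp add: power2_eq_square)
      finally show ?thesis .
    qed
    then show "AE x in M \<Otimes>\<^sub>M lborel. x \<in> space M \<times> {a..b} \<longrightarrow> norm (case_prod f x) \<le> 1 / y"
      using \<open>y > 0\<close> by (intro AE_I2) (auto simp: f_def split: prod.split)
    show "AE x in M \<Otimes>\<^sub>M lborel. x \<notin> space M \<times> {a..b} \<longrightarrow> case_prod f x = 0"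
      by (intro AE_I2) (auto simp: f_def sp indicator_def)
  qed auto
  have inner: "(LINT x|lborel. f u x) = arctan ((b - u) / y) - arctan ((a - u) / y)" for u
  proof -
    have "(LINT x|lborel. indicator {a..b} x *\<^sub>R (y / ((x - u)\<^sup>2 + y\<^sup>2)))
        = (\<lambda>x. arctan ((x - u) / y)) b - (\<lambda>x. arctan ((x - u) / y)) a"
    proof (rule integral_FTC_atLeastAtMost[OF \<open>a \<le> b\<close>])
      fix x
      have "((\<lambda>x. arctan ((x - u) / y)) has_real_derivative (inverse (1 + ((x - u) / y)\<^sup>2) * (1 / y))) (at x within {a..b})"
        using \<open>y > 0\<close> by (auto intro!: derivative_eq_intros simp: field_simps)
      also have "inverse (1 + ((x - u) / y)\<^sup>2) * (1 / y) = y / ((x - u)\<^sup>2 + y\<^sup>2)"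
        using \<open>y > 0\<close> by (simp add: divide_simps) (simp add: power2_eq_square algebra_simps)
      finally show "((\<lambda>x. arctan ((x - u) / y)) has_vector_derivative y / ((x - u)\<^sup>2 + y\<^sup>2)) (at x within {a..b})"
        by (simp add: has_real_derivative_iff_has_vector_derivative)
    next
      have "(x - u)\<^sup>2 + y\<^sup>2 \<noteq> 0" for x using \<open>y > 0\<close> by (simp add: sum_power2_eq_zero_iff)
      then show "continuous_on {a..b} (\<lambda>x. y / ((x - u)\<^sup>2 + y\<^sup>2))"
        by (intro continuous_intros) auto
    qed
    then show ?thesis by (simp add: f_def)
  qed
  have "(LINT u|M. arctan ((b - u) / y) - arctan ((a - u) / y)) = (LINT u|M. LINT x|lborel. f u x)"
    by (simp add: inner)
  also have "\<dots> = (LINT x|lborel. LINT u|M. f u x)"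
    by (rule Fubini_integral[OF int, symmetric])
  also have "\<dots> = (LINT x|lborel. indicator {a..b} x * poisson M x y)"
    by (simp only: f_def poisson_def integral_mult_right_zero)
  finally show ?thesis .
qed

text \<open>
  Height, left and right end point move simultaneously. The left end point \<open>a + 1/n\<close> approaches \<open>a\<close>
  so slowly compared with the height \<open>1/n\<^sup>2\<close> that an atom at \<open>a\<close> is excluded in the limit, and no
  correction by half of the mass of the end points arises.
\<close>

lemma stieltjes_limit:
  assumes fin: "finite_measure M" and [measurable_cong]: "sets M = sets borel"
  shows "(\<lambda>n. LINT u|M. arctan ((real n - u) / (1 / (real n)\<^sup>2)) - arctan ((a + 1 / real n - u) / (1 / (real n)\<^sup>2)))
      \<longlonglongrightarrow> pi * measure M {a<..}"
proof -
  interpret finite_measure M by fact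
  let ?f = "\<lambda>n u. arctan ((real n - u) / (1 / (real n)\<^sup>2)) - arctan ((a + 1 / real n - u) / (1 / (real n)\<^sup>2))"
  have "(\<lambda>n. LINT u|M. ?f n u) \<longlonglongrightarrow> (LINT u|M. pi * indicator {a<..} u)"
  proof (rule integral_dominated_convergence[where w="\<lambda>_. 2 * pi"])
    show "AE u in M. norm (?f n u) \<le> 2 * pi" for n
    proof (rule AE_I2)
      fix u
      have b: "\<bar>arctan v\<bar> \<le> pi" for v
      proof -
        have "- (pi / 2) < arctan v" "arctan v < pi / 2" using arctan_bounded[of v] by auto
        then show ?thesis using pi_gt_zero by linarith
      qed
      show "norm (?f n u) \<le> 2 * pi"
        using b[of "(real n - u) / (1 / (real n)\<^sup>2)"] b[of "(a + 1 / real n - u) / (1 / (real n)\<^sup>2)"]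
        unfolding real_norm_def by linarith
    qed
    show "AE u in M. (\<lambda>n. ?f n u) \<longlonglongrightarrow> pi * indicator {a<..} u"
    proof (rule AE_I2)
      fix u
      have 1: "(\<lambda>n. arctan ((real n - u) / (1 / (real n)\<^sup>2))) \<longlonglongrightarrow> pi / 2"
        by (rule filterlim_compose[OF tendsto_arctan_at_top]) real_asymp
      show "(\<lambda>n. ?f n u) \<longlonglongrightarrow> pi * indicator {a<..} u"
      proof (cases "u > a")
        case True
        have "filterlim (\<lambda>n. (a + 1 / real n - u) / (1 / (real n)\<^sup>2)) at_bot sequentially"
        proof -
          define c where "c = u - a"
          have "c > 0" using True by (simp add: c_def)
          then have "filterlim (\<lambda>n. (1 / real n - c) / (1 / (real n)\<^sup>2)) at_bot sequentially"
            by real_asymp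
          then show ?thesis by (simp add: c_def algebra_simps)
        qed
        then have "(\<lambda>n. arctan ((a + 1 / real n - u) / (1 / (real n)\<^sup>2))) \<longlonglongrightarrow> - (pi / 2)"
          by (rule filterlim_compose[OF tendsto_arctan_at_bot])
        from tendsto_diff[OF 1 this] show ?thesis using True by simp
      next
        case False
        have "filterlim (\<lambda>n. (a + 1 / real n - u) / (1 / (real n)\<^sup>2)) at_top sequentially"
        proof -
          define c where "c = a - u"
          have "c \<ge> 0" using False by (simp add: c_def)
          have "filterlim (\<lambda>n. (1 / real n) / (1 / (real n)\<^sup>2)) at_top sequentially"
            by real_asymp
          then have "filterlim (\<lambda>n. (1 / real n + c) / (1 / (real n)\<^sup>2)) at_top sequentially"
            by (rule filterlim_at_top_mono) (use \<open>c \<ge> 0\<close> in \<open>auto intro!: always_eventually simp: field_simps\<close>)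
          then show ?thesis by (simp add: c_def algebra_simps)
        qed
        then have "(\<lambda>n. arctan ((a + 1 / real n - u) / (1 / (real n)\<^sup>2))) \<longlonglongrightarrow> (pi / 2)"
          by (rule filterlim_compose[OF tendsto_arctan_at_top])
        from tendsto_diff[OF 1 this] show ?thesis using False by simp
      qed
    qed
  qed auto
  also have "(LINT u|M. pi * indicator {a<..} u) = pi * measure M {a<..}"
    using sets_eq_imp_space_eq[OF assms(2)] by simp
  finally show ?thesis .
qed

text \<open>
  Stieltjes inversion determines the part on the real line, and the mass at infinity is what is then
  missing to one.
\<close>

theorem cauchy_transform_inj:
  assumes \<mu>: "\<mu> \<in> PM" and \<nu>: "\<nu> \<in> PM"
    and eq: "\<And>z. Im z > 0 \<Longrightarrow> G \<mu> z = G \<nu> z"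
  shows "\<mu> = \<nu>"
proof -
  interpret \<mu>: prob_space \<mu> using \<mu> by (simp add: prob_measures_prob)
  interpret \<nu>: prob_space \<nu> using \<nu> by (simp add: prob_measures_prob)
  have p: "poisson (real_line_part \<mu>) x y = poisson (real_line_part \<nu>) x y" if "y > 0" for x y
    using that by (simp add: poisson_cauchy \<mu> \<nu> eq)
  let ?f = "\<lambda>a n u. arctan ((real n - u) / (1 / (real n)\<^sup>2)) - arctan ((a + 1 / real n - u) / (1 / (real n)\<^sup>2))"
  have m: "measure (real_line_part \<mu>) {a<..} = measure (real_line_part \<nu>) {a<..}" for a
  proof -
    have ev: "\<forall>\<^sub>F n in sequentially. (LINT u|real_line_part \<mu>. ?f a n u) = (LINT u|real_line_part \<nu>. ?f a n u)"
    proof -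
      have "\<forall>\<^sub>F n in sequentially. a + 1 / real n \<le> real n \<and> n > 0"
        by (intro eventually_conj eventually_gt_at_top) real_asymp
      then show ?thesis
      proof eventually_elim
        case (elim n)
        then show ?case
          by (subst (1 2) stieltjes_integral) (auto simp: finite_real_line_part \<mu> \<nu> p)
      qed
    qed
    have "(\<lambda>n. LINT u|real_line_part \<nu>. ?f a n u) \<longlonglongrightarrow> pi * measure (real_line_part \<mu>) {a<..}"
      using stieltjes_limit[OF finite_real_line_part[OF \<mu>], of a] tendsto_cong[OF ev] by simp
    from LIMSEQ_unique[OF this stieltjes_limit[OF finite_real_line_part[OF \<nu>], of a]]
    show ?thesis by simp
  qed
  have rp: "real_line_part \<mu> = real_line_part \<nu>"
    by (rule measure_eqI_lessThan)
       (use m in \<open>auto simp: finite_measure.emeasure_eq_measure finite_real_line_part \<mu> \<nu>\<close>)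
  have A: "emeasure \<mu> (A \<inter> real_line) = emeasure \<nu> (A \<inter> real_line)" if "A \<in> sets sphere_borel" for A
  proof -
    let ?B = "{x. Some (complex_of_real x) \<in> A}"
    have "(\<lambda>x. Some (complex_of_real x)) \<in> measurable borel sphere_borel"
      by (intro measurable_compose[OF _ Some_measurable]) measurable
    from measurable_sets[OF this that] have "?B \<in> sets borel" by (simp add: vimage_def)
    moreover have "real_line \<inter> real_point -` ?B = A \<inter> real_line"
      by (auto simp: real_line_def Reals_def)
    ultimately show ?thesis
      using emeasure_real_line_part[OF \<mu>, of ?B] emeasure_real_line_part[OF \<nu>, of ?B] rp by simp
  qed
  have total: "measure \<rho> {None} = 1 - measure \<rho> real_line" if "\<rho> \<in> PM" for \<rho>
  proof -
    interpret prob_space \<rho> using that by (simp add: prob_measures_prob)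
    have s: "sets \<rho> = sets sphere_borel" using that by (simp add: prob_measures_sets)
    have "AE p in \<rho>. p \<in> ext_real_line" by (rule prob_measures_AE[OF that ext_real_line_sets])
    then have "prob ext_real_line = 1" using prob_eq_1[of ext_real_line] s ext_real_line_sets by simp
    moreover have e: "ext_real_line = {None} \<union> real_line" by (simp add: ext_real_line_def)
    moreover have "prob ext_real_line = prob {None} + prob real_line"
      unfolding e by (rule finite_measure_Union) (use s infinity_sets real_line_sets in \<open>auto simp: real_line_def\<close>)
    ultimately show ?thesis by simp
  qed
  have N: "emeasure \<mu> {None} = emeasure \<nu> {None}"
    using total[OF \<mu>] total[OF \<nu>] A[of UNIV]
    by (simp add: sets_sphere_borel_iff \<mu>.emeasure_eq_measure \<nu>.emeasure_eq_measure)
  have split: "emeasure \<rho> A = emeasure \<rho> (A \<inter> real_line) + (if None \<in> A then emeasure \<rho> {None} else 0)"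
    if "\<rho> \<in> PM" "A \<in> sets sphere_borel" for \<rho> A
  proof -
    have s: "sets \<rho> = sets sphere_borel" using that by (simp add: prob_measures_sets)
    have "emeasure \<rho> A = emeasure \<rho> ((A \<inter> real_line) \<union> (A \<inter> {None}))"
    proof (rule emeasure_eq_AE)
      show "AE p in \<rho>. p \<in> A \<longleftrightarrow> p \<in> A \<inter> real_line \<union> A \<inter> {None}"
        using that(1) by (rule PM_AE) (auto simp: real_line_def)
    qed (use that s infinity_sets real_line_sets in auto)
    also have "\<dots> = emeasure \<rho> (A \<inter> real_line) + emeasure \<rho> (A \<inter> {None})"
      by (rule plus_emeasure[symmetric]) (use that s infinity_sets real_line_sets in \<open>auto simp: real_line_def\<close>)
    finally show ?thesis by auto
  qed
  show ?thesis
  proof (rule measure_eqI)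
    fix X assume "X \<in> sets \<mu>"
    then have "X \<in> sets sphere_borel" by (simp add: prob_measures_sets[OF \<mu>])
    then show "emeasure \<mu> X = emeasure \<nu> X" using split[OF \<mu>] split[OF \<nu>] A N by simp
  qed (simp add: prob_measures_sets[OF \<mu>] prob_measures_sets[OF \<nu>])
qed

section \<open>Barycentres and the Schwarz--Pick inequality\<close>

lemma integral_Cauchy_Schwarz:
  fixes f g :: "'a \<Rightarrow> complex"
  assumes "integrable M (\<lambda>x. (cmod (f x))\<^sup>2)" "integrable M (\<lambda>x. (cmod (g x))\<^sup>2)"
    and "integrable M (\<lambda>x. f x * g x)"
  shows "(cmod (LINT x|M. f x * g x))\<^sup>2 \<le> (LINT x|M. (cmod (f x))\<^sup>2) * (LINT x|M. (cmod (g x))\<^sup>2)"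
proof -
  define A where "A = (LINT x|M. (cmod (f x))\<^sup>2)"
  define B where "B = (LINT x|M. (cmod (g x))\<^sup>2)"
  define C where "C = (LINT x|M. cmod (f x * g x))"
  have iC: "integrable M (\<lambda>x. cmod (f x * g x))" using assms(3) by (rule integrable_norm)
  have C: "C \<ge> 0" "B \<ge> 0" unfolding C_def B_def by auto
  have q: "2 * t * C \<le> A + t\<^sup>2 * B" for t
  proof -
    have "0 \<le> (LINT x|M. (cmod (f x) - t * cmod (g x))\<^sup>2)" by simp
    also have "(\<lambda>x. (cmod (f x) - t * cmod (g x))\<^sup>2)
        = (\<lambda>x. (cmod (f x))\<^sup>2 - 2 * t * cmod (f x * g x) + t\<^sup>2 * (cmod (g x))\<^sup>2)"
      by (auto simp: norm_mult power2_eq_square algebra_simps)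
    also have "(LINT x|M. (cmod (f x))\<^sup>2 - 2 * t * cmod (f x * g x) + t\<^sup>2 * (cmod (g x))\<^sup>2)
        = A - 2 * t * C + t\<^sup>2 * B"
      using assms(1,2) iC by (simp add: A_def B_def C_def)
    finally show ?thesis by simp
  qed
  have "C\<^sup>2 \<le> A * B"
  proof (cases "B = 0")
    case True
    have "C = 0"
    proof (rule ccontr)
      assume "C \<noteq> 0"
      then have "2 * ((A + 1) / (2 * C)) * C = A + 1" by simp
      then show False using q[of "(A + 1) / (2 * C)"] True by simp
    qed
    then show ?thesis using True by simp
  next
    case False
    then show ?thesis using q[of "C / B"] C
      by (simp add: field_simps power2_eq_square)
  qed
  moreover have "cmod (LINT x|M. f x * g x) \<le> C"
    unfolding C_def by (rule integral_norm_bound)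
  ultimately show ?thesis unfolding A_def B_def
    by (meson norm_ge_zero order.trans power_mono)
qed

text \<open>
  If the Moebius transformation \<open>x \<mapsto> 1 / (w - x)\<close>, which sends \<open>w\<close> to infinity, is applied to \<open>\<mu>\<close>, then
  the mean of the image is \<open>G \<mu> w\<close>; the barycentre of \<open>\<mu>\<close> seen from \<open>w\<close> is the point that is sent
  to this mean. It is equivariant under Moebius transformations.
\<close>

definition barycentre :: "sphere measure \<Rightarrow> complex \<Rightarrow> complex" where
  "barycentre \<mu> w = w - 1 / G \<mu> w"

lemma cauchy_nonzero: "\<mu> \<in> PM \<Longrightarrow> \<mu> \<noteq> dirac None \<Longrightarrow> Im z \<noteq> 0 \<Longrightarrow> G \<mu> z \<noteq> 0"
  using cauchy_eq_0_imp by blast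

context
  fixes \<mu> :: "sphere measure"
  assumes \<mu>: "\<mu> \<in> PM" "\<mu> \<noteq> dirac None"
begin

definition deviation :: "complex \<Rightarrow> sphere \<Rightarrow> complex" where
  "deviation w p = ker w p / G \<mu> w - 1"

lemma measure_space_1 [simp]: "measure \<mu> (space \<mu>) = 1"
  by (rule prob_space.prob_space[OF prob_measures_prob[OF \<mu>(1)]])

lemma prob_integral_const [simp]: "(LINT p|\<mu>. (c :: 'c :: {banach, second_countable_topology})) = c"
  using prob_space.prob_space[OF prob_measures_prob[OF \<mu>(1)]] by simp

lemma prob_integrable_const [simp]: "integrable \<mu> (\<lambda>p. (c :: 'c :: {banach, second_countable_topology}))"
  using prob_measures_prob[OF \<mu>(1)] by (simp add: prob_space.finite_measure finite_measure.integrable_const)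

text \<open>
  The deviation has mean zero, hence its products are covariances. They express differences and
  imaginary parts of barycentres, and Cauchy--Schwarz turns this into the Schwarz--Pick inequality.
\<close>

lemma deviation_prod:
  assumes "Im w \<noteq> 0" "Im v \<noteq> 0"
  shows "integrable \<mu> (\<lambda>p. deviation w p * deviation v p)"
    and "(LINT p|\<mu>. deviation w p * deviation v p)
      = (LINT p|\<mu>. ker w p * ker v p) / (G \<mu> w * G \<mu> v) - 1"
proof -
  let ?G = "G \<mu> w" and ?H = "G \<mu> v"
  have eq: "(\<lambda>p. deviation w p * deviation v p) = (\<lambda>p. ker w p * ker v p / (?G * ?H) - ker w p / ?G - ker v p / ?H + 1)"
    by (auto simp: deviation_def algebra_simps)
  show "integrable \<mu> (\<lambda>p. deviation w p * deviation v p)"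
    unfolding eq using assms
    by (intro Bochner_Integration.integrable_add Bochner_Integration.integrable_diff integrable_divide
        ker_integrable ker2_integrable \<mu> prob_integrable_const) auto
  have "(LINT p|\<mu>. deviation w p * deviation v p) = (LINT p|\<mu>. ker w p * ker v p) / (?G * ?H) - (LINT p|\<mu>. ker w p) / ?G - (LINT p|\<mu>. ker v p) / ?H + 1"
    unfolding eq using assms by (simp add: ker_integrable ker2_integrable \<mu>)
  then show "(LINT p|\<mu>. deviation w p * deviation v p) = (LINT p|\<mu>. ker w p * ker v p) / (?G * ?H) - 1"
    using cauchy_nonzero[OF \<mu>] assms by (simp add: cauchy_ker[symmetric])
qed

lemma deviation_sq:
  assumes "Im w \<noteq> 0"
  shows "integrable \<mu> (\<lambda>p. (cmod (deviation w p))\<^sup>2)"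
    and "(LINT p|\<mu>. (cmod (deviation w p))\<^sup>2) = (LINT p|\<mu>. (cmod (ker w p))\<^sup>2) / (cmod (G \<mu> w))\<^sup>2 - 1"
proof -
  let ?G = "G \<mu> w"
  have "(cmod (u - 1))\<^sup>2 = (cmod u)\<^sup>2 - 2 * Re u + 1" for u
    unfolding cmod_power2 by (simp add: power2_eq_square algebra_simps)
  then have eq: "(\<lambda>p. (cmod (deviation w p))\<^sup>2) = (\<lambda>p. (cmod (ker w p))\<^sup>2 / (cmod ?G)\<^sup>2 - 2 * Re (ker w p / ?G) + 1)"
    by (auto simp: deviation_def norm_divide power_divide)
  show "integrable \<mu> (\<lambda>p. (cmod (deviation w p))\<^sup>2)"
    unfolding eq using assms
    by (intro Bochner_Integration.integrable_add Bochner_Integration.integrable_diff integrable_divide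
        integrable_mult_right integrable_Re ker_integrable ker_sq_integrable \<mu> prob_integrable_const) auto
  have "(LINT p|\<mu>. 2 * Re (ker w p / ?G)) = 2 * Re ((LINT p|\<mu>. ker w p) / ?G)"
    using assms by (simp add: ker_integrable \<mu>)
  then show "(LINT p|\<mu>. (cmod (deviation w p))\<^sup>2) = (LINT p|\<mu>. (cmod (ker w p))\<^sup>2) / (cmod ?G)\<^sup>2 - 1"
    unfolding eq using assms cauchy_nonzero[OF \<mu>]
    by (simp add: ker_integrable ker_sq_integrable \<mu> cauchy_ker[symmetric])
qed

lemma barycentre_diff:
  assumes "Im w \<noteq> 0" "Im v \<noteq> 0"
  shows "barycentre \<mu> w - barycentre \<mu> v = - (w - v) * (LINT p|\<mu>. deviation w p * deviation v p)"
proof -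
  have "barycentre \<mu> w - barycentre \<mu> v
      = (w - v) - (G \<mu> v - G \<mu> w) / (G \<mu> w * G \<mu> v)"
    using assms cauchy_nonzero[OF \<mu>] by (simp add: barycentre_def field_simps)
  also have "G \<mu> v - G \<mu> w = (w - v) * (LINT p|\<mu>. ker w p * ker v p)"
    using cauchy_diff[OF \<mu>(1) assms(2,1)] by (simp add: mult.commute)
  finally have eq: "barycentre \<mu> w - barycentre \<mu> v = (w - v)
      - (w - v) * (LINT p|\<mu>. ker w p * ker v p) / (G \<mu> w * G \<mu> v)" .
  have alg: "a - a * i / g = - a * (i / g - 1)" for a i g :: complex by (simp add: algebra_simps)
  show ?thesis unfolding deviation_prod(2)[OF assms] eq by (rule alg)
qed

lemma Im_barycentre:
  assumes "Im w \<noteq> 0"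
  shows "Im (barycentre \<mu> w) = - Im w * (LINT p|\<mu>. (cmod (deviation w p))\<^sup>2)"
proof -
  have "Im (1 / u) = - Im u / (cmod u)\<^sup>2" for u by (simp add: Im_divide cmod_power2)
  then have "Im (barycentre \<mu> w) = Im w + Im (G \<mu> w) / (cmod (G \<mu> w))\<^sup>2"
    by (simp add: barycentre_def)
  then show ?thesis
    unfolding deviation_sq(2)[OF assms] Im_cauchy[OF \<mu>(1) assms] by (simp add: algebra_simps)
qed

text \<open>
  The Moebius transformation that sends \<open>w\<close> to infinity takes the real line to a circle, whose
  closed disc contains the mean. Hence the barycentre is not on the same side of the real line as \<open>w\<close>.
\<close>

lemma barycentre_opposite:
  assumes "Im w \<noteq> 0" shows "Im w * Im (barycentre \<mu> w) \<le> 0"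
proof -
  have "Im w * Im (barycentre \<mu> w) = - ((Im w)\<^sup>2 * (LINT p|\<mu>. (cmod (deviation w p))\<^sup>2))"
    unfolding Im_barycentre[OF assms] by (simp add: power2_eq_square)
  then show ?thesis by simp
qed

lemma barycentre_Pick:
  assumes "Im w \<noteq> 0" "Im v \<noteq> 0" "Im w * Im v > 0"
  shows "(cmod (barycentre \<mu> w - barycentre \<mu> v))\<^sup>2 * (Im w * Im v)
     \<le> (cmod (w - v))\<^sup>2 * (Im (barycentre \<mu> w) * Im (barycentre \<mu> v))"
proof -
  have cs: "(cmod (LINT p|\<mu>. deviation w p * deviation v p))\<^sup>2 \<le> (LINT p|\<mu>. (cmod (deviation w p))\<^sup>2) * (LINT p|\<mu>. (cmod (deviation v p))\<^sup>2)"
    by (rule integral_Cauchy_Schwarz) (use assms in \<open>simp_all add: deviation_sq deviation_prod\<close>)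
  have "(cmod (barycentre \<mu> w - barycentre \<mu> v))\<^sup>2 * (Im w * Im v)
      = (cmod (w - v))\<^sup>2 * (Im w * Im v) * (cmod (LINT p|\<mu>. deviation w p * deviation v p))\<^sup>2"
    unfolding barycentre_diff[OF assms(1,2)] by (simp add: norm_mult norm_minus_commute power_mult_distrib)
  also have "\<dots> \<le> (cmod (w - v))\<^sup>2 * (Im w * Im v) * ((LINT p|\<mu>. (cmod (deviation w p))\<^sup>2) * (LINT p|\<mu>. (cmod (deviation v p))\<^sup>2))"
    using assms(3) by (intro mult_left_mono cs) auto
  also have "\<dots> = (cmod (w - v))\<^sup>2 * (Im (barycentre \<mu> w) * Im (barycentre \<mu> v))"
    unfolding Im_barycentre[OF assms(1)] Im_barycentre[OF assms(2)] by (simp add: algebra_simps)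
  finally show ?thesis .
qed

lemma barycentre_holomorphic: "barycentre \<mu> holomorphic_on {z. Im z \<noteq> 0}"
  unfolding barycentre_def
  by (intro holomorphic_intros cauchy_holomorphic \<mu>) (auto simp: cauchy_nonzero \<mu>)

end

section \<open>Global inverses of perturbations of the identity\<close>

definition "upper = {z. Im z > 0}"

lemma upper_iff [simp]: "z \<in> upper \<longleftrightarrow> Im z > 0" by (simp add: upper_def)
lemma open_upper: "open upper" unfolding upper_def by (rule open_halfspace_Im_gt)
lemma connected_upper: "connected upper" unfolding upper_def by (rule connected_halfspace_Im_gt)

text \<open>
  A perturbation \<open>w \<mapsto> w - Q w\<close> of the identity lowers imaginary parts. Under the Schwarz--Pick
  inequality for \<open>Q\<close> it is a bijection from the points that it keeps in the upper half-plane onto the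
  whole upper half-plane as soon as there is one such point. Its inverse is the subordination
  function of free convolution powers.
\<close>

locale pick_map =
  fixes Q :: "complex \<Rightarrow> complex"
  assumes holo: "Q holomorphic_on upper"
    and Im_nonneg: "Im w > 0 \<Longrightarrow> Im (Q w) \<ge> 0"
    and Pick: "Im w > 0 \<Longrightarrow> Im v > 0 \<Longrightarrow>
      (cmod (Q w - Q v))\<^sup>2 * (Im w * Im v) \<le> (cmod (w - v))\<^sup>2 * (Im (Q w) * Im (Q v))"
begin

lemma inj:
  assumes w: "Im w > 0" "Im (w - Q w) > 0" and v: "Im v > 0" "Im (v - Q v) > 0" and eq: "w - Q w = v - Q v"
  shows "w = v"
proof (rule ccontr)
  assume "w \<noteq> v"
  have e: "Q w - Q v = w - v" using eq by (simp add: algebra_simps)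
  have "Im (Q w) * Im (Q v) < Im w * Im v"
    using w v Im_nonneg[OF w(1)] Im_nonneg[OF v(1)] by (intro mult_strict_mono') auto
  then have "(cmod (w - v))\<^sup>2 * (Im (Q w) * Im (Q v)) < (cmod (w - v))\<^sup>2 * (Im w * Im v)"
    using \<open>w \<noteq> v\<close> by (intro mult_strict_left_mono) auto
  then show False using Pick[OF w(1) v(1)] e by simp
qed

definition "kept = {w \<in> upper. Im (w - Q w) > 0}"

lemma open_kept: "open kept"
proof -
  have "continuous_on upper (\<lambda>w. w - Q w)"
    by (intro continuous_intros holomorphic_on_imp_continuous_on holo)
  then have "open (upper \<inter> (\<lambda>w. w - Q w) -` upper)"
    by (rule continuous_open_preimage[OF _ open_upper open_upper])
  also have "upper \<inter> (\<lambda>w. w - Q w) -` upper = kept" by (auto simp: kept_def)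
  finally show ?thesis .
qed

lemma kept_holo: "(\<lambda>w. w - Q w) holomorphic_on kept"
  using holo by (intro holomorphic_intros) (auto simp: kept_def intro: holomorphic_on_subset)

lemma kept_inj: "inj_on (\<lambda>w. w - Q w) kept"
  by (rule inj_onI) (auto simp: kept_def intro: inj)

lemma expansion_bound:
  assumes "w0 \<in> kept"
  obtains C where "\<And>w. w \<in> kept \<Longrightarrow> cmod (w - w0) \<le> C * cmod ((w - Q w) - (w0 - Q w0))"
proof -
  define c where "c = sqrt (Im (Q w0) / Im w0)"
  have w0: "Im w0 > 0" "Im (Q w0) < Im w0" "Im (Q w0) \<ge> 0"
    using assms Im_nonneg by (auto simp: kept_def)
  have c: "0 \<le> c" "c < 1" using w0 by (auto simp: c_def real_sqrt_lt_1_iff)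
  have "cmod (w - w0) \<le> (1 / (1 - c)) * cmod ((w - Q w) - (w0 - Q w0))" if "w \<in> kept" for w
  proof -
    have w: "Im w > 0" "Im (Q w) < Im w" "Im (Q w) \<ge> 0"
      using that Im_nonneg by (auto simp: kept_def)
    have "(cmod (Q w - Q w0))\<^sup>2 * (Im w * Im w0) \<le> (cmod (w - w0))\<^sup>2 * (Im (Q w) * Im (Q w0))"
      by (rule Pick) (use w w0 in auto)
    also have "\<dots> \<le> (cmod (w - w0))\<^sup>2 * (Im w * Im (Q w0))"
      using w w0 by (intro mult_left_mono mult_right_mono) auto
    also have "\<dots> = (cmod (w - w0))\<^sup>2 * c\<^sup>2 * (Im w * Im w0)"
      using w0 by (simp add: c_def)
    finally have "(cmod (Q w - Q w0))\<^sup>2 \<le> (c * cmod (w - w0))\<^sup>2"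
      using w w0 by (simp add: power_mult_distrib mult.commute)
    then have "cmod (Q w - Q w0) \<le> c * cmod (w - w0)"
      by (rule power2_le_imp_le) (use c in auto)
    moreover have "cmod (w - w0) \<le> cmod ((w - Q w) - (w0 - Q w0)) + cmod (Q w - Q w0)"
      using norm_triangle_ineq[of "(w - Q w) - (w0 - Q w0)" "Q w - Q w0"] by (simp add: algebra_simps)
    ultimately have "(1 - c) * cmod (w - w0) \<le> cmod ((w - Q w) - (w0 - Q w0))"
      by (simp add: algebra_simps)
    then show ?thesis using c by (simp add: field_simps)
  qed
  then show ?thesis by (rule that)
qed

lemma image_kept:
  assumes "w0 \<in> kept" shows "(\<lambda>w. w - Q w) ` kept = upper"
proof -
  let ?h = "\<lambda>w. w - Q w"
  let ?S = "?h ` kept"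
  have sub: "?S \<subseteq> upper" by (auto simp: kept_def)
  have "open ?S" by (rule open_mapping_thm3[OF kept_holo open_kept kept_inj])
  then have op: "openin (top_of_set upper) ?S" using sub open_upper by (simp add: openin_open_eq)
  \<comment> \<open>Preimages of a convergent sequence are bounded by the expansion estimate, and stay away from the real axis because \<open>Im (w - Q w) \<le> Im w\<close>.\<close>
  have cl: "closedin (top_of_set upper) ?S"
    unfolding closedin_limpt
  proof (intro conjI allI impI sub)
    fix z assume z: "z islimpt ?S \<and> z \<in> upper"
    then obtain f where f: "\<And>n::nat. f n \<in> ?S - {z}" "f \<longlonglongrightarrow> z"
      unfolding islimpt_sequential by auto
    then have "\<forall>n. \<exists>w\<in>kept. f n = ?h w" by blast
    then obtain w where w: "\<And>n. w n \<in> kept" "\<And>n. f n = ?h (w n)" by metis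
    obtain C where C: "\<And>u. u \<in> kept \<Longrightarrow> cmod (u - w0) \<le> C * cmod (?h u - ?h w0)"
      using expansion_bound[OF assms] by blast
    have "bounded (range f)" using f(2) convergent_imp_bounded by blast
    then obtain B where B: "\<And>n. cmod (f n) \<le> B" by (auto simp: bounded_iff)
    have "cmod (w n) \<le> cmod w0 + \<bar>C\<bar> * (B + cmod (?h w0))" for n
    proof -
      have "cmod (w n - w0) \<le> \<bar>C\<bar> * cmod (f n - ?h w0)"
        using C[OF w(1)[of n]] w(2)[of n]
        by (metis abs_ge_self mult_right_mono norm_ge_zero order.trans)
      also have "\<dots> \<le> \<bar>C\<bar> * (B + cmod (?h w0))"
        using B[of n] norm_triangle_ineq4[of "f n" "?h w0"] by (intro mult_left_mono) auto
      finally show ?thesis using norm_triangle_ineq2[of "w n" w0] by linarith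
    qed
    then have "bounded (range w)" by (auto simp: bounded_iff)
    then obtain l r where r: "strict_mono r" "(w \<circ> r) \<longlonglongrightarrow> l"
      using bounded_imp_convergent_subsequence by blast
    have fr: "(f \<circ> r) \<longlonglongrightarrow> z" using f(2) r(1) by (rule LIMSEQ_subseq_LIMSEQ)
    have "Im z \<le> Im l"
    proof (rule LIMSEQ_le[OF tendsto_Im[OF fr] tendsto_Im[OF r(2)]])
      show "\<exists>N. \<forall>n\<ge>N. Im ((f \<circ> r) n) \<le> Im ((w \<circ> r) n)"
        using w Im_nonneg by (auto simp: kept_def)
    qed
    then have l: "l \<in> upper" using z by simp
    have "isCont Q l"
      using holo l open_upper holomorphic_on_imp_continuous_on continuous_on_eq_continuous_at by blast
    then have "(\<lambda>n. Q ((w \<circ> r) n)) \<longlonglongrightarrow> Q l" using r(2) by (rule isCont_tendsto_compose)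
    with r(2) have "(\<lambda>n. (w \<circ> r) n - Q ((w \<circ> r) n)) \<longlonglongrightarrow> l - Q l" by (intro tendsto_diff)
    moreover have "(\<lambda>n. (w \<circ> r) n - Q ((w \<circ> r) n)) = f \<circ> r" using w(2) by auto
    ultimately have "l - Q l = z" using fr LIMSEQ_unique by metis
    then show "z \<in> ?S" using l z by (auto simp: kept_def intro!: image_eqI[of _ _ l])
  qed
  have "?S \<noteq> {}" using assms by auto
  with connected_upper op cl show ?thesis unfolding connected_clopen by blast
qed

lemma inverse:
  assumes "w0 \<in> kept"
  obtains \<omega> where "\<omega> holomorphic_on upper"
    "\<And>z. Im z > 0 \<Longrightarrow> Im (\<omega> z) > 0" "\<And>z. Im z > 0 \<Longrightarrow> \<omega> z - Q (\<omega> z) = z"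
proof -
  obtain g where g: "g holomorphic_on ((\<lambda>w. w - Q w) ` kept)" "\<And>w. w \<in> kept \<Longrightarrow> g (w - Q w) = w"
    using holomorphic_has_inverse[OF kept_holo open_kept kept_inj] by metis
  have "g z \<in> kept \<and> g z - Q (g z) = z" if "Im z > 0" for z
  proof -
    have "z \<in> (\<lambda>w. w - Q w) ` kept" using image_kept[OF assms] that by simp
    then show ?thesis using g(2) by auto
  qed
  then show ?thesis using that[of g] g(1) image_kept[OF assms] by (auto simp: kept_def)
qed

end

text \<open>
  With this \<open>Q\<close>, the equation \<open>w - Q w = t z\<close> says that \<open>w\<close> arises from \<open>z\<close> by stretching with factor
  \<open>t\<close> from the barycentre seen from \<open>w\<close>.
\<close>

lemma pick_map_barycentre:
  assumes "\<mu> \<in> PM" "\<mu> \<noteq> dirac None" "t \<ge> 1"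
  shows "pick_map (\<lambda>w. - of_real (t - 1) * barycentre \<mu> w)"
proof
  let ?Q = "\<lambda>w. - of_real (t - 1) * barycentre \<mu> w"
  show "?Q holomorphic_on upper"
    using barycentre_holomorphic[OF assms(1,2)]
    by (intro holomorphic_intros) (auto intro: holomorphic_on_subset)
  show "0 \<le> Im (?Q w)" if "0 < Im w" for w
    using barycentre_opposite[OF assms(1,2), of w] that assms(3)
    by (auto simp: mult_le_0_iff intro: mult_nonpos_nonpos)
  show "(cmod (?Q w - ?Q v))\<^sup>2 * (Im w * Im v) \<le> (cmod (w - v))\<^sup>2 * (Im (?Q w) * Im (?Q v))"
    if "0 < Im w" "0 < Im v" for w v
  proof -
    have "?Q w - ?Q v = - of_real (t - 1) * (barycentre \<mu> w - barycentre \<mu> v)" by (simp add: algebra_simps)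
    then have "(cmod (?Q w - ?Q v))\<^sup>2 * (Im w * Im v)
        = (t - 1)\<^sup>2 * ((cmod (barycentre \<mu> w - barycentre \<mu> v))\<^sup>2 * (Im w * Im v))"
      by (simp only: norm_mult norm_minus_cancel norm_of_real power_mult_distrib power2_abs mult.assoc)
    also have "\<dots> \<le> (t - 1)\<^sup>2 * ((cmod (w - v))\<^sup>2 * (Im (barycentre \<mu> w) * Im (barycentre \<mu> v)))"
      using barycentre_Pick[OF assms(1,2)] that by (intro mult_left_mono) auto
    also have "\<dots> = (cmod (w - v))\<^sup>2 * (Im (?Q w) * Im (?Q v))"
      by (simp add: power2_eq_square algebra_simps)
    finally show ?thesis .
  qed
qed

section \<open>Herglotz representation\<close>

definition cis1 :: "real \<Rightarrow> complex" where
  "cis1 t = exp (2 * of_real pi * \<i> * of_real t)"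

lemma norm_cis1 [simp]: "cmod (cis1 t) = 1"
  by (simp add: cis1_def)

lemma cis1_nonzero [simp]: "cis1 t \<noteq> 0"
  by (simp add: cis1_def)

lemma cnj_cis1: "cnj (cis1 t) = 1 / cis1 t"
  using complex_norm_square[of "cis1 t"] by (simp add: field_simps)

lemma cis1_continuous [continuous_intros]: "continuous_on A cis1"
  unfolding cis1_def by (intro continuous_intros)

lemma cis1_measurable [measurable]: "cis1 \<in> borel_measurable borel"
  by (intro borel_measurable_continuous_onI continuous_intros)

text \<open>
  Cauchy's formula, with the circle parametrised by one turn \<open>t \<in> [0, 1]\<close>.
\<close>

lemma Cauchy_circle_mean:
  assumes h: "h holomorphic_on cball 0 1" and \<zeta>: "cmod \<zeta> < 1"
  shows "((\<lambda>t. h (cis1 t) * (cis1 t / (cis1 t - \<zeta>))) has_integral h \<zeta>) {0..1}"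
proof -
  have "((\<lambda>u. h u / (u - \<zeta>)) has_contour_integral (2 * of_real pi * \<i> * h \<zeta>)) (circlepath 0 1)"
    by (rule Cauchy_integral_circlepath_simple) (use assms in auto)
  then have "((\<lambda>t. h (cis1 t) / (cis1 t - \<zeta>) * (2 * of_real pi * \<i> * cis1 t)) has_integral (2 * of_real pi * \<i> * h \<zeta>)) {0..1}"
    unfolding has_contour_integral_def
  proof (rule has_integral_eq[rotated])
    fix t :: real assume t: "t \<in> {0..1}"
    have vd: "vector_derivative (circlepath 0 1) (at t within {0..1}) = 2 * of_real pi * \<i> * cis1 t"
      using t by (simp add: vector_derivative_circlepath01 cis1_def)
    have cp: "circlepath 0 1 t = cis1 t" by (simp add: circlepath cis1_def)
    show "h (circlepath 0 1 t) / (circlepath 0 1 t - \<zeta>) * vector_derivative (circlepath 0 1) (at t within {0..1})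
      = h (cis1 t) / (cis1 t - \<zeta>) * (2 * of_real pi * \<i> * cis1 t)"
      by (simp only: vd cp)
  qed
  from has_integral_mult_right[OF this, of "1 / (2 * of_real pi * \<i>)"]
  show ?thesis by (simp add: field_simps)
qed

definition herglotz_kernel :: "complex \<Rightarrow> real \<Rightarrow> complex" where
  "herglotz_kernel \<zeta> t = (cis1 t + \<zeta>) / (cis1 t - \<zeta>)"

lemma cis1_neq: "cmod \<zeta> < 1 \<Longrightarrow> cis1 t \<noteq> \<zeta>"
  using norm_cis1[of t] by auto

lemma herglotz_kernel_continuous: "cmod \<zeta> < 1 \<Longrightarrow> continuous_on A (herglotz_kernel \<zeta>)"
  unfolding herglotz_kernel_def by (intro continuous_intros) (simp add: cis1_neq)

lemma herglotz_kernel_bound: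
  assumes "cmod \<zeta> < 1" shows "cmod (herglotz_kernel \<zeta> t) \<le> 2 / (1 - cmod \<zeta>)"
proof -
  have "cmod (cis1 t + \<zeta>) \<le> 2" using norm_triangle_ineq[of "cis1 t" \<zeta>] assms by simp
  moreover have "cmod (cis1 t - \<zeta>) \<ge> 1 - cmod \<zeta>" using norm_triangle_ineq2[of "cis1 t" \<zeta>] by simp
  ultimately show ?thesis unfolding herglotz_kernel_def norm_divide using assms
    by (intro frac_le) auto
qed

text \<open>
  The conjugate of \<open>g\<close> contributes only \<open>g 0\<close>: on the unit circle \<open>cnj (\<xi> / (\<xi> - \<zeta>)) = 1 / (1 - cnj \<zeta> * \<xi>)\<close>, and this
  factor is holomorphic on the closed disc, with value one at the origin.
\<close>

lemma Poisson_Schwarz_formula: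
  assumes g: "g holomorphic_on cball 0 1" and \<zeta>: "cmod \<zeta> < 1" and 0: "Im (g 0) = 0"
  shows "((\<lambda>t. of_real (Re (g (cis1 t))) * herglotz_kernel \<zeta> t) has_integral g \<zeta>) {0..1}"
proof -
  have i1: "((\<lambda>t. g (cis1 t) * (cis1 t / (cis1 t - \<zeta>))) has_integral g \<zeta>) {0..1}"
    by (rule Cauchy_circle_mean[OF g \<zeta>])
  have i0: "((\<lambda>t. g (cis1 t)) has_integral g 0) {0..1}"
    using Cauchy_circle_mean[OF g, of 0] by simp
  have i0': "((\<lambda>t. cnj (g (cis1 t))) has_integral cnj (g 0)) {0..1}"
    using has_integral_linear[OF i0 bounded_linear_cnj] by (simp add: o_def)
  have nz: "1 - cnj \<zeta> * \<xi> \<noteq> 0" if "cmod \<xi> \<le> 1" for \<xi>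
  proof
    assume "1 - cnj \<zeta> * \<xi> = 0"
    then have "cmod (cnj \<zeta> * \<xi>) = 1" by simp
    then have "cmod \<zeta> * cmod \<xi> = 1" by (simp add: norm_mult)
    moreover have "cmod \<zeta> * cmod \<xi> \<le> cmod \<zeta> * 1" using that by (intro mult_left_mono) auto
    ultimately show False using \<zeta> by simp
  qed
  have "(\<lambda>\<xi>. g \<xi> / (1 - cnj \<zeta> * \<xi>)) holomorphic_on cball 0 1"
    using nz by (intro holomorphic_intros g) auto
  from Cauchy_circle_mean[OF this, of 0]
  have "((\<lambda>t. g (cis1 t) / (1 - cnj \<zeta> * cis1 t)) has_integral g 0) {0..1}" by simp
  from has_integral_linear[OF this bounded_linear_cnj]
  have "((\<lambda>t. cnj (g (cis1 t)) / (1 - \<zeta> * cnj (cis1 t))) has_integral cnj (g 0)) {0..1}"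
    by (simp add: o_def)
  then have i2: "((\<lambda>t. cnj (g (cis1 t)) * (cis1 t / (cis1 t - \<zeta>))) has_integral cnj (g 0)) {0..1}"
    by (rule has_integral_eq[rotated]) (use cis1_neq[OF \<zeta>] in \<open>simp add: cnj_cis1 field_simps\<close>)
  have "((\<lambda>t. (1/2) * (2 * (g (cis1 t) * (cis1 t / (cis1 t - \<zeta>))) - g (cis1 t)
       + 2 * (cnj (g (cis1 t)) * (cis1 t / (cis1 t - \<zeta>))) - cnj (g (cis1 t)))) has_integral
      (1/2) * (2 * g \<zeta> - g 0 + 2 * cnj (g 0) - cnj (g 0))) {0..1}"
    by (intro has_integral_mult_right has_integral_add has_integral_diff i0 i0' i1 i2)
  moreover have "(1/2) * (2 * g \<zeta> - g 0 + 2 * cnj (g 0) - cnj (g 0)) = g \<zeta>"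
    using 0 by (auto simp: complex_eq_iff)
  moreover have "(1/2) * (2 * (g (cis1 t) * (cis1 t / (cis1 t - \<zeta>))) - g (cis1 t)
       + 2 * (cnj (g (cis1 t)) * (cis1 t / (cis1 t - \<zeta>))) - cnj (g (cis1 t)))
     = of_real (Re (g (cis1 t))) * herglotz_kernel \<zeta> t" for t
  proof -
    have r: "complex_of_real (Re (g (cis1 t))) = (g (cis1 t) + cnj (g (cis1 t))) / 2"
      by (simp add: complex_add_cnj)
    have k: "herglotz_kernel \<zeta> t = 2 * (cis1 t / (cis1 t - \<zeta>)) - 1"
      using cis1_neq[OF \<zeta>, of t] by (simp add: herglotz_kernel_def field_simps)
    have alg: "(1/2) * (2 * (a * q) - a + 2 * (b * q) - b) = (a + b) / 2 * (2 * q - 1)" for a b q :: complex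
      by (simp add: field_simps)
    show ?thesis unfolding r k by (rule alg)
  qed
  ultimately show ?thesis by simp
qed

definition boundary_density :: "(complex \<Rightarrow> complex) \<Rightarrow> real measure" where
  "boundary_density g = density lborel (\<lambda>t. ennreal (indicator {0..1} t * Re (g (cis1 t))))"

lemma boundary_density:
  assumes g: "g holomorphic_on cball 0 1" and pos: "\<And>\<zeta>. cmod \<zeta> \<le> 1 \<Longrightarrow> Re (g \<zeta>) \<ge> 0" and 0: "g 0 = 1"
  shows "real_distribution (boundary_density g)"
    and "measure (boundary_density g) {-1<..2} = 1"
    and "cmod \<zeta> < 1 \<Longrightarrow> (LINT t|boundary_density g. herglotz_kernel \<zeta> t) = g \<zeta>"
proof -
  let ?u = "\<lambda>t. indicator {0..1} t * Re (g (cis1 t))"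
  have contg: "continuous_on {0..1} (\<lambda>t. g (cis1 t))"
    by (rule continuous_on_compose2[OF holomorphic_on_imp_continuous_on[OF g]])
       (auto intro: continuous_intros)
  have su: "set_integrable lborel {0..1} (\<lambda>t. Re (g (cis1 t)))"
    by (rule borel_integrable_atLeastAtMost') (intro continuous_intros contg)
  have iu: "integrable lborel ?u" using su by (simp add: set_integrable_def)
  then have mu [measurable]: "?u \<in> borel_measurable lborel" by (rule borel_measurable_integrable)
  have nn: "?u t \<ge> 0" for t using pos[of "cis1 t"] by (auto simp: indicator_def)
  have "((\<lambda>t. g (cis1 t)) has_integral g 0) {0..1}"
    using Cauchy_circle_mean[OF g, of 0] by simp
  from has_integral_linear[OF this bounded_linear_Re]
  have "((\<lambda>t. Re (g (cis1 t))) has_integral 1) {0..1}" by (simp add: o_def 0)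
  then have one: "integral\<^sup>L lborel ?u = 1"
    using set_borel_integral_eq_integral(2)[OF su] by (simp add: set_lebesgue_integral_def integral_unique)
  have "(\<integral>\<^sup>+ t. ennreal (?u t) \<partial>lborel) = 1"
    using nn_integral_eq_integral[OF iu] nn one by simp
  then have tot: "emeasure (boundary_density g) UNIV = 1"
    unfolding boundary_density_def by (subst emeasure_density) auto
  have sp: "space (boundary_density g) = UNIV" "sets (boundary_density g) = sets borel"
    by (simp_all add: boundary_density_def)
  show rd: "real_distribution (boundary_density g)"
    by (intro real_distribution.intro prob_spaceI real_distribution_axioms.intro) (use tot sp in auto)
  have "emeasure (boundary_density g) {-1<..2} = (\<integral>\<^sup>+ t. ennreal (?u t) * indicator {-1<..2} t \<partial>lborel)"
    unfolding boundary_density_def by (rule emeasure_density) auto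
  also have "\<dots> = (\<integral>\<^sup>+ t. ennreal (?u t) \<partial>lborel)"
    by (intro nn_integral_cong) (auto simp: indicator_def)
  finally show "measure (boundary_density g) {-1<..2} = 1"
    using \<open>(\<integral>\<^sup>+ t. ennreal (?u t) \<partial>lborel) = 1\<close> by (simp add: measure_def)
  assume \<zeta>: "cmod \<zeta> < 1"
  have km: "herglotz_kernel \<zeta> \<in> borel_measurable lborel"
    using borel_measurable_continuous_onI[OF herglotz_kernel_continuous[OF \<zeta>]] by simp
  have sk: "set_integrable lborel {0..1} (\<lambda>t. of_real (Re (g (cis1 t))) * herglotz_kernel \<zeta> t)"
    by (rule borel_integrable_atLeastAtMost') (intro continuous_intros contg herglotz_kernel_continuous \<zeta>)
  have "(LINT t|boundary_density g. herglotz_kernel \<zeta> t) = (LINT t|lborel. ?u t *\<^sub>R herglotz_kernel \<zeta> t)"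
    unfolding boundary_density_def by (rule integral_density[OF km mu]) (use nn in auto)
  also have "\<dots> = (LINT t:{0..1}|lborel. of_real (Re (g (cis1 t))) * herglotz_kernel \<zeta> t)"
    unfolding set_lebesgue_integral_def by (intro Bochner_Integration.integral_cong) (auto simp: scaleR_conv_of_real)
  also have "\<dots> = integral {0..1} (\<lambda>t. of_real (Re (g (cis1 t))) * herglotz_kernel \<zeta> t)"
    by (rule set_borel_integral_eq_integral(2)[OF sk])
  also have "\<dots> = g \<zeta>"
    using Poisson_Schwarz_formula[OF g \<zeta>] 0 by (simp add: integral_unique)
  finally show "(LINT t|boundary_density g. herglotz_kernel \<zeta> t) = g \<zeta>" .
qed

text \<open>
  On slightly smaller discs \<open>f\<close> is represented by its boundary values. These probability measures live
  on \<open>[0, 1]\<close>, so Helly's theorem provides a weak limit, and the kernel is a bounded continuous test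
  function.
\<close>

theorem Herglotz_disc:
  assumes f: "f holomorphic_on ball 0 1" and pos: "\<And>\<zeta>. cmod \<zeta> < 1 \<Longrightarrow> Re (f \<zeta>) \<ge> 0" and 0: "f 0 = 1"
  obtains M where "real_distribution M" "\<And>\<zeta>. cmod \<zeta> < 1 \<Longrightarrow> (LINT t|M. herglotz_kernel \<zeta> t) = f \<zeta>"
proof -
  define \<rho> where "\<rho> n = 1 - 1 / real (n + 2)" for n
  have \<rho>: "0 \<le> \<rho> n" "\<rho> n < 1" for n by (auto simp: \<rho>_def)
  have \<rho>1: "\<rho> \<longlonglongrightarrow> 1" unfolding \<rho>_def by real_asymp
  define g where "g n \<zeta> = f (of_real (\<rho> n) * \<zeta>)" for n \<zeta>
  have b: "cmod (of_real (\<rho> n) * \<zeta>) < 1" if "cmod \<zeta> \<le> 1" for n \<zeta>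
  proof -
    have "cmod (of_real (\<rho> n) * \<zeta>) = \<rho> n * cmod \<zeta>" using \<rho> by (simp add: norm_mult)
    also have "\<dots> \<le> \<rho> n * 1" using that \<rho> by (intro mult_left_mono) auto
    finally show ?thesis using \<rho>[of n] by simp
  qed
  have gh: "g n holomorphic_on cball 0 1" for n
  proof -
    have "(f \<circ> (\<lambda>\<zeta>. of_real (\<rho> n) * \<zeta>)) holomorphic_on cball 0 1"
      using b by (intro holomorphic_on_compose_gen[OF _ f]) (auto intro!: holomorphic_intros)
    then show ?thesis by (simp add: o_def g_def[abs_def])
  qed
  have gp: "Re (g n \<zeta>) \<ge> 0" if "cmod \<zeta> \<le> 1" for n \<zeta> using pos b that by (simp add: g_def)
  have g0: "g n 0 = 1" for n by (simp add: g_def 0)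
  define \<mu> where "\<mu> n = boundary_density (g n)" for n
  note bd = boundary_density[OF gh gp g0, folded \<mu>_def]
  have "tight \<mu>"
    unfolding tight_def
  proof (intro conjI allI impI)
    fix e :: real assume "e > 0"
    then have "(-1::real) < 2 \<and> (\<forall>n. measure (\<mu> n) {-1<..2} > 1 - e)" using bd(2) by simp
    then show "\<exists>a b. a < b \<and> (\<forall>n. measure (\<mu> n) {a<..b} > 1 - e)" by blast
  qed (rule bd(1))
  from tight_imp_convergent_subsubsequence[OF this strict_mono_id]
  obtain r M where r: "strict_mono r" "real_distribution M" "weak_conv_m (\<mu> \<circ> id \<circ> r) M" by blast
  have "integral\<^sup>L M (herglotz_kernel \<zeta>) = f \<zeta>" if \<zeta>: "cmod \<zeta> < 1" for \<zeta>
  proof -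
    interpret real_distribution M by fact
    have "(\<lambda>n. integral\<^sup>L ((\<mu> \<circ> id \<circ> r) n) (herglotz_kernel \<zeta>)) \<longlonglongrightarrow> integral\<^sup>L M (herglotz_kernel \<zeta>)"
    proof (rule weak_conv_imp_integral_bdd_continuous_conv[OF _ r(2,3)])
      show "real_distribution ((\<mu> \<circ> id \<circ> r) n)" for n using bd(1) by simp
      show "isCont (herglotz_kernel \<zeta>) x" for x
        using herglotz_kernel_continuous[OF \<zeta>, of UNIV] by (simp add: continuous_on_eq_continuous_at)
      show "cmod (herglotz_kernel \<zeta> x) \<le> 2 / (1 - cmod \<zeta>)" for x by (rule herglotz_kernel_bound[OF \<zeta>])
    qed
    moreover have "integral\<^sup>L ((\<mu> \<circ> id \<circ> r) n) (herglotz_kernel \<zeta>) = f (of_real (\<rho> (r n)) * \<zeta>)" for n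
      using bd(3)[OF _ \<zeta>] \<zeta> by (simp add: g_def)
    moreover have "(\<lambda>n. f (of_real (\<rho> (r n)) * \<zeta>)) \<longlonglongrightarrow> f \<zeta>"
    proof (rule isCont_tendsto_compose[where g=f])
      show "isCont f \<zeta>"
        using f \<zeta> holomorphic_on_imp_continuous_on continuous_on_eq_continuous_at[of "ball 0 1" f] by auto
      have "(\<lambda>n. of_real (\<rho> (r n)) * \<zeta>) \<longlonglongrightarrow> of_real 1 * \<zeta>"
        using LIMSEQ_subseq_LIMSEQ[OF \<rho>1 r(1)] by (intro tendsto_intros) (simp add: o_def)
      then show "(\<lambda>n. of_real (\<rho> (r n)) * \<zeta>) \<longlonglongrightarrow> \<zeta>" by simp
    qed
    ultimately show "integral\<^sup>L M (herglotz_kernel \<zeta>) = f \<zeta>" using LIMSEQ_unique by simp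
  qed
  then show ?thesis using that[OF r(2)] by blast
qed

text \<open>
  The Cayley transform on the unit circle, onto the extended real line.
\<close>

definition boundary_point :: "real \<Rightarrow> sphere" where
  "boundary_point t = (if cis1 t = 1 then None else Some (\<i> * (1 + cis1 t) / (1 - cis1 t)))"

lemma boundary_point_ext_real_line: "boundary_point t \<in> ext_real_line"
proof (cases "cis1 t = 1")
  case False
  have "cnj (\<i> * (1 + cis1 t) / (1 - cis1 t)) = \<i> * (1 + cis1 t) / (1 - cis1 t)"
    using False by (simp add: cnj_cis1 divide_simps) (simp add: algebra_simps)
  then have "\<i> * (1 + cis1 t) / (1 - cis1 t) \<in> \<real>" using Reals_cnj_iff by blast
  then show ?thesis using False by (simp add: boundary_point_def ext_real_line_def real_line_def)
qed (simp add: boundary_point_def ext_real_line_def)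

lemma boundary_point_measurable [measurable]: "boundary_point \<in> measurable borel sphere_borel"
  unfolding boundary_point_def
  by (intro measurable_If measurable_compose[OF _ Some_measurable]) auto

lemma herglotz_kernel_eq:
  assumes "cmod \<zeta> < 1" "z = \<i> * (1 + \<zeta>) / (1 - \<zeta>)"
  shows "\<i> * herglotz_kernel \<zeta> t = z - (1 + z\<^sup>2) * ker z (boundary_point t)"
proof (cases "cis1 t = 1")
  case True
  then show ?thesis by (simp add: herglotz_kernel_def boundary_point_def assms)
next
  case False
  define \<xi> where "\<xi> = cis1 t"
  have nz: "1 - \<zeta> \<noteq> 0" "\<xi> - \<zeta> \<noteq> 0" "\<zeta> - \<xi> \<noteq> 0" "1 - \<xi> \<noteq> 0"
    using assms(1) cis1_neq[OF assms(1), of t] False by (auto simp: \<xi>_def)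
  have zx: "z - \<i> * (1 + \<xi>) / (1 - \<xi>) = 2 * \<i> * (\<zeta> - \<xi>) / ((1 - \<zeta>) * (1 - \<xi>))"
    using nz unfolding assms(2) by (simp add: divide_simps) (simp add: algebra_simps)
  have z2: "1 + z\<^sup>2 = - 4 * \<zeta> / (1 - \<zeta>)\<^sup>2"
    using nz unfolding assms(2) by (simp add: power_divide power_mult_distrib divide_simps) (simp add: power2_eq_square algebra_simps)
  have "(1 + z\<^sup>2) * (1 / (z - \<i> * (1 + \<xi>) / (1 - \<xi>))) = 2 * \<i> * \<zeta> * (1 - \<xi>) / ((1 - \<zeta>) * (\<zeta> - \<xi>))"
    unfolding zx z2 using nz by (simp add: divide_simps power2_eq_square)
  moreover have "z - 2 * \<i> * \<zeta> * (1 - \<xi>) / ((1 - \<zeta>) * (\<zeta> - \<xi>)) = \<i> * ((\<xi> + \<zeta>) / (\<xi> - \<zeta>))"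
    using nz unfolding assms(2) by (simp add: divide_simps) (simp add: algebra_simps)
  ultimately show ?thesis using False
    by (simp add: herglotz_kernel_def boundary_point_def \<xi>_def)
qed

text \<open>
  The disc version in the coordinate \<open>\<zeta> = (z - i) / (z + i)\<close>, for \<open>f = - i N\<close>; the normalisation \<open>f 0 = 1\<close>
  becomes \<open>N i = i\<close>.
\<close>

theorem Nevanlinna_representation:
  assumes N: "N holomorphic_on upper" and pos: "\<And>z. Im z > 0 \<Longrightarrow> Im (N z) \<ge> 0" and i: "N \<i> = \<i>"
  obtains \<mu> where "\<mu> \<in> PM" "\<And>z. Im z > 0 \<Longrightarrow> N z = z - (1 + z\<^sup>2) * G \<mu> z"
proof -
  define Z where "Z \<zeta> = \<i> * (1 + \<zeta>) / (1 - \<zeta>)" for \<zeta> :: complex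
  have ne: "1 - \<zeta> \<noteq> 0" if "cmod \<zeta> < 1" for \<zeta> using that by auto
  have ImZ: "Im (Z \<zeta>) > 0" if "cmod \<zeta> < 1" for \<zeta>
  proof -
    have "Z \<zeta> = \<i> * ((1 + \<zeta>) / (1 - \<zeta>))" by (simp add: Z_def)
    then have "Im (Z \<zeta>) = Re ((1 + \<zeta>) / (1 - \<zeta>))" by (simp only: Im_i_times)
    also have "\<dots> = (1 - (cmod \<zeta>)\<^sup>2) / (cmod (1 - \<zeta>))\<^sup>2"
      unfolding Re_divide cmod_power2
      by (rule arg_cong2[where f="(/)"]) (simp_all add: power2_eq_square algebra_simps)
    also have "\<dots> > 0"
      using that ne[OF that] by (intro divide_pos_pos) (auto simp: power_less_one_iff abs_square_less_1)
    finally show ?thesis .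
  qed
  define f where "f \<zeta> = - \<i> * N (Z \<zeta>)" for \<zeta>
  have "f holomorphic_on ball 0 1"
  proof -
    have "(N \<circ> Z) holomorphic_on ball 0 1"
      unfolding Z_def using ImZ ne
      by (intro holomorphic_on_compose_gen[OF _ N] holomorphic_intros) (auto simp: Z_def)
    then show ?thesis unfolding f_def by (intro holomorphic_intros) (simp add: o_def)
  qed
  moreover have "Re (f \<zeta>) \<ge> 0" if "cmod \<zeta> < 1" for \<zeta> using pos[OF ImZ[OF that]] by (simp add: f_def)
  moreover have "f 0 = 1" by (simp add: f_def Z_def i)
  ultimately obtain M where M: "real_distribution M"
    "\<And>\<zeta>. cmod \<zeta> < 1 \<Longrightarrow> (LINT t|M. herglotz_kernel \<zeta> t) = f \<zeta>"
    using Herglotz_disc by blast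
  interpret real_distribution M by fact
  have bm: "boundary_point \<in> measurable M sphere_borel"
    using boundary_point_measurable measurable_cong_sets[OF events_eq_borel refl] by blast
  define \<mu> where "\<mu> = distr M sphere_borel boundary_point"
  have \<mu>: "\<mu> \<in> PM"
  proof (rule prob_measuresI)
    show "prob_space \<mu>" unfolding \<mu>_def by (rule prob_space_distr[OF bm])
    show "AE p in \<mu>. p \<in> ext_real_line"
      unfolding \<mu>_def by (subst AE_distr_iff[OF bm]) (use ext_real_line_sets boundary_point_ext_real_line in auto)
  qed (auto simp: \<mu>_def ext_real_line_sets)
  show ?thesis
  proof (rule that[OF \<mu>])
    fix z assume z: "Im z > 0"
    define \<zeta> where "\<zeta> = (z - \<i>) / (z + \<i>)"
    have nz: "z + \<i> \<noteq> 0" using z by (auto simp: complex_eq_iff)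
    have "cmod (z - \<i>) < cmod (z + \<i>)"
      using z by (simp add: cmod_def power2_eq_square algebra_simps)
    then have \<zeta>: "cmod \<zeta> < 1" using nz by (simp add: \<zeta>_def norm_divide)
    have zZ: "z = \<i> * (1 + \<zeta>) / (1 - \<zeta>)"
      using nz ne[OF \<zeta>] by (simp add: \<zeta>_def divide_simps)
    have int: "integrable M (\<lambda>t. ker z (boundary_point t))"
      using ker_integrable[OF \<mu>, of z] z unfolding \<mu>_def by (intro integrable_distr[OF bm]) auto
    have "N z = \<i> * f \<zeta>" using zZ by (simp add: f_def Z_def)
    also have "\<dots> = (LINT t|M. \<i> * herglotz_kernel \<zeta> t)" using M(2)[OF \<zeta>] by simp
    also have "\<dots> = (LINT t|M. z - (1 + z\<^sup>2) * ker z (boundary_point t))"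
      using herglotz_kernel_eq[OF \<zeta> zZ] by simp
    also have "\<dots> = z - (1 + z\<^sup>2) * (LINT t|M. ker z (boundary_point t))"
      using int prob_space by simp
    also have "(LINT t|M. ker z (boundary_point t)) = G \<mu> z"
      unfolding cauchy_ker \<mu>_def using bm by (subst integral_distr) auto
    finally show "N z = z - (1 + z\<^sup>2) * G \<mu> z" .
  qed
qed

text \<open>
  The function \<open>N\<close> below is the mean of the kernels \<open>(1 + x z) / (x - z)\<close>, expressed through the
  barycentre. For fixed \<open>z\<close> this kernel is a Moebius transformation of \<open>x\<close> which maps the closed lower
  half-plane into the closed upper one, so the representation theorem applies. Linear growth of \<open>K\<close>
  along the imaginary axis is reflected in a mass at infinity.
\<close>

theorem measure_with_barycentre:
  assumes K: "K holomorphic_on upper" and neg: "\<And>z. Im z > 0 \<Longrightarrow> Im (K z) \<le> 0"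
  obtains \<mu> where "\<mu> \<in> PM" "\<And>z. Im z > 0 \<Longrightarrow> G \<mu> z = 1 / (z - K z)"
proof -
  have nz: "z - K z \<noteq> 0" "K z - z \<noteq> 0" if "Im z > 0" for z using neg[OF that] that by auto
  \<comment> \<open>Recovering \<open>G\<close> from \<open>N\<close> divides by \<open>1 + z\<^sup>2\<close>, whose zero \<open>z = i\<close> is treated by continuation.\<close>
  define N where "N z = (1 + z * K z) / (K z - z)" for z
  have "N holomorphic_on upper" unfolding N_def using nz by (intro holomorphic_intros K) auto
  moreover have "Im (N z) \<ge> 0" if "Im z > 0" for z
  proof -
    have "Im (N z) = (Im z * (1 + (cmod (K z))\<^sup>2) - Im (K z) * (1 + (cmod z)\<^sup>2)) / (cmod (K z - z))\<^sup>2"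
      unfolding N_def Im_divide cmod_power2
      by (rule arg_cong2[where f="(/)"]) (simp_all add: power2_eq_square algebra_simps)
    moreover have "Im (K z) * (1 + (cmod z)\<^sup>2) \<le> 0"
      by (rule mult_nonpos_nonneg) (use neg[OF that] in auto)
    moreover have "Im z * (1 + (cmod (K z))\<^sup>2) \<ge> 0" using that by simp
    ultimately show ?thesis by (simp only:) (intro divide_nonneg_nonneg, linarith, simp)
  qed
  moreover have "N \<i> = \<i>"
    using nz[of \<i>] by (simp add: N_def divide_simps) (simp add: algebra_simps)
  ultimately obtain \<mu> where \<mu>: "\<mu> \<in> PM" "\<And>z. Im z > 0 \<Longrightarrow> N z = z - (1 + z\<^sup>2) * G \<mu> z"
    using Nevanlinna_representation by blast
  have off: "G \<mu> z = 1 / (z - K z)" if "Im z > 0" "z \<noteq> \<i>" for z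
  proof -
    have "1 + z\<^sup>2 = (z - \<i>) * (z + \<i>)" by (simp add: power2_eq_square algebra_simps)
    moreover have "z + \<i> \<noteq> 0" using that by (auto simp: complex_eq_iff)
    ultimately have z2: "1 + z\<^sup>2 \<noteq> 0" using that by simp
    have "z - N z = (1 + z\<^sup>2) * (1 / (z - K z))"
      using nz[OF that(1)] by (simp add: N_def divide_simps) (simp add: power2_eq_square algebra_simps)
    then have "(1 + z\<^sup>2) * G \<mu> z = (1 + z\<^sup>2) * (1 / (z - K z))"
      using \<mu>(2)[OF that(1)] by (simp add: algebra_simps)
    then show ?thesis using z2 mult_left_cancel by blast
  qed
  have "G \<mu> z = 1 / (z - K z)" if z: "Im z > 0" for z
  proof (rule analytic_continuation_open[where s="upper - {\<i>}" and s'=upper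
        and f="G \<mu>" and g="\<lambda>z. 1 / (z - K z)"])
    show "open (upper - {\<i>})" using open_upper by (simp add: open_delete)
    have "2 * \<i> \<in> upper - {\<i>}" by simp
    then show "upper - {\<i>} \<noteq> {}" by blast
    show "G \<mu> holomorphic_on upper"
      by (rule holomorphic_on_subset[OF cauchy_holomorphic[OF \<mu>(1)]]) auto
    show "(\<lambda>z. 1 / (z - K z)) holomorphic_on upper" using nz by (intro holomorphic_intros K) auto
  qed (use open_upper connected_upper off z in auto)
  then show ?thesis using that[OF \<mu>(1)] by blast
qed

section \<open>Behaviour in Stolz angles\<close>

lemma real_lineD:
  assumes "\<mu> \<in> prob_measures real_line"
  shows "\<mu> \<in> PM" "measure \<mu> {None} = 0" "\<mu> \<noteq> dirac None"
proof -
  show PM: "\<mu> \<in> PM" by (rule real_imp_PM[OF assms])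
  interpret prob_space \<mu> using assms by (simp add: prob_measures_prob)
  have "AE p in \<mu>. p \<notin> {None}"
    using prob_measures_AE[OF assms real_line_sets] by eventually_elim (auto simp: real_line_def)
  then show m: "measure \<mu> {None} = 0"
    using prob_eq_0[of "{None}"] infinity_sets prob_measures_sets[OF assms] by simp
  show "\<mu> \<noteq> dirac None" using m infinity_sets by (auto simp: dirac_def measure_return)
qed

lemma real_lineI:
  assumes "\<mu> \<in> PM" "measure \<mu> {None} = 0" shows "\<mu> \<in> prob_measures real_line"
proof -
  interpret prob_space \<mu> using assms by (simp add: prob_measures_prob)
  have s: "sets \<mu> = sets sphere_borel" using assms by (simp add: prob_measures_sets)
  have "AE p in \<mu>. p \<notin> {None}"
    using prob_eq_0[of "{None}"] infinity_sets s assms(2) by simp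
  then have "AE p in \<mu>. p \<in> real_line"
    using prob_measures_AE[OF assms(1) ext_real_line_sets]
    by eventually_elim (auto simp: ext_real_line_def)
  then show ?thesis by (intro prob_measuresI prob_space_axioms s real_line_sets)
qed

text \<open>
  At a real point \<open>x\<close> this is \<open>x / (w - x)\<close>. It stays bounded while \<open>w\<close> runs through a Stolz angle, and
  tends to zero as \<open>w\<close> tends to infinity there.
\<close>

definition remainder :: "complex \<Rightarrow> sphere \<Rightarrow> complex" where
  "remainder w p = w * ker w p - indicator (range Some) p"

lemma remainder_measurable [measurable]: "remainder w \<in> borel_measurable sphere_borel"
  unfolding remainder_def using plane_sets by measurable

lemma cauchy_stolz_limit:
  assumes \<mu>: "\<mu> \<in> PM" and "\<epsilon> > 0"
  shows "\<exists>\<beta>>0. \<forall>w. \<bar>Im w\<bar> \<ge> \<beta> \<and> \<bar>Re w\<bar> \<le> \<alpha> * \<bar>Im w\<bar>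
     \<longrightarrow> cmod (w * G \<mu> w - of_real (1 - measure \<mu> {None})) \<le> \<epsilon>"
proof -
  interpret prob_space \<mu> using \<mu> by (simp add: prob_measures_prob)
  have s: "sets \<mu> = sets sphere_borel" using \<mu> by (simp add: prob_measures_sets)
  have sp: "space \<mu> = UNIV" using \<mu> by (simp add: prob_measures_space)
  define C where "C = 2 + \<bar>\<alpha>\<bar>"
  have C: "0 \<le> C" by (simp add: C_def)
  define e where "e n p = min C (\<bar>real_point p\<bar> / real n)" for n p
  have [measurable]: "e n \<in> borel_measurable sphere_borel" for n
    unfolding e_def by measurable
  have eb: "\<bar>e n p\<bar> \<le> C" for n p by (auto simp: e_def C_def)
  have "(\<lambda>n. LINT p|\<mu>. e n p) \<longlonglongrightarrow> (LINT p|\<mu>. 0)"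
  proof (rule integral_dominated_convergence[where w="\<lambda>_. C"])
    show "AE p in \<mu>. (\<lambda>n. e n p) \<longlonglongrightarrow> 0"
    proof (rule AE_I2)
      fix p
      have "(\<lambda>n. \<bar>real_point p\<bar> / real n) \<longlonglongrightarrow> 0" by real_asymp
      from tendsto_min[OF tendsto_const[of C] this] show "(\<lambda>n. e n p) \<longlonglongrightarrow> 0"
        using C by (simp only: e_def min.absorb2)
    qed
    show "AE p in \<mu>. norm (e n p) \<le> C" for n using eb by simp
  qed (auto intro!: PM_measurable[OF \<mu>])
  then have "(\<lambda>n. LINT p|\<mu>. e n p) \<longlonglongrightarrow> 0" by simp
  then have "\<forall>\<^sub>F n in sequentially. (LINT p|\<mu>. e n p) < \<epsilon>"
    using \<open>\<epsilon> > 0\<close> by (rule order_tendstoD)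
  then obtain N where N: "\<And>n. n \<ge> N \<Longrightarrow> (LINT p|\<mu>. e n p) < \<epsilon>"
    unfolding eventually_sequentially by blast
  define n where "n = Suc N"
  have n: "n > 0" "(LINT p|\<mu>. e n p) < \<epsilon>" using N by (auto simp: n_def)
  have "cmod (w * G \<mu> w - of_real (1 - measure \<mu> {None})) \<le> \<epsilon>"
    if w: "\<bar>Im w\<bar> \<ge> real n" "\<bar>Re w\<bar> \<le> \<alpha> * \<bar>Im w\<bar>" for w
  proof -
    have Im: "\<bar>Im w\<bar> > 0" using w(1) n(1) by linarith
    have nz: "w - of_real x \<noteq> 0" for x using Im by auto
    have "\<alpha> * \<bar>Im w\<bar> \<le> \<bar>\<alpha>\<bar> * \<bar>Im w\<bar>" by (intro mult_right_mono) auto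
    then have cw: "cmod w \<le> (1 + \<bar>\<alpha>\<bar>) * \<bar>Im w\<bar>"
      using cmod_le[of w] w(2) by (simp add: algebra_simps)
    have real: "cmod (remainder w (Some (of_real x))) \<le> e n (Some (of_real x))" for x
    proof -
      have inv: "cmod (1 / (w - of_real x)) \<le> 1 / \<bar>Im w\<bar>" by (rule ker_bound_real) (use Im in auto)
      have t1: "remainder w (Some (of_real x)) = of_real x * (1 / (w - of_real x))"
        using nz[of x] by (simp add: remainder_def field_simps)
      have "cmod (remainder w (Some (of_real x))) \<le> \<bar>x\<bar> * (1 / \<bar>Im w\<bar>)"
        unfolding t1 norm_mult using inv by (intro mult_mono) auto
      also have "\<dots> \<le> \<bar>x\<bar> * (1 / real n)"
        using w(1) n(1) by (intro mult_left_mono frac_le) auto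
      finally have 1: "cmod (remainder w (Some (of_real x))) \<le> \<bar>x\<bar> / real n" by simp
      have "cmod (remainder w (Some (of_real x))) \<le> cmod w * cmod (1 / (w - of_real x)) + 1"
        using norm_triangle_ineq4[of "w * (1 / (w - of_real x))" 1] by (simp add: remainder_def norm_divide)
      also have "\<dots> \<le> ((1 + \<bar>\<alpha>\<bar>) * \<bar>Im w\<bar>) * (1 / \<bar>Im w\<bar>) + 1"
        using inv cw by (intro add_right_mono mult_mono) auto
      also have "\<dots> = C" using Im by (simp add: C_def)
      finally show ?thesis using 1 by (simp add: e_def)
    qed
    have int: "integrable \<mu> (remainder w)"
    proof (rule PM_integrable[OF \<mu>, where B=C])
      have "e n p \<le> C" for p by (simp add: e_def)
      then show "cmod (remainder w (Some (of_real x))) \<le> C" for x by (rule order.trans[OF real])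
      show "cmod (remainder w None) \<le> C" using C by (simp add: remainder_def notin_range_Some)
    qed simp
    have m: "(LINT p|\<mu>. indicator (range Some) p) = complex_of_real (1 - measure \<mu> {None})"
    proof -
      have "range Some = space \<mu> - {None}" using sp by (auto simp: notin_range_Some)
      then have "measure \<mu> (range Some) = 1 - measure \<mu> {None}"
        using prob_compl[of "{None}"] infinity_sets s by simp
      moreover have "(LINT p|\<mu>. indicator (range Some) p :: complex) = (LINT p|\<mu>. complex_of_real (indicator (range Some) p))"
        by (rule arg_cong[where f="integral\<^sup>L \<mu>"]) (auto simp: indicator_def)
      moreover have "(LINT p|\<mu>. complex_of_real (indicator (range Some) p)) = of_real (measure \<mu> (range Some))"
        using sp by simp
      ultimately show ?thesis by (simp only:)
    qed
    have "(LINT p|\<mu>. remainder w p) = w * G \<mu> w - of_real (1 - measure \<mu> {None})"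
    proof -
      have "integrable \<mu> (\<lambda>p. w * ker w p)" using Im by (simp add: ker_integrable \<mu>)
      moreover have "integrable \<mu> (\<lambda>p. indicator (range Some) p :: complex)"
        by (rule PM_integrable[OF \<mu>, where B=1]) (use plane_sets in \<open>auto simp: indicator_def\<close>)
      ultimately show ?thesis unfolding remainder_def cauchy_ker m[symmetric] by simp
    qed
    moreover have "cmod (LINT p|\<mu>. remainder w p) \<le> (LINT p|\<mu>. e n p)"
    proof -
      have "cmod (LINT p|\<mu>. remainder w p) \<le> (LINT p|\<mu>. cmod (remainder w p))" by (rule integral_norm_bound)
      also have "\<dots> \<le> (LINT p|\<mu>. e n p)"
      proof (rule integral_mono_AE)
        show "integrable \<mu> (e n)"
          by (rule PM_integrable[OF \<mu>, where B=C]) (use eb in auto)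
        show "AE p in \<mu>. cmod (remainder w p) \<le> e n p"
          using \<mu> by (rule PM_AE) (use real C in \<open>simp_all add: remainder_def notin_range_Some e_def real_point_def\<close>)
      qed (rule integrable_norm[OF int])
      finally show ?thesis .
    qed
    ultimately show ?thesis using n(2) by simp
  qed
  then show ?thesis using n(1) by (intro exI[of _ "real n"]) auto
qed

text \<open>
  Without mass at infinity the barycentre is negligible compared with \<open>w\<close> in Stolz angles. Both the
  local inversion of \<open>G\<close> and the existence of free powers rest on this.
\<close>

lemma barycentre_stolz:
  assumes \<mu>: "\<mu> \<in> prob_measures real_line" and "\<epsilon> > 0"
  shows "\<exists>\<beta>>0. \<forall>w. Im w \<ge> \<beta> \<and> \<bar>Re w\<bar> \<le> \<alpha> * Im w \<longrightarrow> cmod (barycentre \<mu> w) \<le> \<epsilon> * Im w"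
proof -
  define C where "C = 1 + \<bar>\<alpha>\<bar>"
  have C: "C > 0" by (simp add: C_def)
  define e where "e = min (1/2) (\<epsilon> / (2 * C))"
  have e: "e > 0" "e \<le> 1/2" "2 * e * C \<le> \<epsilon>"
  proof -
    show "e > 0" using \<open>\<epsilon> > 0\<close> C by (simp add: e_def)
    show "e \<le> 1/2" by (simp add: e_def)
    have "e \<le> \<epsilon> / (2 * C)" by (simp add: e_def)
    then show "2 * e * C \<le> \<epsilon>" using C by (simp add: field_simps)
  qed
  obtain \<beta> where \<beta>: "\<beta> > 0" "\<And>w. \<bar>Im w\<bar> \<ge> \<beta> \<and> \<bar>Re w\<bar> \<le> \<alpha> * \<bar>Im w\<bar> \<Longrightarrow> cmod (w * G \<mu> w - 1) \<le> e"
    using cauchy_stolz_limit[OF real_lineD(1)[OF \<mu>] e(1), of \<alpha>] real_lineD(2)[OF \<mu>] by auto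
  have "cmod (barycentre \<mu> w) \<le> \<epsilon> * Im w" if w: "Im w \<ge> \<beta>" "\<bar>Re w\<bar> \<le> \<alpha> * Im w" for w
  proof -
    have Im: "Im w > 0" using w \<beta> by linarith
    define d where "d = w * G \<mu> w - 1"
    have d: "cmod d \<le> e" unfolding d_def using \<beta>(2)[of w] w Im by simp
    have G: "G \<mu> w \<noteq> 0" using cauchy_nonzero real_lineD[OF \<mu>] Im by simp
    have "barycentre \<mu> w * (1 + d) = w * d"
      using G by (simp add: barycentre_def d_def field_simps)
    then have "cmod (barycentre \<mu> w) * cmod (1 + d) = cmod w * cmod d" by (metis norm_mult)
    moreover have "1 / 2 \<le> cmod (1 + d)" using norm_triangle_ineq2[of 1 "- d"] d e by simp
    then have "cmod (barycentre \<mu> w) * (1 / 2) \<le> cmod (barycentre \<mu> w) * cmod (1 + d)"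
      by (intro mult_left_mono) auto
    moreover have "cmod w * cmod d \<le> cmod w * e" using d by (intro mult_left_mono) auto
    ultimately have "cmod (barycentre \<mu> w) \<le> 2 * (cmod w * e)" by linarith
    then have 1: "cmod (barycentre \<mu> w) \<le> (2 * e) * cmod w" by (simp add: mult_ac)
    have "\<alpha> * Im w \<le> \<bar>\<alpha>\<bar> * Im w" using Im by (intro mult_right_mono) auto
    then have "cmod w \<le> C * Im w"
      using cmod_le[of w] w(2) Im unfolding C_def distrib_right by linarith
    then have "(2 * e) * cmod w \<le> (2 * e) * (C * Im w)" using e by (intro mult_left_mono) auto
    also have "\<dots> = (2 * e * C) * Im w" by simp
    also have "\<dots> \<le> \<epsilon> * Im w" using e Im by (intro mult_right_mono) auto
    finally show ?thesis using 1 by simp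
  qed
  then show ?thesis using \<beta>(1) by blast
qed

text \<open>
  If \<open>G\<close> takes the same value at two points, then the barycentre differs by as much as the points do.
  The Schwarz--Pick inequality forbids this where the barycentre is small.
\<close>

lemma cauchy_inj_stolz:
  assumes \<mu>: "\<mu> \<in> prob_measures real_line"
  obtains \<beta> where "\<beta> > 0" "inj_on (G \<mu>) (stolz_infinity 1 \<beta>)"
proof -
  obtain \<beta> where \<beta>: "\<beta> > 0" "\<And>w. Im w \<ge> \<beta> \<and> \<bar>Re w\<bar> \<le> 1 * Im w \<Longrightarrow> cmod (barycentre \<mu> w) \<le> (1/2) * Im w"
    using barycentre_stolz[OF \<mu>, of "1/2" 1] by auto
  note PM = real_lineD(1,3)[OF \<mu>]
  have "inj_on (G \<mu>) (stolz_infinity 1 \<beta>)"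
  proof (rule inj_onI, rule ccontr)
    fix w v assume a: "w \<in> stolz_infinity 1 \<beta>" "v \<in> stolz_infinity 1 \<beta>"
      "G \<mu> w = G \<mu> v" "w \<noteq> v"
    have b: "Im u > 0 \<and> \<bar>Im (barycentre \<mu> u)\<bar> < Im u" if "u \<in> stolz_infinity 1 \<beta>" for u
      using that \<beta>(2)[of u] \<beta>(1) abs_Im_le_cmod[of "barycentre \<mu> u"] by (auto simp: stolz_infinity_def)
    note w = b[OF a(1)] and v = b[OF a(2)]
    have "barycentre \<mu> w - barycentre \<mu> v = w - v" using a(3) by (simp add: barycentre_def)
    then have "(cmod (w - v))\<^sup>2 * (Im w * Im v) \<le> (cmod (w - v))\<^sup>2 * (Im (barycentre \<mu> w) * Im (barycentre \<mu> v))"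
      using barycentre_Pick[OF PM, of w v] w v by simp
    also have "Im (barycentre \<mu> w) * Im (barycentre \<mu> v) \<le> \<bar>Im (barycentre \<mu> w)\<bar> * \<bar>Im (barycentre \<mu> v)\<bar>"
      by (metis abs_ge_self abs_mult)
    then have "(cmod (w - v))\<^sup>2 * (Im (barycentre \<mu> w) * Im (barycentre \<mu> v)) \<le> (cmod (w - v))\<^sup>2 * (\<bar>Im (barycentre \<mu> w)\<bar> * \<bar>Im (barycentre \<mu> v)\<bar>)"
      by (intro mult_left_mono) auto
    also have "\<dots> < (cmod (w - v))\<^sup>2 * (Im w * Im v)"
      using w v a(4) by (intro mult_strict_left_mono mult_strict_mono') auto
    finally show False by simp
  qed
  then show ?thesis using that \<beta>(1) by blast
qed

lemma stolz_infinity_mono: "\<alpha> \<le> \<alpha>' \<Longrightarrow> 0 \<le> \<beta>' \<Longrightarrow> \<beta>' \<le> \<beta> \<Longrightarrow> stolz_infinity \<alpha> \<beta> \<subseteq> stolz_infinity \<alpha>' \<beta>'"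
proof
  fix w assume a: "\<alpha> \<le> \<alpha>'" "0 \<le> \<beta>'" "\<beta>' \<le> \<beta>" "w \<in> stolz_infinity \<alpha> \<beta>"
  then have "\<alpha> * Im w \<le> \<alpha>' * Im w" by (intro mult_right_mono) (auto simp: stolz_infinity_def)
  then show "w \<in> stolz_infinity \<alpha>' \<beta>'" using a unfolding stolz_infinity_def mem_Collect_eq by linarith
qed

text \<open>
  A preimage of \<open>1 / p\<close> is a fixed point of \<open>w \<mapsto> p + barycentre \<mu> w\<close>. This map sends a small disc around
  \<open>p\<close> to itself, so Brouwer's theorem applies.
\<close>

lemma cauchy_image_stolz:
  assumes \<mu>: "\<mu> \<in> prob_measures real_line" and "\<alpha> > 0" "\<beta> > 0"
  shows "\<exists>\<gamma>>0. \<exists>\<delta>>0. stolz_zero \<gamma> \<delta> \<subseteq> G \<mu> ` stolz_infinity \<alpha> \<beta>"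
proof -
  note PM = real_lineD(1,3)[OF \<mu>]
  \<comment> \<open>The disc around \<open>p\<close> has radius \<open>\<eta> * Im p\<close>; these constants keep it in the Stolz angle when \<open>p\<close> lies in the one of opening \<open>\<alpha> / 4\<close>.\<close>
  define \<eta> where "\<eta> = min (1/2) (\<alpha> / 8)"
  have \<eta>: "\<eta> > 0" "\<eta> \<le> 1/2" "\<eta> \<le> \<alpha> / 8" using \<open>\<alpha> > 0\<close> by (auto simp: \<eta>_def)
  obtain \<beta>' where \<beta>': "\<beta>' > 0" "\<And>w. Im w \<ge> \<beta>' \<and> \<bar>Re w\<bar> \<le> \<alpha> * Im w \<Longrightarrow> cmod (barycentre \<mu> w) \<le> (\<eta> / 2) * Im w"
    using barycentre_stolz[OF \<mu>, of "\<eta> / 2" \<alpha>] \<eta> by auto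
  define \<delta> where "\<delta> = 2 * max \<beta> \<beta>'"
  have \<delta>: "\<delta> > 0" "\<delta> / 2 \<ge> \<beta>" "\<delta> / 2 \<ge> \<beta>'" using \<open>\<beta> > 0\<close> by (auto simp: \<delta>_def)
  have "stolz_zero (\<alpha> / 4) \<delta> \<subseteq> G \<mu> ` stolz_infinity \<alpha> \<beta>"
  proof
    fix g assume g: "g \<in> stolz_zero (\<alpha> / 4) \<delta>"
    define p where "p = 1 / g"
    have p: "Im p > \<delta>" "\<bar>Re p\<bar> < \<alpha> / 4 * Im p"
      using g by (auto simp: p_def stolz_zero_def stolz_infinity_def)
    have Imp: "Im p > 0" using p(1) \<delta>(1) by linarith
    define r where "r = \<eta> * Im p"
    have r: "r > 0" "r \<le> Im p / 2" "r \<le> \<alpha> / 8 * Im p"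
      using \<eta> Imp mult_right_mono[OF \<eta>(2), of "Im p"] mult_right_mono[OF \<eta>(3), of "Im p"] by (auto simp: r_def)
    have near: "Im w > \<delta> / 2 \<and> Im w > 0 \<and> \<bar>Re w\<bar> < \<alpha> * Im w \<and> cmod (barycentre \<mu> w) \<le> r" if "w \<in> cball p r" for w
    proof -
      have d: "cmod (w - p) \<le> r" using that by (simp add: dist_norm norm_minus_commute)
      have im: "\<bar>Im w - Im p\<bar> \<le> r" using abs_Im_le_cmod[of "w - p"] d by simp
      have re: "\<bar>Re w - Re p\<bar> \<le> r" using abs_Re_le_cmod[of "w - p"] d by simp
      have w1: "Im w \<ge> Im p / 2" "Im w \<le> 2 * Im p" using im r Imp by linarith+
      have "\<bar>Re w\<bar> < \<alpha> / 4 * Im p + \<alpha> / 8 * Im p" using re r p(2) by linarith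
      also have "\<dots> = (3/4 * \<alpha>) * (Im p / 2)" by simp
      also have "\<dots> \<le> (3/4 * \<alpha>) * Im w" using w1 \<open>\<alpha> > 0\<close> by (intro mult_left_mono) auto
      also have "\<dots> \<le> \<alpha> * Im w" using w1 Imp \<open>\<alpha> > 0\<close> by (intro mult_right_mono) auto
      finally have w2: "\<bar>Re w\<bar> < \<alpha> * Im w" .
      have w3: "Im w > \<delta> / 2" using w1 p by linarith
      have "cmod (barycentre \<mu> w) \<le> (\<eta> / 2) * Im w" by (rule \<beta>'(2)) (use w2 w3 \<delta> in auto)
      also have "\<dots> \<le> (\<eta> / 2) * (2 * Im p)" using w1 \<eta> by (intro mult_left_mono) auto
      also have "\<dots> = r" by (simp add: r_def)
      finally show ?thesis using w2 w3 \<delta> by auto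
    qed
    have "continuous_on (cball p r) (\<lambda>w. p + barycentre \<mu> w)"
      by (intro continuous_intros continuous_on_subset[OF holomorphic_on_imp_continuous_on[OF barycentre_holomorphic[OF PM]]])
        (use near in force)
    then obtain w where w: "w \<in> cball p r" "p + barycentre \<mu> w = w"
      using brouwer[of "cball p r" "\<lambda>w. p + barycentre \<mu> w"] r near by (auto simp: dist_norm)
    have "G \<mu> w \<noteq> 0" using cauchy_nonzero[OF PM] near[OF w(1)] by simp
    moreover have "1 / G \<mu> w = p" using w(2) by (simp add: barycentre_def algebra_simps)
    ultimately have "G \<mu> w = g" by (auto simp: p_def field_simps)
    moreover have "w \<in> stolz_infinity \<alpha> \<beta>" using near[OF w(1)] \<delta> by (auto simp: stolz_infinity_def)
    ultimately show "g \<in> G \<mu> ` stolz_infinity \<alpha> \<beta>" by blast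
  qed
  then show ?thesis using \<open>\<alpha> > 0\<close> \<delta>(1) by (intro exI[of _ "\<alpha> / 4"] exI[of _ \<delta>] conjI) auto
qed

lemma open_stolz_infinity: "open (stolz_infinity \<alpha> \<beta>)"
proof -
  have "stolz_infinity \<alpha> \<beta> = {z. \<beta> < Im z} \<inter> {z. \<bar>Re z\<bar> < \<alpha> * Im z}" by (auto simp: stolz_infinity_def)
  then show ?thesis by (auto intro!: open_Int open_Collect_less continuous_intros)
qed

lemma stolz_zero_mono: "\<gamma> \<le> \<gamma>' \<Longrightarrow> 0 \<le> \<delta>' \<Longrightarrow> \<delta>' \<le> \<delta> \<Longrightarrow> stolz_zero \<gamma> \<delta> \<subseteq> stolz_zero \<gamma>' \<delta>'"
  using stolz_infinity_mono[of \<gamma> \<gamma>' \<delta>' \<delta>] by (auto simp: stolz_zero_def)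

lemma stolz_zero_nonempty:
  assumes "\<gamma> > 0" "\<delta> > 0" shows "\<exists>g. g \<in> stolz_zero \<gamma> \<delta>"
proof
  show "1 / Complex 0 (\<delta> + 1) \<in> stolz_zero \<gamma> \<delta>"
    using assms by (simp add: stolz_zero_def stolz_infinity_def)
qed

section \<open>Uniqueness of free powers\<close>

text \<open>
  The inverse of \<open>G\<close> at a given small value does not depend on the chosen Stolz angle, since a preimage
  exists in any smaller one. Hence the Cauchy transforms of two free powers agree on a nonempty open
  set, and by analytic continuation everywhere.
\<close>

lemma free_power_unique:
  assumes \<mu>: "\<mu> \<in> prob_measures real_line" and 1: "is_free_power t \<mu> \<nu>1" and 2: "is_free_power t \<mu> \<nu>2"
  shows "\<nu>1 = \<nu>2"
proof -
  have \<nu>: "\<nu>1 \<in> PM" "\<nu>2 \<in> PM" "\<nu>1 \<noteq> dirac None"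
    using 1 2 real_lineD by (auto simp: is_free_power_def)
  obtain \<gamma>1 \<delta>1 R1 where R1: "\<gamma>1 > 0" "\<delta>1 > 0" "is_R_transform_on \<mu> (stolz_zero \<gamma>1 \<delta>1) R1"
     "is_R_transform_on \<nu>1 (stolz_zero \<gamma>1 \<delta>1) (\<lambda>z. of_real t * R1 z)"
    using 1 unfolding is_free_power_def by blast
  obtain \<gamma>2 \<delta>2 R2 where R2: "\<gamma>2 > 0" "\<delta>2 > 0" "is_R_transform_on \<mu> (stolz_zero \<gamma>2 \<delta>2) R2"
     "is_R_transform_on \<nu>2 (stolz_zero \<gamma>2 \<delta>2) (\<lambda>z. of_real t * R2 z)"
    using 2 unfolding is_free_power_def by blast
  obtain \<alpha>1 \<beta>1 where S1: "\<alpha>1 > 0" "\<beta>1 > 0" "inj_on (G \<mu>) (stolz_infinity \<alpha>1 \<beta>1)"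
    "\<And>z. z \<in> stolz_zero \<gamma>1 \<delta>1 \<Longrightarrow> R1 z = the_inv_into (stolz_infinity \<alpha>1 \<beta>1) (G \<mu>) z - 1 / z"
    using R1(3) unfolding is_R_transform_on_def by blast
  obtain \<alpha>2 \<beta>2 where S2: "\<alpha>2 > 0" "\<beta>2 > 0" "inj_on (G \<mu>) (stolz_infinity \<alpha>2 \<beta>2)"
    "\<And>z. z \<in> stolz_zero \<gamma>2 \<delta>2 \<Longrightarrow> R2 z = the_inv_into (stolz_infinity \<alpha>2 \<beta>2) (G \<mu>) z - 1 / z"
    using R2(3) unfolding is_R_transform_on_def by blast
  obtain a1 b1 where T1: "a1 > 0" "b1 > 0" "inj_on (G \<nu>1) (stolz_infinity a1 b1)"
    "stolz_zero \<gamma>1 \<delta>1 \<subseteq> G \<nu>1 ` stolz_infinity a1 b1"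
    "\<And>z. z \<in> stolz_zero \<gamma>1 \<delta>1 \<Longrightarrow> of_real t * R1 z = the_inv_into (stolz_infinity a1 b1) (G \<nu>1) z - 1 / z"
    using R1(4) unfolding is_R_transform_on_def by blast
  obtain a2 b2 where T2: "a2 > 0" "b2 > 0" "inj_on (G \<nu>2) (stolz_infinity a2 b2)"
    "stolz_zero \<gamma>2 \<delta>2 \<subseteq> G \<nu>2 ` stolz_infinity a2 b2"
    "\<And>z. z \<in> stolz_zero \<gamma>2 \<delta>2 \<Longrightarrow> of_real t * R2 z = the_inv_into (stolz_infinity a2 b2) (G \<nu>2) z - 1 / z"
    using R2(4) unfolding is_R_transform_on_def by blast
  obtain \<gamma>0 \<delta>0 where D0: "\<gamma>0 > 0" "\<delta>0 > 0"
    "stolz_zero \<gamma>0 \<delta>0 \<subseteq> G \<mu> ` stolz_infinity (min \<alpha>1 \<alpha>2) (max \<beta>1 \<beta>2)"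
    using cauchy_image_stolz[OF \<mu>, of "min \<alpha>1 \<alpha>2" "max \<beta>1 \<beta>2"] S1(1,2) S2(1,2) by (auto simp: less_max_iff_disj)
  define \<gamma> where "\<gamma> = min \<gamma>0 (min \<gamma>1 \<gamma>2)"
  define \<delta> where "\<delta> = max \<delta>0 (max \<delta>1 \<delta>2)"
  have gd: "\<gamma> > 0" "\<delta> > 0" using R1(1,2) R2(1,2) D0(1,2) by (auto simp: \<gamma>_def \<delta>_def)
  define D where "D = stolz_zero \<gamma> \<delta>"
  have D: "D \<subseteq> stolz_zero \<gamma>0 \<delta>0" "D \<subseteq> stolz_zero \<gamma>1 \<delta>1" "D \<subseteq> stolz_zero \<gamma>2 \<delta>2"
    unfolding D_def by (rule stolz_zero_mono; use R1(1,2) R2(1,2) D0(1,2) in \<open>simp add: \<gamma>_def \<delta>_def\<close>)+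
  have eq: "the_inv_into (stolz_infinity a1 b1) (G \<nu>1) g = the_inv_into (stolz_infinity a2 b2) (G \<nu>2) g" if g: "g \<in> D" for g
  proof -
    obtain w where w: "w \<in> stolz_infinity (min \<alpha>1 \<alpha>2) (max \<beta>1 \<beta>2)" "G \<mu> w = g"
      using g D(1) D0(3) by blast
    have "w \<in> stolz_infinity \<alpha>1 \<beta>1" "w \<in> stolz_infinity \<alpha>2 \<beta>2"
      using w(1) stolz_infinity_mono[of "min \<alpha>1 \<alpha>2" \<alpha>1 \<beta>1 "max \<beta>1 \<beta>2"] S1(2) S2(2)
        stolz_infinity_mono[of "min \<alpha>1 \<alpha>2" \<alpha>2 \<beta>2 "max \<beta>1 \<beta>2"] by auto
    then have "the_inv_into (stolz_infinity \<alpha>1 \<beta>1) (G \<mu>) g = w" "the_inv_into (stolz_infinity \<alpha>2 \<beta>2) (G \<mu>) g = w"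
      using the_inv_into_f_f[OF S1(3)] the_inv_into_f_f[OF S2(3)] w(2) by auto
    then have "R1 g = R2 g" using S1(4)[of g] S2(4)[of g] subsetD[OF D(2) g] subsetD[OF D(3) g] by simp
    then have "the_inv_into (stolz_infinity a1 b1) (G \<nu>1) g - 1 / g = the_inv_into (stolz_infinity a2 b2) (G \<nu>2) g - 1 / g"
      using T1(5)[of g] T2(5)[of g] subsetD[OF D(2) g] subsetD[OF D(3) g] by simp
    then show ?thesis by simp
  qed
  define V where "V = {v \<in> stolz_infinity a1 b1. 1 / G \<nu>1 v \<in> stolz_infinity \<gamma> \<delta>}"
  have S_up: "stolz_infinity a1 b1 \<subseteq> upper" using T1(2) by (auto simp: stolz_infinity_def)
  have "continuous_on (stolz_infinity a1 b1) (\<lambda>v. 1 / G \<nu>1 v)"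
    using S_up cauchy_nonzero[OF \<nu>(1,3)]
    by (intro continuous_intros continuous_on_subset[OF holomorphic_on_imp_continuous_on[OF cauchy_holomorphic[OF \<nu>(1)]]]) force+
  from continuous_open_preimage[OF this open_stolz_infinity open_stolz_infinity[of \<gamma> \<delta>]]
  have openV: "open V" unfolding V_def by (simp add: Int_def vimage_def)
  have V: "G \<nu>1 v = G \<nu>2 v" if v: "v \<in> V" for v
  proof -
    define g where "g = G \<nu>1 v"
    have g: "g \<in> D" using v by (simp add: V_def D_def stolz_zero_def g_def)
    have "the_inv_into (stolz_infinity a1 b1) (G \<nu>1) g = v"
      using the_inv_into_f_f[OF T1(3)] v by (simp add: V_def g_def)
    then have "the_inv_into (stolz_infinity a2 b2) (G \<nu>2) g = v" using eq[OF g] by simp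
    moreover have "g \<in> G \<nu>2 ` stolz_infinity a2 b2" using g D(3) T2(4) by blast
    ultimately show ?thesis using f_the_inv_into_f[OF T2(3), of g] by (simp add: g_def)
  qed
  have "V \<noteq> {}"
  proof -
    obtain g where g: "g \<in> D" using stolz_zero_nonempty[OF gd] by (auto simp: D_def)
    then obtain v where "v \<in> stolz_infinity a1 b1" "G \<nu>1 v = g" using D(2) T1(4) by blast
    then have "v \<in> V" using g by (simp add: V_def D_def stolz_zero_def)
    then show ?thesis by blast
  qed
  show ?thesis
  proof (rule cauchy_transform_inj[OF \<nu>(1,2)])
    fix z assume z: "Im z > 0"
    show "G \<nu>1 z = G \<nu>2 z"
    proof (rule analytic_continuation_open[where s=V and s'=upper and f="G \<nu>1" and g="G \<nu>2"])
      show "G \<nu>1 holomorphic_on upper" "G \<nu>2 holomorphic_on upper"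
        by (rule holomorphic_on_subset[OF cauchy_holomorphic]; use \<nu> in force)+
      show "V \<subseteq> upper" using S_up by (auto simp: V_def)
    qed (use openV open_upper connected_upper \<open>V \<noteq> {}\<close> V z in simp_all)
  qed
qed

section \<open>Existence of free powers\<close>

definition real_affine :: "real \<Rightarrow> real \<Rightarrow> sphere \<Rightarrow> sphere" where
  "real_affine c d = map_option (\<lambda>x. of_real c * x + of_real d)"

lemma real_affine_simps [simp]:
  "real_affine c d None = None" "real_affine c d (Some x) = Some (of_real c * x + of_real d)"
  by (simp_all add: real_affine_def)

lemma real_affine_measurable [measurable]: "real_affine c d \<in> measurable sphere_borel sphere_borel"
  unfolding real_affine_def by (intro map_option_measurable) measurable

lemma real_affine_real_line: "real_affine c d ` real_line \<subseteq> real_line"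
  by (auto simp: real_line_def)

lemma cauchy_pushforward:
  assumes "\<mu> \<in> prob_measures K" "T \<in> measurable sphere_borel sphere_borel"
  shows "G (pushforward T \<mu>) z = (LINT p|\<mu>. ker z (T p))"
  unfolding cauchy_ker pushforward_def
  by (rule integral_distr)
     (use assms measurable_cong_sets[OF prob_measures_sets[OF assms(1)] refl] in auto)

lemma cauchy_real_affine:
  assumes "\<mu> \<in> prob_measures K" "c \<noteq> 0"
  shows "G (pushforward (real_affine c d) \<mu>) z = G \<mu> ((z - of_real d) / of_real c) / of_real c"
proof -
  have "1 / (z - (of_real c * x + of_real d)) = 1 / ((z - of_real d) / of_real c - x) / of_real c" for x
  proof -
    have "(z - of_real d) / of_real c - x = (z - (of_real c * x + of_real d)) / of_real c"
      using assms(2) by (simp add: diff_divide_distrib add_divide_distrib)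
    then show ?thesis using assms(2) by simp
  qed
  then have "ker z (real_affine c d p) = ker ((z - of_real d) / of_real c) p / of_real c" for p
    by (cases p) simp_all
  then show ?thesis
    unfolding cauchy_pushforward[OF assms(1) real_affine_measurable] by (simp add: cauchy_ker)
qed

lemma compression_inj:
  assumes \<mu>: "\<mu> \<in> PM" "\<mu> \<noteq> dirac None" and t: "t \<ge> 1" and w: "Im w > 0" and v: "Im v > 0"
    and eq: "w + of_real (t - 1) * barycentre \<mu> w = z" "v + of_real (t - 1) * barycentre \<mu> v = z" and z: "Im z > 0"
  shows "w = v"
proof -
  interpret P: pick_map "\<lambda>w. - of_real (t - 1) * barycentre \<mu> w" by (rule pick_map_barycentre[OF \<mu> t])
  have e: "u - (- of_real (t - 1) * barycentre \<mu> u) = u + of_real (t - 1) * barycentre \<mu> u" for u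
    by (simp only: mult_minus_left diff_minus_eq_add)
  show ?thesis by (rule P.inj[OF w _ v]) (simp_all only: e eq z)
qed

text \<open>
  The free power rescaled by \<open>1 / t\<close>, characterised by subordination: seen from \<open>z\<close>, the measure \<open>\<nu>\<close> has
  the same barycentre as \<open>\<mu>\<close> seen from \<open>w\<close>, and \<open>w\<close> is the stretching of \<open>z\<close> from this barycentre with
  factor \<open>t\<close>.
\<close>

locale free_compression =
  fixes \<mu> :: "sphere measure" and t :: real and \<nu> :: "sphere measure"
  assumes \<mu>: "\<mu> \<in> prob_measures real_line" and t: "t \<ge> 1" and \<nu>: "\<nu> \<in> prob_measures real_line"
    and ex: "Im z > 0 \<Longrightarrow> \<exists>w. Im w > 0 \<and> w + of_real (t - 1) * barycentre \<mu> w = of_real t * z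
        \<and> G \<nu> z = of_real t * G \<mu> w"
begin

lemma at_point:
  assumes w: "Im w > 0" "Im (w + of_real (t - 1) * barycentre \<mu> w) > 0"
  shows "G \<nu> ((w + of_real (t - 1) * barycentre \<mu> w) / of_real t) = of_real t * G \<mu> w"
proof -
  define z where "z = (w + of_real (t - 1) * barycentre \<mu> w) / of_real t"
  have tz: "of_real t * z = w + of_real (t - 1) * barycentre \<mu> w" using t by (simp add: z_def)
  have "t * Im z = Im (of_real t * z)" by simp
  then have "t * Im z > 0" using w(2) tz by simp
  then have z: "Im z > 0" using t by (simp add: zero_less_mult_iff)
  obtain w' where w': "Im w' > 0" "w' + of_real (t - 1) * barycentre \<mu> w' = of_real t * z"
    "G \<nu> z = of_real t * G \<mu> w'" using ex[OF z] by blast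
  have "Im (of_real t * z) > 0" using w(2) tz by simp
  then have "w' = w"
    using compression_inj[OF real_lineD(1,3)[OF \<mu>] t w'(1) w(1) w'(2) tz[symmetric]] by simp
  then show ?thesis using w'(3) by (simp add: z_def)
qed

text \<open>
  Rescaling turns the subordination equation into \<open>v = w + (t - 1) k\<close>, where \<open>k\<close> is the common barycentre.
  The common value \<open>g\<close> satisfies \<open>1 / g = w - k\<close>, so that \<open>v - 1 / g = t k\<close> and \<open>w - 1 / g = k\<close> are the
  two R-transforms.
\<close>

lemma is_free_power: "is_free_power t \<mu> (pushforward (real_affine t 0) \<nu>)"
proof -
  let ?\<nu> = "pushforward (real_affine t 0) \<nu>"
  have \<nu>': "?\<nu> \<in> prob_measures real_line"
    by (rule pushforward_prob_measures[OF \<nu> real_affine_measurable real_line_sets real_line_sets real_affine_real_line])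
  have G\<nu>': "G ?\<nu> (of_real t * z) = G \<nu> z / of_real t" for z
    using cauchy_real_affine[OF \<nu>, of t 0 "of_real t * z"] t by simp
  obtain b1 where b1: "b1 > 0" "inj_on (G \<mu>) (stolz_infinity 1 b1)" using cauchy_inj_stolz[OF \<mu>] .
  obtain b2 where b2: "b2 > 0" "inj_on (G ?\<nu>) (stolz_infinity 1 b2)" using cauchy_inj_stolz[OF \<nu>'] .
  obtain b3 where b3: "b3 > 0" "\<And>w. Im w \<ge> b3 \<and> \<bar>Re w\<bar> \<le> 1 * Im w \<Longrightarrow> cmod (barycentre \<mu> w) \<le> (1 / (4 * t)) * Im w"
    using barycentre_stolz[OF \<mu>, of "1 / (4 * t)" 1] t by auto
  define b where "b = max b1 (max (2 * b2) b3)"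
  have b: "b > 0" "b \<ge> b1" "b \<ge> 2 * b2" "b \<ge> b3" using b1 by (auto simp: b_def)
  obtain \<gamma> \<delta> where gd: "\<gamma> > 0" "\<delta> > 0" "stolz_zero \<gamma> \<delta> \<subseteq> G \<mu> ` stolz_infinity (1/4) b"
    using cauchy_image_stolz[OF \<mu>, of "1/4" b] b by auto
  define R where "R g = the_inv_into (stolz_infinity 1 b1) (G \<mu>) g - 1 / g" for g
  have sub: "stolz_infinity (1/4) b \<subseteq> stolz_infinity 1 b1"
    by (rule stolz_infinity_mono) (use b b1 in auto)
  have 1: "is_R_transform_on \<mu> (stolz_zero \<gamma> \<delta>) R"
    unfolding is_R_transform_on_def
  proof (rule exI[of _ 1], intro conjI, simp, rule exI[of _ b1], intro conjI ballI)
    show "stolz_zero \<gamma> \<delta> \<subseteq> G \<mu> ` stolz_infinity 1 b1" by (rule order.trans[OF gd(3) image_mono[OF sub]])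
  qed (use b1 in \<open>simp_all add: R_def\<close>)
  have key: "g \<in> G ?\<nu> ` stolz_infinity 1 b2 \<and>
      of_real t * R g = the_inv_into (stolz_infinity 1 b2) (G ?\<nu>) g - 1 / g" if g: "g \<in> stolz_zero \<gamma> \<delta>" for g
  proof -
    obtain w where w: "w \<in> stolz_infinity (1/4) b" "G \<mu> w = g" using g gd(3) by blast
    have Im: "Im w > b" "\<bar>Re w\<bar> < 1/4 * Im w" "Im w > 0" using w(1) b(1) by (auto simp: stolz_infinity_def)
    define k where "k = barycentre \<mu> w"
    have "cmod k \<le> (1 / (4 * t)) * Im w" unfolding k_def by (rule b3(2)) (use Im b in auto)
    then have "cmod (of_real (t - 1) * k) \<le> (t - 1) * ((1 / (4 * t)) * Im w)"
      using t unfolding norm_mult norm_of_real by (intro mult_mono) auto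
    also have "\<dots> = ((t - 1) / t) * (1/4 * Im w)" using t by simp
    also have "\<dots> \<le> 1 * (1/4 * Im w)" using t Im by (intro mult_right_mono) auto
    finally have ck: "cmod (of_real (t - 1) * k) \<le> 1/4 * Im w" by simp
    define v where "v = w + of_real (t - 1) * k"
    have "\<bar>Im (of_real (t - 1) * k)\<bar> \<le> 1/4 * Im w" "\<bar>Re (of_real (t - 1) * k)\<bar> \<le> 1/4 * Im w"
      using ck abs_Im_le_cmod[of "of_real (t - 1) * k"] abs_Re_le_cmod[of "of_real (t - 1) * k"] by linarith+
    moreover have "Im v = Im w + Im (of_real (t - 1) * k)" "Re v = Re w + Re (of_real (t - 1) * k)"
      by (simp_all add: v_def)
    ultimately have v: "Im v \<ge> 3/4 * Im w" "\<bar>Re v\<bar> < 1/2 * Im w" using Im by linarith+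
    have vS: "v \<in> stolz_infinity 1 b2"
      unfolding stolz_infinity_def mem_Collect_eq using v Im b b2(1) by (intro conjI; linarith)
    have "G \<nu> (v / of_real t) = of_real t * g"
      unfolding v_def k_def w(2)[symmetric] by (rule at_point) (use v Im in \<open>auto simp: v_def k_def\<close>)
    then have Gv: "G ?\<nu> v = g" using G\<nu>'[of "v / of_real t"] t by simp
    have "the_inv_into (stolz_infinity 1 b2) (G ?\<nu>) g = v"
      using the_inv_into_f_f[OF b2(2) vS] Gv by simp
    moreover have "the_inv_into (stolz_infinity 1 b1) (G \<mu>) g = w"
      using the_inv_into_f_f[OF b1(2)] w sub by blast
    moreover have wk: "w = k + 1 / g" using w(2) by (simp add: k_def barycentre_def)
    have "of_real t * (w - 1 / g) = v - 1 / g" unfolding v_def wk by (simp add: algebra_simps)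
    moreover have "g \<in> G ?\<nu> ` stolz_infinity 1 b2" using imageI[OF vS, of "G ?\<nu>"] Gv by simp
    ultimately show ?thesis by (simp add: R_def)
  qed
  have 2: "is_R_transform_on ?\<nu> (stolz_zero \<gamma> \<delta>) (\<lambda>z. of_real t * R z)"
    unfolding is_R_transform_on_def
  proof (rule exI[of _ 1], intro conjI, simp, rule exI[of _ b2], intro conjI ballI)
    show "stolz_zero \<gamma> \<delta> \<subseteq> G ?\<nu> ` stolz_infinity 1 b2" using key by blast
  qed (use b2 key in simp_all)
  show ?thesis unfolding is_free_power_def using \<nu>' gd(1,2) 1 2 by blast
qed

lemma F_real_eq: "F_real t \<mu> = \<nu>"
proof -
  have "free_power t \<mu> = pushforward (real_affine t 0) \<nu>"
    unfolding free_power_def by (rule the_equality[where P="is_free_power t \<mu>", OF is_free_power]) (rule free_power_unique[OF \<mu> _ is_free_power])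
  moreover have e: "map_option (\<lambda>x. x / complex_of_real t) = real_affine (1 / t) 0" by (simp add: real_affine_def)
  ultimately have "F_real t \<mu> = pushforward (real_affine (1 / t) 0 \<circ> real_affine t 0) \<nu>"
    unfolding F_real_def by (simp add: pushforward_pushforward[OF \<nu>])
  also have "\<dots> = \<nu>"
    proof (rule pushforward_id[OF \<nu>])
    fix p show "(real_affine (1 / t) 0 \<circ> real_affine t 0) p = p" using t by (cases p) auto
  qed
  finally show ?thesis .
qed

end

text \<open>
  The global inverse provides \<open>w\<close> as a holomorphic function of \<open>z\<close>, and the barycentre of \<open>\<mu>\<close> seen from \<open>w\<close>
  is the barycentre map of some measure on the extended real line. This measure has no mass at
  infinity, as its Cauchy transform at the points \<open>z\<close> that belong to \<open>w = i v\<close> shows.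
\<close>

lemma free_compression_exists:
  assumes \<mu>: "\<mu> \<in> prob_measures real_line" and t: "t \<ge> 1"
  shows "\<exists>\<nu>. free_compression \<mu> t \<nu>"
proof -
  note PM = real_lineD(1,3)[OF \<mu>]
  interpret P: pick_map "\<lambda>w. - of_real (t - 1) * barycentre \<mu> w"
    by (rule pick_map_barycentre[OF PM t])
  obtain b where b: "b > 0" "\<And>w. Im w \<ge> b \<and> \<bar>Re w\<bar> \<le> 1 * Im w \<Longrightarrow> cmod (barycentre \<mu> w) \<le> (1 / (2 * t)) * Im w"
    using barycentre_stolz[OF \<mu>, of "1 / (2 * t)" 1] t by auto
  have small: "cmod (of_real (t - 1) * barycentre \<mu> w) \<le> 1/2 * Im w" if w: "Im w \<ge> b" "Re w = 0" for w
  proof -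
    have Im: "Im w > 0" using w b(1) by simp
    have "cmod (of_real (t - 1) * barycentre \<mu> w) \<le> (t - 1) * ((1 / (2 * t)) * Im w)"
      using t b(2)[of w] w Im unfolding norm_mult norm_of_real by (intro mult_mono) auto
    also have "\<dots> = ((t - 1) / t) * (1/2 * Im w)" using t by simp
    also have "\<dots> \<le> 1 * (1/2 * Im w)" using t Im by (intro mult_right_mono) auto
    finally show ?thesis by simp
  qed
  have H: "Im (w + of_real (t - 1) * barycentre \<mu> w) \<ge> 1/2 * Im w" if w: "Im w \<ge> b" "Re w = 0" for w
    using small[OF w] abs_Im_le_cmod[of "of_real (t - 1) * barycentre \<mu> w"]
    unfolding plus_complex.sel(2) by linarith
  have "Im (Complex 0 b + of_real (t - 1) * barycentre \<mu> (Complex 0 b)) \<ge> 1/2 * b"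
    using H[of "Complex 0 b"] by (simp only: complex.sel order_refl simp_thms)
  then have "Complex 0 b \<in> P.kept"
    unfolding P.kept_def mem_Collect_eq upper_iff
    unfolding mult_minus_left diff_minus_eq_add
    using b(1) by (intro conjI) (simp, linarith)
  from P.inverse[OF this] obtain \<omega> where \<omega>': "\<omega> holomorphic_on upper" "\<And>z. Im z > 0 \<Longrightarrow> Im (\<omega> z) > 0"
    "\<And>z. Im z > 0 \<Longrightarrow> \<omega> z - (- of_real (t - 1) * barycentre \<mu> (\<omega> z)) = z" by blast
  have \<omega>: "\<omega> holomorphic_on upper" "\<And>z. Im z > 0 \<Longrightarrow> Im (\<omega> z) > 0"
    "\<And>z. Im z > 0 \<Longrightarrow> \<omega> z + of_real (t - 1) * barycentre \<mu> (\<omega> z) = z"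
    using \<omega>' by (simp_all only: mult_minus_left diff_minus_eq_add)
  define K where "K z = barycentre \<mu> (\<omega> (of_real t * z))" for z
  have tz: "Im (of_real t * z) > 0" if "Im z > 0" for z using that t by simp
  have K: "K holomorphic_on upper"
  proof -
    have "(\<omega> \<circ> (\<lambda>z. of_real t * z)) holomorphic_on upper"
      by (rule holomorphic_on_compose_gen[OF _ \<omega>(1)]) (use tz in \<open>auto intro!: holomorphic_intros\<close>)
    moreover have "Im (\<omega> (of_real t * z)) \<noteq> 0" if "Im z > 0" for z using \<omega>(2)[OF tz[OF that]] by simp
    then have "(\<omega> \<circ> (\<lambda>z. of_real t * z)) ` upper \<subseteq> {z. Im z \<noteq> 0}" by auto
    ultimately have "(barycentre \<mu> \<circ> (\<omega> \<circ> (\<lambda>z. of_real t * z))) holomorphic_on upper"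
      by (rule holomorphic_on_compose_gen[OF _ barycentre_holomorphic[OF PM]])
    then show ?thesis by (simp add: o_def K_def[abs_def])
  qed
  have Kn: "Im (K z) \<le> 0" if "Im z > 0" for z
    using barycentre_opposite[OF PM, of "\<omega> (of_real t * z)"] \<omega>(2)[OF tz[OF that]]
    by (auto simp: K_def mult_le_0_iff)
  obtain \<nu> where \<nu>: "\<nu> \<in> PM" "\<And>z. Im z > 0 \<Longrightarrow> G \<nu> z = 1 / (z - K z)"
    using measure_with_barycentre[OF K Kn] by blast
  have ex: "\<exists>w. Im w > 0 \<and> w + of_real (t - 1) * barycentre \<mu> w = of_real t * z
        \<and> G \<nu> z = of_real t * G \<mu> w" if z: "Im z > 0" for z
  proof (intro exI conjI)
    define w where "w = \<omega> (of_real t * z)"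
    show "Im w > 0" unfolding w_def by (rule \<omega>(2)[OF tz[OF z]])
    then have G: "G \<mu> w \<noteq> 0" using cauchy_nonzero[OF PM] by simp
    show e: "w + of_real (t - 1) * barycentre \<mu> w = of_real t * z" unfolding w_def by (rule \<omega>(3)[OF tz[OF z]])
    have Kz: "K z = barycentre \<mu> w" by (simp add: K_def w_def)
    have "of_real t * (z - K z) = w - barycentre \<mu> w"
      unfolding Kz using e by (simp add: algebra_simps)
    also have "\<dots> = 1 / G \<mu> w" by (simp add: barycentre_def)
    finally have tK: "of_real t * (z - K z) = 1 / G \<mu> w" .
    have "z - K z = (of_real t * (z - K z)) / of_real t" using t by simp
    also have "\<dots> = 1 / (of_real t * G \<mu> w)" unfolding tK by simp
    finally have "z - K z = 1 / (of_real t * G \<mu> w)" .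
    then show "G \<nu> z = of_real t * G \<mu> w" using \<nu>(2)[OF z] by simp
  qed
  have m: "measure \<nu> {None} = 0"
  proof (rule ccontr)
    assume "measure \<nu> {None} \<noteq> 0"
    \<comment> \<open>The four errors of size \<open>e\<close> that occur below add up to less than the mass at infinity.\<close>
    define e where "e = measure \<nu> {None} / 5"
    have "measure \<nu> {None} \<le> 1" by (rule prob_space.prob_le_1[OF prob_measures_prob[OF \<nu>(1)]])
    then have e: "e > 0" "e \<le> 1 / 4" using \<open>measure \<nu> {None} \<noteq> 0\<close>
      by (auto simp: e_def zero_less_measure_iff)
    obtain c1 where c1: "c1 > 0" "\<And>w. \<bar>Im w\<bar> \<ge> c1 \<and> \<bar>Re w\<bar> \<le> 1 * \<bar>Im w\<bar> \<Longrightarrow>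
      cmod (w * G \<nu> w - of_real (1 - measure \<nu> {None})) \<le> e"
      using cauchy_stolz_limit[OF \<nu>(1) e(1), of 1] by blast
    obtain c2 where c2: "c2 > 0" "\<And>w. \<bar>Im w\<bar> \<ge> c2 \<and> \<bar>Re w\<bar> \<le> 1 * \<bar>Im w\<bar> \<Longrightarrow>
      cmod (w * G \<mu> w - of_real (1 - measure \<mu> {None})) \<le> e"
      using cauchy_stolz_limit[OF PM(1) e(1), of 1] by blast
    obtain c3 where c3: "c3 > 0" "\<And>w. Im w \<ge> c3 \<and> \<bar>Re w\<bar> \<le> 1 * Im w \<Longrightarrow> cmod (barycentre \<mu> w) \<le> (e / t) * Im w"
      using barycentre_stolz[OF \<mu>, of "e / t" 1] t e by auto
    define v where "v = max (2 * t * c1) (max c2 (max c3 b))"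
    have v: "v \<ge> 2 * t * c1" "v \<ge> c2" "v \<ge> c3" "v \<ge> b" "v > 0" using b by (auto simp: v_def)
    define w where "w = Complex 0 v"
    define k where "k = of_real (t - 1) * barycentre \<mu> w"
    have w: "Im w = v" "Re w = 0" "cmod w = v" using v by (auto simp: w_def cmod_def)
    have "cmod k \<le> (t - 1) * ((e / t) * v)"
      using t c3(2)[of w] w v unfolding k_def norm_mult norm_of_real by (intro mult_mono) auto
    also have "\<dots> = ((t - 1) / t) * (e * v)" using t by simp
    also have "\<dots> \<le> 1 * (e * v)" using t v e by (intro mult_right_mono) auto
    finally have k: "cmod k \<le> e * v" by simp
    have k': "cmod k \<le> v / 2" using small[of w] w v by (simp add: k_def)
    define z where "z = (w + k) / of_real t"
    have Im0: "Im (w + k) \<ge> 1/2 * v" using H[of w] w v by (simp add: k_def)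
    have tzw: "of_real t * z = w + k" using t by (simp add: z_def)
    have tIm: "t * Im z = Im (w + k)" "t * Re z = Re (w + k)" by (simp_all add: tzw[symmetric])
    have z: "Im z \<ge> c1"
    proof -
      have "t * c1 \<le> t * Im z" using Im0 tIm v(1) by linarith
      then show ?thesis using t by simp
    qed
    have Imz: "Im z > 0" using z c1(1) by linarith
    have "\<bar>Re (w + k)\<bar> \<le> Im (w + k)"
      using w k' abs_Re_le_cmod[of k] Im0 by simp
    then have "\<bar>t * Re z\<bar> \<le> t * Im z" by (simp only: tIm)
    then have "t * \<bar>Re z\<bar> \<le> t * Im z" using t by (simp add: abs_mult)
    then have zs: "\<bar>Re z\<bar> \<le> Im z" using t by simp
    have Gz: "G \<nu> z = of_real t * G \<mu> w"
    proof -
      obtain w' where w': "Im w' > 0" "w' + of_real (t - 1) * barycentre \<mu> w' = of_real t * z"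
        "G \<nu> z = of_real t * G \<mu> w'" using ex[OF Imz] by blast
      have "w' = w"
        using compression_inj[OF PM t w'(1) _ w'(2) tzw[symmetric, unfolded k_def] tz[OF Imz]] w v by simp
      then show ?thesis using w' by simp
    qed
    define q where "q = w * G \<mu> w"
    have q: "cmod (q - 1) \<le> e" unfolding q_def using c2(2)[of w] w v real_lineD(2)[OF \<mu>] by simp
    have "z * G \<nu> z = (w + k) * G \<mu> w"
      unfolding Gz tzw[symmetric] by simp
    also have "\<dots> = q + (k / w) * q" using w v by (auto simp: q_def field_simps)
    finally have zz: "z * G \<nu> z - 1 = (q - 1) + (k / w) * q" by simp
    have n1: "cmod ((k / w) * q) \<le> e * 2"
      unfolding norm_mult norm_divide
    proof (rule mult_mono)
      show "cmod k / cmod w \<le> e" using k w v by (simp add: field_simps)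
      show "cmod q \<le> 2" using norm_triangle_ineq[of "q - 1" 1] q e by simp
    qed (use e in auto)
    have "cmod (z * G \<nu> z - 1) \<le> e + e * 2"
      unfolding zz by (rule order.trans[OF norm_triangle_ineq add_mono[OF q n1]])
    moreover have "cmod (z * G \<nu> z - of_real (1 - measure \<nu> {None})) \<le> e"
      by (rule c1(2)) (use z zs Imz in auto)
    moreover have "of_real (measure \<nu> {None}) = (z * G \<nu> z - of_real (1 - measure \<nu> {None})) - (z * G \<nu> z - 1)"
      by simp
    then have "cmod (of_real (measure \<nu> {None})) \<le> cmod (z * G \<nu> z - of_real (1 - measure \<nu> {None})) + cmod (z * G \<nu> z - 1)"
      by (metis norm_triangle_ineq4)
    ultimately have "measure \<nu> {None} \<le> 4 * e" by simp
    then show False using e(1) by (simp add: e_def)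
  qed
  show ?thesis
    by (intro exI[of _ \<nu>] free_compression.intro \<mu> t real_lineI[OF \<nu>(1) m] ex)
qed

section \<open>The flow with fixed point infinity\<close>

lemma F_real_compression:
  assumes "\<mu> \<in> prob_measures real_line" "t \<ge> 1" shows "free_compression \<mu> t (F_real t \<mu>)"
  using free_compression_exists[OF assms] free_compression.F_real_eq by metis

text \<open>
  The kernel vanishes at infinity, so only the part on the real line matters.
\<close>

lemma cauchy_scaled:
  assumes \<mu>: "\<mu> \<in> PM" and \<nu>: "\<nu> \<in> PM" and c: "c \<ge> 0"
    and eq: "\<And>A. A \<in> sets sphere_borel \<Longrightarrow> emeasure \<mu> (A \<inter> real_line) = ennreal c * emeasure \<nu> (A \<inter> real_line)"
  shows "G \<mu> z = of_real c * G \<nu> z"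
proof -
  let ?L = real_line
  have s: "sets \<mu> = sets sphere_borel" "sets \<nu> = sets sphere_borel" using \<mu> \<nu> by (simp_all add: prob_measures_sets)
  have restr: "G \<rho> z = (LINT p|\<rho>. indicator ?L p *\<^sub>R ker z p)" if \<rho>: "\<rho> \<in> PM" for \<rho>
    unfolding cauchy_ker
  proof (rule integral_cong_AE)
    show "AE p in \<rho>. ker z p = indicator ?L p *\<^sub>R ker z p"
      using \<rho> by (rule PM_AE) (auto simp: real_line_def)
  qed (use real_line_sets in \<open>auto intro!: PM_measurable[OF \<rho>]\<close>)
  have d: "density \<mu> (\<lambda>p. ennreal (indicator ?L p)) = density \<nu> (\<lambda>p. ennreal (c * indicator ?L p))"
  proof (rule measure_eqI)
    fix A assume "A \<in> sets (density \<mu> (\<lambda>p. ennreal (indicator ?L p)))"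
    then have A: "A \<in> sets sphere_borel" using s by simp
    have AL: "A \<inter> ?L \<in> sets sphere_borel" using A real_line_sets by auto
    have i: "ennreal (indicator ?L p) * indicator A p = indicator (A \<inter> ?L) p"
      "ennreal (c * indicator ?L p) * indicator A p = ennreal c * indicator (A \<inter> ?L) p" for p
      by (auto simp: indicator_def)
    have "emeasure (density \<mu> (\<lambda>p. ennreal (indicator ?L p))) A = (\<integral>\<^sup>+ p. indicator (A \<inter> ?L) p \<partial>\<mu>)"
      using A s real_line_sets
      by (subst emeasure_density) (simp, simp, simp only: i)
    also have "\<dots> = ennreal c * emeasure \<nu> (A \<inter> ?L)" using AL s by (simp add: eq[OF A])
    also have "\<dots> = (\<integral>\<^sup>+ p. ennreal c * indicator (A \<inter> ?L) p \<partial>\<nu>)"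
      using AL s by (subst nn_integral_cmult) auto
    also have "\<dots> = emeasure (density \<nu> (\<lambda>p. ennreal (c * indicator ?L p))) A"
      using A s real_line_sets
      by (subst emeasure_density) (simp, simp, simp only: i)
    finally show "emeasure (density \<mu> (\<lambda>p. ennreal (indicator ?L p))) A = emeasure (density \<nu> (\<lambda>p. ennreal (c * indicator ?L p))) A" .
  qed (simp add: s)
  have "G \<mu> z = (LINT p|density \<mu> (\<lambda>p. ennreal (indicator ?L p)). ker z p)"
    unfolding restr[OF \<mu>]
    by (rule integral_density[symmetric]) (use real_line_sets s in \<open>auto intro!: PM_measurable[OF \<mu>]\<close>)
  also have "\<dots> = (LINT p|\<nu>. (c * indicator ?L p) *\<^sub>R ker z p)"
    unfolding d by (rule integral_density) (use real_line_sets s c in \<open>auto intro!: PM_measurable[OF \<nu>]\<close>)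
  also have "\<dots> = (LINT p|\<nu>. of_real c * (indicator ?L p *\<^sub>R ker z p))"
    by (intro Bochner_Integration.integral_cong) (auto simp: scaleR_conv_of_real)
  also have "\<dots> = of_real c * G \<nu> z" unfolding restr[OF \<nu>] by (rule integral_mult_right_zero)
  finally show ?thesis .
qed

lemma sets_mixture [simp]: "sets (mixture s \<mu> \<nu>) = sets sphere_borel"
  using sets.sigma_sets_eq[of sphere_borel] by (simp add: mixture_def)

lemma emeasure_mixture:
  assumes "sets \<mu> = sets sphere_borel" "sets \<nu> = sets sphere_borel" "A \<in> sets sphere_borel"
  shows "emeasure (mixture s \<mu> \<nu>) A = ennreal s * emeasure \<mu> A + ennreal (1 - s) * emeasure \<nu> A"
proof (rule emeasure_measure_of)
  let ?f = "\<lambda>A. ennreal s * emeasure \<mu> A + ennreal (1 - s) * emeasure \<nu> A"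
  show "mixture s \<mu> \<nu> = measure_of UNIV (sets sphere_borel) ?f" by (simp add: mixture_def)
  show "sets sphere_borel \<subseteq> Pow UNIV" by simp
  show "positive (sets (mixture s \<mu> \<nu>)) ?f" by (simp add: positive_def)
  show "countably_additive (sets (mixture s \<mu> \<nu>)) ?f"
  proof (rule countably_additiveI)
    fix B :: "nat \<Rightarrow> sphere set"
    assume B: "range B \<subseteq> sets (mixture s \<mu> \<nu>)" "disjoint_family B"
    then have "(\<Sum>i. emeasure \<mu> (B i)) = emeasure \<mu> (\<Union>i. B i)" "(\<Sum>i. emeasure \<nu> (B i)) = emeasure \<nu> (\<Union>i. B i)"
      using assms by (auto intro!: suminf_emeasure)
    then show "(\<Sum>i. ?f (B i)) = ?f (\<Union>i. B i)"
      by (subst suminf_add[symmetric]) (simp_all add: ennreal_suminf_cmult)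
  qed
  show "A \<in> sets (mixture s \<mu> \<nu>)" using assms by simp
qed

lemma mixture_PM:
  assumes \<mu>: "\<mu> \<in> PM" and \<nu>: "\<nu> \<in> PM" and s: "0 \<le> s" "s \<le> 1"
  shows "mixture s \<mu> \<nu> \<in> PM"
proof -
  note st = prob_measures_sets[OF \<mu>] prob_measures_sets[OF \<nu>]
  have sp: "space (mixture s \<mu> \<nu>) = UNIV" using sets_eq_imp_space_eq[OF sets_mixture] by simp
  have one: "emeasure \<rho> UNIV = 1" if "\<rho> \<in> PM" for \<rho>
    using prob_space.emeasure_space_1[OF prob_measures_prob[OF that]] prob_measures_space[OF that] by simp
  have "emeasure (mixture s \<mu> \<nu>) UNIV = 1"
    using s by (simp add: emeasure_mixture st one \<mu> \<nu> sets_sphere_borel_iff flip: ennreal_plus)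
  then have "prob_space (mixture s \<mu> \<nu>)" by (intro prob_spaceI) (simp add: sp)
  moreover have "emeasure (mixture s \<mu> \<nu>) (UNIV - ext_real_line) = 0"
    using \<mu> \<nu> sets.compl_sets[OF ext_real_line_sets]
    by (simp add: emeasure_mixture st) (simp add: prob_measures_def)
  ultimately show ?thesis by (simp add: prob_measures_def)
qed

lemma measure_dirac: "A \<in> sets sphere_borel \<Longrightarrow> measure (dirac a) A = indicator A a"
  by (simp add: dirac_def measure_return)

lemma mixture_infinity:
  assumes \<nu>: "\<nu> \<in> prob_measures real_line" and s: "0 \<le> s" "s < 1"
  shows "mixture s (dirac None) \<nu> \<in> PM"
    and "measure (mixture s (dirac None) \<nu>) {None} = s"
    and "G (mixture s (dirac None) \<nu>) z = of_real (1 - s) * G \<nu> z"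
proof -
  note \<nu>' = real_lineD[OF \<nu>]
  have dN: "dirac None \<in> PM" by (rule dirac_PM) (simp add: ext_real_line_def)
  note st = prob_measures_sets[OF dN] prob_measures_sets[OF \<nu>]
  show PM: "mixture s (dirac None) \<nu> \<in> PM"
    by (rule mixture_PM[OF dN \<nu>'(1)]) (use s in auto)
  have "emeasure \<nu> {None} = 0"
    using \<nu>'(2) prob_space.finite_measure[OF prob_measures_prob[OF \<nu>]] by (simp add: finite_measure.emeasure_eq_measure)
  then have "emeasure (mixture s (dirac None) \<nu>) {None} = ennreal s"
    using infinity_sets by (simp add: emeasure_mixture st) (simp add: dirac_def)
  then show "measure (mixture s (dirac None) \<nu>) {None} = s" using s by (simp add: measure_def)
  show "G (mixture s (dirac None) \<nu>) z = of_real (1 - s) * G \<nu> z"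
  proof (rule cauchy_scaled[OF PM \<nu>'(1)])
    fix A assume A: "A \<in> sets sphere_borel"
    have AL: "A \<inter> real_line \<in> sets sphere_borel" using A real_line_sets by auto
    then have "emeasure (dirac None) (A \<inter> real_line) = 0" by (auto simp: dirac_def real_line_def)
    then show "emeasure (mixture s (dirac None) \<nu>) (A \<inter> real_line) = ennreal (1 - s) * emeasure \<nu> (A \<inter> real_line)"
      using AL by (simp add: emeasure_mixture st)
  qed (use s in simp)
qed

lemma mass_infinity_less_1: "\<mu> \<in> PM \<Longrightarrow> \<mu> \<noteq> dirac None \<Longrightarrow> measure \<mu> {None} < 1"
  using eq_dirac by (meson not_le)

lemma conditioned:
  assumes \<mu>: "\<mu> \<in> PM" and r: "measure \<mu> {None} < 1"
  shows "uniform_measure \<mu> real_line \<in> prob_measures real_line"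
    and "G \<mu> z = of_real (1 - measure \<mu> {None}) * G (uniform_measure \<mu> real_line) z"
proof -
  show U: "uniform_measure \<mu> real_line \<in> prob_measures real_line"
    by (rule mixture_infinity_decomposition(1)[OF \<mu> r])
  show "G \<mu> z = of_real (1 - measure \<mu> {None}) * G (uniform_measure \<mu> real_line) z"
    using mixture_infinity(3)[OF U _ r, of z] unfolding mixture_infinity_decomposition(2)[OF \<mu> r] by simp
qed

text \<open>
  Apart from the degenerate case, in which the mass at infinity grows to one, everything reduces to a
  free power of the conditioned measure with a modified exponent.
\<close>

lemma F_infinity_cases:
  assumes \<mu>: "\<mu> \<in> PM" and t: "t \<ge> 1"
  obtains (degenerate) "t * measure \<mu> {None} \<ge> 1" "F_infinity t \<mu> = dirac None"
    | (regular) "t * measure \<mu> {None} < 1" "measure \<mu> {None} < 1" "F_infinity t \<mu> \<in> PM"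
      "measure (F_infinity t \<mu>) {None} = t * measure \<mu> {None}" "F_infinity t \<mu> \<noteq> dirac None"
      "\<And>z. G (F_infinity t \<mu>) z = of_real (1 - t * measure \<mu> {None}) *
        G (F_real ((t - t * measure \<mu> {None}) / (1 - t * measure \<mu> {None})) (uniform_measure \<mu> real_line)) z"
      "free_compression (uniform_measure \<mu> real_line) ((t - t * measure \<mu> {None}) / (1 - t * measure \<mu> {None}))
        (F_real ((t - t * measure \<mu> {None}) / (1 - t * measure \<mu> {None})) (uniform_measure \<mu> real_line))"
proof (cases "t * measure \<mu> {None} < 1")
  case False
  then show ?thesis using degenerate by (simp add: F_infinity_def Let_def)
next
  case True
  define r where "r = measure \<mu> {None}"
  have r0: "0 \<le> r" by (simp add: r_def)
  have tr: "t * r < 1" using True by (simp add: r_def)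
  have "r \<le> t * r" using t r0 mult_right_mono[of 1 t r] by simp
  then have r1: "r < 1" using tr by simp
  define t' where "t' = (t - t * r) / (1 - t * r)"
  have t': "t' \<ge> 1" using tr t by (simp add: t'_def field_simps)
  define \<nu> where "\<nu> = uniform_measure \<mu> real_line"
  have \<nu>: "\<nu> \<in> prob_measures real_line" using conditioned(1)[OF \<mu>] r1 by (simp add: r_def \<nu>_def)
  have fc: "free_compression \<nu> t' (F_real t' \<nu>)" by (rule F_real_compression[OF \<nu> t'])
  have F: "F_infinity t \<mu> = mixture (t * r) (dirac None) (F_real t' \<nu>)"
    using tr by (simp add: F_infinity_def Let_def r_def t'_def \<nu>_def)
  note m = mixture_infinity[OF free_compression.\<nu>[OF fc] _ tr, folded F]
  have tr0: "0 \<le> t * r" using t r0 by simp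
  have ne: "F_infinity t \<mu> \<noteq> dirac None"
    using m(2)[OF tr0] tr infinity_sets by (auto simp: measure_dirac)
  show ?thesis
    by (rule regular) (use m[OF tr0] tr r1 ne fc in \<open>simp_all add: r_def t'_def \<nu>_def\<close>)
qed

lemma dirac_infinity_PM: "dirac None \<in> PM"
  by (rule dirac_PM) (simp add: ext_real_line_def)

lemma F_infinity_PM: "\<mu> \<in> PM \<Longrightarrow> t \<ge> 1 \<Longrightarrow> F_infinity t \<mu> \<in> PM"
  by (erule (1) F_infinity_cases) (simp_all add: dirac_infinity_PM)

lemma F_infinity_degenerate_iff:
  "\<mu> \<in> PM \<Longrightarrow> t \<ge> 1 \<Longrightarrow> F_infinity t \<mu> = dirac None \<longleftrightarrow> t * measure \<mu> {None} \<ge> 1"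
  by (erule (1) F_infinity_cases) auto

lemma F_infinity_mass:
  "\<mu> \<in> PM \<Longrightarrow> t \<ge> 1 \<Longrightarrow> F_infinity t \<mu> \<noteq> dirac None \<Longrightarrow> measure (F_infinity t \<mu>) {None} = t * measure \<mu> {None}"
  by (erule (1) F_infinity_cases) auto

text \<open>
  The barycentre as a relation. A finite barycentre exists exactly for measures other than the Dirac
  measure at infinity, which \<open>barycentre\<close> cannot express because of \<open>1 / 0 = 0\<close>.
\<close>

definition focal :: "sphere measure \<Rightarrow> complex \<Rightarrow> complex \<Rightarrow> bool" where
  "focal \<mu> w k \<longleftrightarrow> Im w \<noteq> 0 \<and> w \<noteq> k \<and> G \<mu> w = 1 / (w - k)"

lemma focal_iff: "focal \<mu> w k \<longleftrightarrow> Im w \<noteq> 0 \<and> G \<mu> w \<noteq> 0 \<and> barycentre \<mu> w = k"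
  by (auto simp: focal_def barycentre_def)

lemma focal_ex: "\<mu> \<in> PM \<Longrightarrow> \<mu> \<noteq> dirac None \<Longrightarrow> Im w \<noteq> 0 \<Longrightarrow> \<exists>k. focal \<mu> w k"
  using cauchy_nonzero by (auto simp: focal_iff)

lemma focal_unique: "focal \<mu> w k \<Longrightarrow> focal \<mu> w l \<Longrightarrow> k = l"
  by (auto simp: focal_iff)

lemma focal_Im: "\<mu> \<in> PM \<Longrightarrow> focal \<mu> w k \<Longrightarrow> Im w * Im k \<le> 0"
  using barycentre_opposite[of \<mu> w] by (cases "\<mu> = dirac None") (auto simp: focal_iff cauchy_dirac)

lemma focal_cnj: "\<mu> \<in> PM \<Longrightarrow> focal \<mu> w k \<Longrightarrow> focal \<mu> (cnj w) (cnj k)"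
  by (simp add: focal_def cauchy_cnj)

lemma focal_eqI:
  assumes "\<mu> \<in> PM" "\<nu> \<in> PM" "\<mu> \<noteq> dirac None" "\<And>w k. Im w > 0 \<Longrightarrow> focal \<mu> w k \<Longrightarrow> focal \<nu> w k"
  shows "\<mu> = \<nu>"
proof (rule cauchy_transform_inj[OF assms(1,2)])
  fix z assume z: "Im z > 0"
  then obtain k where "focal \<mu> z k" using focal_ex[OF assms(1,3), of z] by auto
  then show "G \<mu> z = G \<nu> z" using assms(4)[OF z] by (auto simp: focal_def)
qed

text \<open>
  The Moebius transformation with fixed points \<open>k\<close> and infinity that stretches by the factor \<open>s\<close>.
\<close>

definition expand :: "real \<Rightarrow> complex \<Rightarrow> complex \<Rightarrow> complex" where
  "expand s k z = k + of_real s * (z - k)"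

lemma expand_expand: "expand s k (expand u k z) = expand (s * u) k z"
  by (simp add: expand_def)

lemma expand_1 [simp]: "expand 1 k z = z" by (simp add: expand_def)

lemma Im_expand: "Im (expand s k z) = Im k + s * (Im z - Im k)"
  by (simp add: expand_def)

text \<open>
  Stretching from a point on the other side of the real line moves away from the real line.
\<close>

lemma expand_same_side:
  assumes "s \<ge> 1" "Im z * Im k \<le> 0" "Im z \<noteq> 0"
  shows "Im (expand s k z) * Im z > 0"
proof -
  have "Im (expand s k z) * Im z = s * (Im z)\<^sup>2 - (s - 1) * (Im z * Im k)"
    by (simp add: Im_expand power2_eq_square algebra_simps)
  moreover have "s * (Im z)\<^sup>2 > 0" using assms by (intro mult_pos_pos) auto
  moreover have "(s - 1) * (Im z * Im k) \<le> 0" using mult_nonneg_nonpos[OF _ assms(2), of "s - 1"] assms(1) by simp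
  ultimately show ?thesis by linarith
qed

lemma cnj_expand: "cnj (expand s k z) = expand s (cnj k) (cnj z)"
  by (simp add: expand_def)

text \<open>
  The exponents are arranged so that the mass \<open>r\<close> at infinity disappears from the description: conditioning
  on the real line divides \<open>G\<close> by \<open>1 - r\<close>, and the modified exponent \<open>t'\<close> satisfies
  \<open>(1 - t r) t' = t (1 - r)\<close> and \<open>(1 - t r) (t' - 1) = t - 1\<close>.
\<close>

lemma F_infinity_focal_upper:
  assumes PM: "\<mu> \<in> PM" and t0: "t \<ge> 1" and ne: "F_infinity t \<mu> \<noteq> dirac None"
    and z: "Im z > 0" and f: "focal (F_infinity t \<mu>) z k"
  shows "focal \<mu> (expand t k z) k"
  using PM t0
proof (cases rule: F_infinity_cases)
  case degenerate
  then show ?thesis using ne by simp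
next
  case regular
  define r where "r = measure \<mu> {None}"
  define t' where "t' = (t - t * r) / (1 - t * r)"
  define \<nu> where "\<nu> = uniform_measure \<mu> real_line"
  note reg = regular[folded r_def, folded t'_def \<nu>_def]
  have \<nu>_real: "\<nu> \<in> prob_measures real_line" using conditioned(1)[OF PM] reg(2) by (simp add: r_def \<nu>_def)
  have G\<mu>: "G \<mu> w = of_real (1 - r) * G \<nu> w" for w
    using conditioned(2)[OF PM] reg(2) by (simp add: r_def \<nu>_def)
  interpret free_compression \<nu> t' "F_real t' \<nu>" by (rule reg(7))
  obtain w where w: "Im w > 0" "w + of_real (t' - 1) * barycentre \<nu> w = of_real t' * z"
    "G (F_real t' \<nu>) z = of_real t' * G \<nu> w" using ex[OF z] by blast
  define g where "g = G \<nu> w"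
  have g: "g \<noteq> 0" unfolding g_def using cauchy_nonzero real_lineD[OF \<nu>_real] w(1) by simp
  have tt': "(1 - t * r) * t' = t * (1 - r)" using reg(1) by (simp add: t'_def field_simps)
  have "G (F_infinity t \<mu>) z = of_real ((1 - t * r) * t') * g"
    unfolding reg(6) w(3) g_def by simp
  then have e: "G (F_infinity t \<mu>) z = of_real (t * (1 - r)) * g" unfolding tt' .
  have nz: "t * (1 - r) \<noteq> 0" using t0 reg(2) by simp
  have "z - k = 1 / (of_real (t * (1 - r)) * g)"
    using f e by (auto simp: focal_def field_simps)
  then have tzk: "of_real t * (z - k) = 1 / (of_real (1 - r) * g)" using t0 by simp
  have "of_real t' * z = w + of_real (t' - 1) * (w - 1 / g)"
    using w(2) by (simp add: barycentre_def g_def)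
  also have "\<dots> = of_real t' * w - of_real (t' - 1) / g" by (simp add: algebra_simps diff_divide_distrib)
  finally have "of_real t' * (w - z) = of_real (t' - 1) / g" by (simp only: right_diff_distrib diff_diff_eq2 add_diff_cancel_left')
  moreover have "(1 - t * r) * (t' - 1) = t - 1" using reg(1) by (simp add: t'_def field_simps)
  ultimately have "of_real ((1 - t * r) * t') * (w - z) = of_real (t - 1) / g"
    by (metis (no_types, lifting) mult.assoc of_real_mult times_divide_eq_right)
  then have "of_real (t * (1 - r)) * (w - z) = of_real (t - 1) / g" unfolding tt' .
  then have wz: "of_real t * (w - z) = of_real (t - 1) * (1 / (of_real (1 - r) * g))"
  proof -
    have alg: "x = y * (1 / (c * h))" if "c \<noteq> 0" "c * x = y / h" for x y c h :: complex
    proof -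
      have "x = (c * x) / c" using that(1) by simp
      also have "\<dots> = y * (1 / (c * h))" unfolding that(2) by simp
      finally show ?thesis .
    qed
    show ?thesis
      by (rule alg) (use reg(2) \<open>of_real (t * (1 - r)) * (w - z) = of_real (t - 1) / g\<close> in \<open>simp_all add: mult_ac\<close>)
  qed
  have "of_real t * (w - z) = of_real (t - 1) * (of_real t * (z - k))" unfolding wz tzk by simp
  then have "w - z = of_real (t - 1) * (z - k)" using t0 by simp
  then have wk: "w = expand t k z" by (simp add: expand_def algebra_simps)
  have "w - k = of_real t * (z - k)" unfolding wk by (simp add: expand_def)
  then have wk2: "w - k = 1 / (of_real (1 - r) * g)" using tzk by simp
  have "G \<mu> w = 1 / (w - k)" unfolding wk2 G\<mu> g_def by simp
  moreover have "w \<noteq> k" using wk2 g reg(2) by auto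
  ultimately show ?thesis unfolding wk[symmetric] focal_def using w(1) by simp
qed

text \<open>
  A single pair \<open>z\<close>, \<open>w\<close> in the upper half-plane with \<open>w\<close> stretched from the barycentre already excludes the
  degenerate case: the barycentre of the conditioned measure would otherwise lie above the real
  line.
\<close>

lemma F_infinity_focal_point_upper:
  assumes PM: "\<mu> \<in> PM" and t0: "t \<ge> 1" and z: "Im z > 0" and w: "Im w > 0" "focal \<mu> w k" "w = expand t k z"
  shows "focal (F_infinity t \<mu>) z k"
proof -
  define r where "r = measure \<mu> {None}"
  have "\<mu> \<noteq> dirac None" using w(2) by (auto simp: focal_iff cauchy_dirac)
  then have r1: "r < 1" using mass_infinity_less_1[OF PM] by (simp add: r_def)
  define \<nu> where "\<nu> = uniform_measure \<mu> real_line"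
  have \<nu>: "\<nu> \<in> prob_measures real_line" using conditioned(1)[OF PM] r1 by (simp add: r_def \<nu>_def)
  have G\<mu>: "G \<mu> w = of_real (1 - r) * G \<nu> w" for w
    using conditioned(2)[OF PM] r1 by (simp add: r_def \<nu>_def)
  define g where "g = G \<nu> w"
  have g: "g \<noteq> 0" using w(2) G\<mu>[of w] by (auto simp: g_def focal_iff)
  have wk: "1 / g = of_real (1 - r) * (w - k)"
    using w(2) G\<mu>[of w] g r1 by (auto simp: g_def focal_def field_simps)
  have K\<nu>: "barycentre \<nu> w = w - of_real (1 - r) * (w - k)" by (simp add: barycentre_def g_def[symmetric] wk)
  have "Im w * Im (barycentre \<nu> w) \<le> 0" using barycentre_opposite real_lineD[OF \<nu>] w(1) by simp
  then have "Im (barycentre \<nu> w) \<le> 0" using w(1) by (simp add: mult_le_0_iff)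
  then have i1: "r * Im w + (1 - r) * Im k \<le> 0" unfolding K\<nu> by (simp add: algebra_simps)
  have i2: "Im w = Im k + t * (Im z - Im k)" unfolding w(3) by (simp add: Im_expand)
  have tr: "t * r < 1"
  proof -
    have "t * ((1 - r) * Im z) > 0" using t0 r1 z by simp
    moreover have "t * ((1 - r) * Im z) = (1 - r) * Im w + (t - 1) * ((1 - r) * Im k)"
      unfolding i2 by (simp add: algebra_simps)
    moreover have "(t - 1) * ((1 - r) * Im k) \<le> (t - 1) * (- (r * Im w))"
      using i1 t0 by (intro mult_left_mono) auto
    ultimately have "(1 - r) * Im w + (t - 1) * (- (r * Im w)) > 0" by linarith
    then have "(1 - t * r) * Im w > 0" by (simp add: algebra_simps)
    then show ?thesis using w(1) by (simp add: zero_less_mult_iff)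
  qed
  define t' where "t' = (t - t * r) / (1 - t * r)"
  show ?thesis using PM t0
  proof (cases rule: F_infinity_cases)
    case degenerate
    then show ?thesis using tr by (simp add: r_def)
  next
    case regular
    note reg = regular[folded r_def, folded t'_def \<nu>_def]
    interpret free_compression \<nu> t' "F_real t' \<nu>" by (rule reg(7))
    have tt': "(1 - t * r) * t' = t * (1 - r)" using reg(1) by (simp add: t'_def field_simps)
    have tt1: "(t' - 1) * (1 - r) * t = t' * (t - 1)" using reg(1) by (simp add: t'_def field_simps)
    have "of_real t * (w + of_real (t' - 1) * barycentre \<nu> w)
        = of_real t * (of_real t' * w) - of_real ((t' - 1) * (1 - r) * t) * (w - k)"
      unfolding K\<nu> by (simp add: algebra_simps)
    also have "\<dots> = of_real t' * (of_real t * w - of_real (t - 1) * (w - k))"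
      unfolding tt1 by (simp add: algebra_simps)
    also have "of_real t * w - of_real (t - 1) * (w - k) = of_real t * z"
      unfolding w(3) by (simp add: expand_def algebra_simps)
    finally have tz: "w + of_real (t' - 1) * barycentre \<nu> w = of_real t' * z"
      using t0 by (metis (no_types, lifting) mult.left_commute mult_cancel_left of_real_eq_0_iff not_one_le_zero)
    have "Im (w + of_real (t' - 1) * barycentre \<nu> w) > 0" unfolding tz using t z by simp
    from at_point[OF w(1) this] have "G (F_real t' \<nu>) z = of_real t' * g"
      using t unfolding tz g_def by simp
    then have "G (F_infinity t \<mu>) z = of_real ((1 - t * r) * t') * g"
      unfolding reg(6) by simp
    then have e: "G (F_infinity t \<mu>) z = of_real (t * (1 - r)) * g" unfolding tt' .
    have zk: "w - k = of_real t * (z - k)" unfolding w(3) by (simp add: expand_def)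
    have "1 / g = of_real (t * (1 - r)) * (z - k)" unfolding wk zk by simp
    moreover have "z \<noteq> k" using w(2) zk by (auto simp: focal_def)
    ultimately have "G (F_infinity t \<mu>) z = 1 / (z - k)"
      unfolding e using g by (simp add: field_simps)
    then show ?thesis using z \<open>z \<noteq> k\<close> by (simp add: focal_def)
  qed
qed

lemma F_infinity_focal:
  assumes \<mu>: "\<mu> \<in> PM" and t: "t \<ge> 1" and ne: "F_infinity t \<mu> \<noteq> dirac None"
    and f: "focal (F_infinity t \<mu>) z k"
  shows "focal \<mu> (expand t k z) k"
proof (cases "Im z > 0")
  case True
  then show ?thesis using F_infinity_focal_upper[OF \<mu> t ne _ f] by simp
next
  case False
  then have "Im (cnj z) > 0" using f by (simp add: focal_def)
  from F_infinity_focal_upper[OF \<mu> t ne this focal_cnj[OF F_infinity_PM[OF \<mu> t] f]]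
  have "focal \<mu> (cnj (expand t k z)) (cnj k)" by (simp add: cnj_expand)
  from focal_cnj[OF \<mu> this] show ?thesis by simp
qed

lemma F_infinity_focal_point:
  assumes \<mu>: "\<mu> \<in> PM" and t: "t \<ge> 1" and f: "focal \<mu> (expand t k z) k" and side: "Im (expand t k z) * Im z > 0"
  shows "focal (F_infinity t \<mu>) z k"
proof (cases "Im z > 0")
  case True
  then show ?thesis using F_infinity_focal_point_upper[OF \<mu> t _ _ f] side by (simp add: zero_less_mult_iff)
next
  case False
  then have z: "Im (cnj z) > 0" "Im (expand t (cnj k) (cnj z)) > 0"
    using side by (auto simp: zero_less_mult_iff simp flip: cnj_expand)
  have "focal \<mu> (expand t (cnj k) (cnj z)) (cnj k)" using focal_cnj[OF \<mu> f] by (simp add: cnj_expand)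
  from F_infinity_focal_point_upper[OF \<mu> t z this refl]
  have "focal (F_infinity t \<mu>) (cnj z) (cnj k)" .
  from focal_cnj[OF F_infinity_PM[OF \<mu> t] this] show ?thesis by simp
qed

lemma focal_expand_side:
  assumes "\<mu> \<in> PM" "focal \<mu> z k" "t \<ge> 1" shows "Im (expand t k z) * Im z > 0"
  using assms by (intro expand_same_side focal_Im) (auto simp: focal_def)

text \<open>
  Away from the degenerate case the stretching relation characterises the flow. All later identities
  between flows are proved through it.
\<close>

lemma F_infinity_eqI:
  assumes \<mu>: "\<mu> \<in> PM" and \<nu>: "\<nu> \<in> PM" "\<nu> \<noteq> dirac None" and t: "t \<ge> 1"
    and f: "\<And>z k. Im z > 0 \<Longrightarrow> focal \<nu> z k \<Longrightarrow> focal \<mu> (expand t k z) k"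
  shows "F_infinity t \<mu> = \<nu>"
  by (rule sym, rule focal_eqI[OF \<nu>(1) F_infinity_PM[OF \<mu> t] \<nu>(2)])
     (rule F_infinity_focal_point[OF \<mu> t f focal_expand_side[OF \<nu>(1) _ t]])

text \<open>
  The stretched points fill an open set, on which the Cauchy transforms of both measures are
  determined by the image.
\<close>

lemma F_infinity_inj:
  assumes \<mu>: "\<mu>1 \<in> PM" "\<mu>2 \<in> PM" and t: "t \<ge> 1"
    and eq: "F_infinity t \<mu>1 = F_infinity t \<mu>2" and ne: "F_infinity t \<mu>1 \<noteq> dirac None"
  shows "\<mu>1 = \<mu>2"
proof -
  define \<nu> where "\<nu> = F_infinity t \<mu>1"
  have \<nu>: "\<nu> \<in> PM" "\<nu> \<noteq> dirac None" using F_infinity_PM[OF \<mu>(1) t] ne by (simp_all add: \<nu>_def)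
  define h where "h z = expand t (barycentre \<nu> z) z" for z
  have foc: "focal \<nu> z (barycentre \<nu> z)" if "Im z > 0" for z
    using that cauchy_nonzero[OF \<nu>] by (simp add: focal_iff)
  have f1: "focal \<mu>1 (h z) (barycentre \<nu> z)" if "Im z > 0" for z
    using F_infinity_focal[OF \<mu>(1) t ne] foc[OF that] by (simp add: \<nu>_def h_def)
  have f2: "focal \<mu>2 (h z) (barycentre \<nu> z)" if "Im z > 0" for z
    using F_infinity_focal[OF \<mu>(2) t] ne eq foc[OF that] by (simp add: \<nu>_def h_def)
  have hup: "Im (h z) > 0" if "Im z > 0" for z
    using focal_expand_side[OF \<nu>(1) foc[OF that] t] that by (simp add: h_def zero_less_mult_iff)
  have inj: "inj_on h upper"
  proof (rule inj_onI)
    fix z w assume zw: "z \<in> upper" "w \<in> upper" "h z = h w"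
    have k: "barycentre \<nu> z = barycentre \<nu> w"
      using focal_unique f1[of z] f1[of w] zw by auto
    have "of_real t * (z - barycentre \<nu> w) = of_real t * (w - barycentre \<nu> w)"
      using zw(3) unfolding h_def expand_def k by simp
    then show "z = w" using t by simp
  qed
  have holo: "h holomorphic_on upper"
    unfolding h_def expand_def
    by (intro holomorphic_intros holomorphic_on_subset[OF barycentre_holomorphic[OF \<nu>]]) auto
  have op: "open (h ` upper)" by (rule open_mapping_thm3[OF holo open_upper inj])
  show ?thesis
  proof (rule cauchy_transform_inj[OF \<mu>])
    fix z assume z: "Im z > 0"
    show "G \<mu>1 z = G \<mu>2 z"
    proof (rule analytic_continuation_open[where s="h ` upper" and s'=upper and f="G \<mu>1" and g="G \<mu>2"])
      show "G \<mu>1 holomorphic_on upper" "G \<mu>2 holomorphic_on upper"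
        by (rule holomorphic_on_subset[OF cauchy_holomorphic]; use \<mu> in force)+
      have "\<i> \<in> upper" by simp
      then show "h ` upper \<noteq> {}" by blast
      show "h ` upper \<subseteq> upper" using hup by auto
      show "G \<mu>1 w = G \<mu>2 w" if "w \<in> h ` upper" for w
        using that f1 f2 by (auto simp: focal_def)
    qed (use op open_upper connected_upper z in simp_all)
  qed
qed

lemma F_infinity_dirac_infinity: "t \<ge> 1 \<Longrightarrow> F_infinity t (dirac None) = dirac None"
  using F_infinity_degenerate_iff[OF dirac_infinity_PM] infinity_sets by (simp add: measure_dirac)

lemma F_infinity_1: "\<mu> \<in> PM \<Longrightarrow> F_infinity 1 \<mu> = \<mu>"
  by (cases "\<mu> = dirac None") (auto intro: F_infinity_eqI simp: F_infinity_dirac_infinity)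

text \<open>
  Stretchings from the same point compose to a stretching. In the degenerate case the mass at
  infinity, which is multiplied by the exponent, decides.
\<close>

lemma F_infinity_F_infinity:
  assumes \<mu>: "\<mu> \<in> PM" and s: "s \<ge> 1" and t: "t \<ge> 1"
  shows "F_infinity s (F_infinity t \<mu>) = F_infinity (s * t) \<mu>"
proof -
  define \<tau> where "\<tau> = F_infinity t \<mu>"
  have \<tau>: "\<tau> \<in> PM" unfolding \<tau>_def by (rule F_infinity_PM[OF \<mu> t])
  have st: "s * t \<ge> 1" using mult_mono[OF s t] s by simp
  show ?thesis
  proof (cases "F_infinity (s * t) \<mu> = dirac None")
    case True
    then have m: "s * t * measure \<mu> {None} \<ge> 1" using F_infinity_degenerate_iff[OF \<mu> st] by simp
    show ?thesis
    proof (cases "\<tau> = dirac None")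
      case True
      then show ?thesis using F_infinity_dirac_infinity[OF s] \<open>F_infinity (s * t) \<mu> = dirac None\<close> by (simp add: \<tau>_def)
    next
      case False
      then have "measure \<tau> {None} = t * measure \<mu> {None}" using F_infinity_mass[OF \<mu> t] by (simp add: \<tau>_def)
      then have "F_infinity s \<tau> = dirac None" using F_infinity_degenerate_iff[OF \<tau> s] m by (simp add: mult_ac)
      then show ?thesis using True by (simp add: \<tau>_def)
    qed
  next
    case False
    let ?\<nu> = "F_infinity (s * t) \<mu>"
    have \<nu>: "?\<nu> \<in> PM" by (rule F_infinity_PM[OF \<mu> st])
    have "F_infinity s \<tau> = ?\<nu>"
    proof (rule F_infinity_eqI[OF \<tau> \<nu> False s])
      fix z k assume z: "Im z > 0" "focal ?\<nu> z k"
      have e: "expand t k (expand s k z) = expand (s * t) k z" by (simp add: expand_expand mult.commute)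
      have f: "focal \<mu> (expand (s * t) k z) k" by (rule F_infinity_focal[OF \<mu> st False z(2)])
      have "Im (expand s k z) > 0" "Im (expand (s * t) k z) > 0"
        using focal_expand_side[OF \<nu> z(2) s] focal_expand_side[OF \<nu> z(2) st] z(1) by (simp_all add: zero_less_mult_iff)
      then show "focal \<tau> (expand s k z) k"
        unfolding \<tau>_def by (intro F_infinity_focal_point[OF \<mu> t]) (simp_all add: e f)
    qed
    then show ?thesis by (simp add: \<tau>_def)
  qed
qed

text \<open>
  Real affine maps, orientation reversing ones included, commute with stretching. Consequently the flow
  at a point \<open>a\<close> may be computed with any real Moebius transformation that sends \<open>a\<close> to infinity.
\<close>

lemma F_infinity_real_affine:
  assumes \<mu>: "\<mu> \<in> PM" and t: "t \<ge> 1" and c: "c \<noteq> 0"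
  shows "F_infinity t (pushforward (real_affine c d) \<mu>) = pushforward (real_affine c d) (F_infinity t \<mu>)"
proof -
  let ?L = "real_affine c d"
  have PM: "pushforward ?L \<rho> \<in> PM" if "\<rho> \<in> PM" for \<rho>
    by (rule pushforward_prob_measures[OF that real_affine_measurable ext_real_line_sets ext_real_line_sets])
       (use real_affine_real_line in \<open>auto simp: ext_real_line_def\<close>)
  have pre: "?L -` {None} = {None}" by (auto simp: real_affine_def)
  have mass: "measure (pushforward ?L \<rho>) {None} = measure \<rho> {None}" if "\<rho> \<in> PM" for \<rho>
    using measure_pushforward[OF that real_affine_measurable infinity_sets] pre by simp
  show ?thesis
  proof (cases "F_infinity t \<mu> = dirac None")
    case True
    then have "F_infinity t (pushforward ?L \<mu>) = dirac None"
      using F_infinity_degenerate_iff[OF \<mu> t] F_infinity_degenerate_iff[OF PM[OF \<mu>] t] mass[OF \<mu>] by simp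
    then show ?thesis using True by (simp add: pushforward_dirac[OF real_affine_measurable])
  next
    case False
    let ?\<nu> = "F_infinity t \<mu>"
    have \<nu>: "?\<nu> \<in> PM" by (rule F_infinity_PM[OF \<mu> t])
    have foc: "focal (pushforward ?L \<rho>) z k \<longleftrightarrow> focal \<rho> ((z - of_real d) / of_real c) ((k - of_real d) / of_real c)"
      if "\<rho> \<in> PM" for \<rho> z k
    proof -
      have "(z - of_real d) / of_real c - (k - of_real d) / of_real c = (z - k) / of_real c"
        by (simp add: diff_divide_distrib)
      then show ?thesis unfolding focal_def cauchy_real_affine[OF that c]
        using c by (auto simp: field_simps)
    qed
    show ?thesis
    proof (rule F_infinity_eqI[OF PM[OF \<mu>] PM[OF \<nu>] _ t])
      show "pushforward ?L ?\<nu> \<noteq> dirac None"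
        using mass[OF \<nu>] mass_infinity_less_1[OF \<nu> False] infinity_sets by (auto simp: measure_dirac)
      fix z k assume "focal (pushforward ?L ?\<nu>) z k"
      then have "focal \<mu> (expand t ((k - of_real d) / of_real c) ((z - of_real d) / of_real c)) ((k - of_real d) / of_real c)"
        using F_infinity_focal[OF \<mu> t False] by (simp add: foc[OF \<nu>])
      moreover have "expand t ((k - of_real d) / of_real c) ((z - of_real d) / of_real c) = (expand t k z - of_real d) / of_real c"
        using c by (simp add: expand_def field_simps)
      ultimately show "focal (pushforward ?L \<mu>) (expand t k z) k" by (simp add: foc[OF \<mu>])
    qed
  qed
qed

section \<open>Inversion and the flow with fixed point zero\<close>

abbreviation J :: "sphere \<Rightarrow> sphere" where "J \<equiv> moebius_to_infinity (Some 0)"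
abbreviation origin :: sphere where "origin \<equiv> Some 0"

lemma J_J [simp]: "J (J p) = p"
  by (cases p) auto

lemma ext_real_line_None [simp]: "None \<in> ext_real_line" and ext_real_line_Some [simp]: "Some x \<in> ext_real_line \<longleftrightarrow> x \<in> \<real>"
  by (auto simp: ext_real_line_def real_line_def)

lemma J_ext: "J ` ext_real_line \<subseteq> ext_real_line"
proof
  fix q assume "q \<in> J ` ext_real_line"
  then obtain p where "p \<in> ext_real_line" "q = J p" by blast
  then show "q \<in> ext_real_line" by (cases p) auto
qed

lemma pushforward_J_PM: "\<mu> \<in> PM \<Longrightarrow> pushforward J \<mu> \<in> PM"
  by (rule pushforward_prob_measures[OF _ moebius_measurable ext_real_line_sets ext_real_line_sets J_ext])

lemma pushforward_J_J: "\<mu> \<in> PM \<Longrightarrow> pushforward J (pushforward J \<mu>) = \<mu>"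
  by (simp add: pushforward_pushforward pushforward_id)

lemma pushforward_J_dirac: "pushforward J (dirac p) = dirac (J p)"
  by (rule pushforward_dirac) simp

lemma pushforward_J_eq_dirac: "\<mu> \<in> PM \<Longrightarrow> pushforward J \<mu> = dirac p \<longleftrightarrow> \<mu> = dirac (J p)"
  using pushforward_J_J pushforward_J_dirac J_J by metis

lemma J_vimage: "J -` {p} = {J p}"
  by (auto simp del: moebius_to_infinity.simps)

lemma mass_pushforward_J: "\<mu> \<in> PM \<Longrightarrow> measure (pushforward J \<mu>) {p} = measure \<mu> {J p}"
  using measure_pushforward[of \<mu> _ J "{p}"] by (simp add: singleton_sets J_vimage)

text \<open>
  Equivariance of the barycentre under inversion, in terms of Cauchy transforms: if \<open>G \<mu> w = 1 / (w - k)\<close>,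
  then the right-hand side is \<open>1 / (1 / w - 1 / k)\<close>.
\<close>

lemma cauchy_J:
  assumes \<mu>: "\<mu> \<in> PM" and w: "Im w \<noteq> 0"
  shows "G (pushforward J \<mu>) (1 / w) = w - w\<^sup>2 * G \<mu> w"
proof -
  interpret prob_space \<mu> using \<mu> by (simp add: prob_measures_prob)
  have "G (pushforward J \<mu>) (1 / w) = (LINT p|\<mu>. ker (1 / w) (J p))"
    by (rule cauchy_pushforward[OF \<mu>]) simp
  also have "\<dots> = (LINT p|\<mu>. w - w\<^sup>2 * ker w p)"
  proof (rule integral_cong_AE)
    show "AE p in \<mu>. ker (1 / w) (J p) = w - w\<^sup>2 * ker w p"
      using \<mu>
    proof (rule PM_AE)
      show "ker (1 / w) (J (Some (of_real x))) = w - w\<^sup>2 * ker w (Some (of_real x))" for x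
      proof (cases "x = 0")
        case True
        then show ?thesis using w by (auto simp: power2_eq_square)
      next
        case False
        then have "complex_of_real x \<noteq> 0" "w \<noteq> 0" "w - of_real x \<noteq> 0" "of_real x - w \<noteq> 0" using w by auto
        then have "1 / (1 / w - 1 / of_real x) = w - w\<^sup>2 * (1 / (w - of_real x))"
          by (simp add: divide_simps) (simp add: power2_eq_square algebra_simps)
        then show ?thesis using False by simp
      qed
    qed simp
    show "(\<lambda>p. ker (1 / w) (J p)) \<in> borel_measurable \<mu>"
      by (rule PM_measurable[OF \<mu>]) measurable
    show "(\<lambda>p. w - w\<^sup>2 * ker w p) \<in> borel_measurable \<mu>"
      by (rule PM_measurable[OF \<mu>]) measurable
  qed
  also have "\<dots> = w - w\<^sup>2 * G \<mu> w"
    unfolding cauchy_ker using w by (simp add: ker_integrable \<mu> prob_space)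
  finally show ?thesis .
qed

lemma Im_inverse: "Im (1 / z) = - Im z / (cmod z)\<^sup>2"
  by (simp add: Im_divide cmod_power2)

lemma focal_J:
  assumes \<mu>: "\<mu> \<in> PM" and f: "focal \<mu> w k" and k: "k \<noteq> 0"
  shows "focal (pushforward J \<mu>) (1 / w) (1 / k)"
proof -
  have w: "Im w \<noteq> 0" "w \<noteq> 0" "w - k \<noteq> 0" "k - w \<noteq> 0" using f by (auto simp: focal_def)
  have "G (pushforward J \<mu>) (1 / w) = w - w\<^sup>2 * (1 / (w - k))"
    using cauchy_J[OF \<mu> w(1)] f by (simp add: focal_def)
  also have "\<dots> = 1 / (1 / w - 1 / k)"
    using w k by (simp add: divide_simps) (simp add: power2_eq_square algebra_simps)
  finally show ?thesis using w k by (auto simp: focal_def Im_inverse)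
qed

lemma focal_zero:
  assumes \<mu>: "\<mu> \<in> PM" and f: "focal \<mu> w 0" shows "\<mu> = dirac origin"
proof -
  have w: "Im w \<noteq> 0" "w \<noteq> 0" using f by (auto simp: focal_def)
  have "G (pushforward J \<mu>) (1 / w) = 0"
    using cauchy_J[OF \<mu> w(1)] f w by (simp add: focal_def power2_eq_square)
  then have "pushforward J \<mu> = dirac None"
    by (intro cauchy_eq_0_imp[OF pushforward_J_PM[OF \<mu>], of "1 / w"]) (use w in \<open>auto simp: Im_inverse\<close>)
  then show ?thesis by (simp add: pushforward_J_eq_dirac[OF \<mu>])
qed

lemma focal_origin: "Im w \<noteq> 0 \<Longrightarrow> focal (dirac origin) w k \<longleftrightarrow> k = 0"
  by (auto simp: focal_def cauchy_dirac)

text \<open>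
  The flow with fixed point \<open>0\<close> in place of infinity. In the coordinate \<open>1 / z\<close> it stretches from \<open>1 / k\<close>.
\<close>

definition F_origin :: "real \<Rightarrow> sphere measure \<Rightarrow> sphere measure" where
  "F_origin t \<mu> = pushforward J (F_infinity t (pushforward J \<mu>))"

lemma F_origin_PM: "\<mu> \<in> PM \<Longrightarrow> t \<ge> 1 \<Longrightarrow> F_origin t \<mu> \<in> PM"
  by (simp add: F_origin_def pushforward_J_PM F_infinity_PM)

lemma F_origin_J: "\<mu> \<in> PM \<Longrightarrow> t \<ge> 1 \<Longrightarrow> pushforward J (F_origin t \<mu>) = F_infinity t (pushforward J \<mu>)"
  by (simp add: F_origin_def pushforward_J_J pushforward_J_PM F_infinity_PM)

lemma F_origin_degenerate_iff:
  assumes "\<mu> \<in> PM" "t \<ge> 1" shows "F_origin t \<mu> = dirac origin \<longleftrightarrow> t * measure \<mu> {origin} \<ge> 1"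
  using assms F_infinity_degenerate_iff[OF pushforward_J_PM[OF assms(1)] assms(2)]
  by (simp add: F_origin_def pushforward_J_eq_dirac F_infinity_PM pushforward_J_PM mass_pushforward_J)

lemma F_origin_focal:
  assumes \<mu>: "\<mu> \<in> PM" and t: "t \<ge> 1" and ne: "F_origin t \<mu> \<noteq> dirac origin" and f: "focal (F_origin t \<mu>) z k"
  shows "k \<noteq> 0" "focal \<mu> (1 / expand t (1 / k) (1 / z)) k"
proof -
  show k: "k \<noteq> 0" using focal_zero[OF F_origin_PM[OF \<mu> t]] f ne by auto
  have J\<mu>: "pushforward J \<mu> \<in> PM" by (rule pushforward_J_PM[OF \<mu>])
  have "focal (F_infinity t (pushforward J \<mu>)) (1 / z) (1 / k)"
    using focal_J[OF F_origin_PM[OF \<mu> t] f k] by (simp add: F_origin_J \<mu> t)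
  moreover have "F_infinity t (pushforward J \<mu>) \<noteq> dirac None"
    using ne by (auto simp: F_origin_def pushforward_J_dirac)
  ultimately have "focal (pushforward J \<mu>) (expand t (1 / k) (1 / z)) (1 / k)"
    using F_infinity_focal[OF J\<mu> t] by blast
  from focal_J[OF J\<mu> this] show "focal \<mu> (1 / expand t (1 / k) (1 / z)) k"
    using k by (simp add: pushforward_J_J \<mu>)
qed

lemma F_origin_focal_point:
  assumes \<mu>: "\<mu> \<in> PM" and t: "t \<ge> 1" and k: "k \<noteq> 0" and f: "focal \<mu> (1 / expand t (1 / k) (1 / z)) k"
    and side: "Im (expand t (1 / k) (1 / z)) * Im (1 / z) > 0"
  shows "focal (F_origin t \<mu>) z k"
proof -
  have J\<mu>: "pushforward J \<mu> \<in> PM" by (rule pushforward_J_PM[OF \<mu>])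
  have "focal (pushforward J \<mu>) (expand t (1 / k) (1 / z)) (1 / k)"
    using focal_J[OF \<mu> f k] by simp
  from F_infinity_focal_point[OF J\<mu> t this side]
  have "focal (F_infinity t (pushforward J \<mu>)) (1 / z) (1 / k)" .
  from focal_J[OF F_infinity_PM[OF J\<mu> t] this] show ?thesis using k by (simp add: F_origin_def)
qed

lemma inverse_side: "Im z * Im k \<le> 0 \<Longrightarrow> Im (1 / z) * Im (1 / k) \<le> 0"
proof -
  assume "Im z * Im k \<le> 0"
  moreover have "Im (1 / z) * Im (1 / k) = (Im z * Im k) / ((cmod z)\<^sup>2 * (cmod k)\<^sup>2)"
    unfolding Im_inverse by simp
  ultimately show ?thesis by (simp add: divide_nonpos_nonneg)
qed

text \<open>
  Inversion exchanges the half-planes, so the inverted points again lie on opposite sides.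
\<close>

lemma expand_origin_side:
  assumes "Im z * Im k \<le> 0" "Im z \<noteq> 0" "t \<ge> 1"
  shows "Im (expand t (1 / k) (1 / z)) * Im (1 / z) > 0" "Im (1 / expand t (1 / k) (1 / z)) * Im z > 0"
proof -
  let ?E = "expand t (1 / k) (1 / z)"
  have z: "z \<noteq> 0" using assms(2) by auto
  show 1: "Im ?E * Im (1 / z) > 0"
    by (rule expand_same_side[OF assms(3) inverse_side[OF assms(1)]]) (use assms(2) z in \<open>simp add: Im_inverse\<close>)
  then have "?E \<noteq> 0" by auto
  have "Im ?E * Im z < 0"
    using 1 z by (simp add: Im_inverse field_simps)
  moreover have "Im (1 / ?E) * Im z = - (Im ?E * Im z) / (cmod ?E)\<^sup>2" by (simp add: Im_inverse)
  ultimately show "Im (1 / ?E) * Im z > 0" using \<open>?E \<noteq> 0\<close> by (simp add: divide_neg_pos)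
qed

lemma F_infinity_origin: "t \<ge> 1 \<Longrightarrow> F_infinity t (dirac origin) = dirac origin"
  by (rule F_infinity_eqI) (auto simp: dirac_PM dirac_eq_iff focal_origin expand_def)

lemma F_infinity_eq_origin:
  assumes \<mu>: "\<mu> \<in> PM" and t: "t \<ge> 1" and eq: "F_infinity t \<mu> = dirac origin"
  shows "\<mu> = dirac origin"
proof -
  have "F_infinity t \<mu> \<noteq> dirac None" "focal (F_infinity t \<mu>) \<i> 0" using eq by (simp_all add: dirac_eq_iff focal_origin)
  from F_infinity_focal[OF \<mu> t this] show ?thesis by (rule focal_zero[OF \<mu>])
qed

lemma F_origin_eq_infinity:
  assumes \<mu>: "\<mu> \<in> PM" and t: "t \<ge> 1" and eq: "F_origin t \<mu> = dirac None"
  shows "\<mu> = dirac None"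
proof -
  have "F_infinity t (pushforward J \<mu>) = dirac origin"
    using eq by (simp add: F_origin_def pushforward_J_eq_dirac F_infinity_PM pushforward_J_PM \<mu> t)
  from F_infinity_eq_origin[OF pushforward_J_PM[OF \<mu>] t this] show ?thesis
    by (simp add: pushforward_J_eq_dirac[OF \<mu>])
qed

text \<open>
  Inversion turns the mass at the origin into mass at infinity, which the behaviour in Stolz angles
  reveals.
\<close>

lemma cauchy_atom_limit:
  assumes \<mu>: "\<mu> \<in> PM" and Z: "\<And>n. Im (Z n) \<noteq> 0" and r: "\<forall>\<^sub>F n in sequentially. \<bar>Re (Z n)\<bar> \<le> \<bar>Im (Z n)\<bar>"
    and i: "filterlim (\<lambda>n. \<bar>Im (Z n)\<bar>) at_top sequentially"
  shows "(\<lambda>n. (1 / Z n) * G \<mu> (1 / Z n)) \<longlonglongrightarrow> of_real (measure \<mu> {origin})"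
proof -
  have J\<mu>: "pushforward J \<mu> \<in> PM" by (rule pushforward_J_PM[OF \<mu>])
  have m: "measure (pushforward J \<mu>) {None} = measure \<mu> {origin}" by (simp add: mass_pushforward_J \<mu>)
  have eq: "Z n * G (pushforward J \<mu>) (Z n) = 1 - (1 / Z n) * G \<mu> (1 / Z n)" for n
  proof -
    have nz: "Z n \<noteq> 0" using Z[of n] by auto
    have "G (pushforward J \<mu>) (Z n) = 1 / Z n - (1 / Z n)\<^sup>2 * G \<mu> (1 / Z n)"
      using cauchy_J[OF \<mu>, of "1 / Z n"] Z[of n] nz by (simp add: Im_inverse)
    then show ?thesis using nz by (simp add: right_diff_distrib power2_eq_square)
  qed
  have "(\<lambda>n. Z n * G (pushforward J \<mu>) (Z n)) \<longlonglongrightarrow> of_real (1 - measure \<mu> {origin})"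
  proof (rule tendstoI)
    fix e :: real assume e: "e > 0"
    then obtain \<beta> where \<beta>: "\<And>w. \<bar>Im w\<bar> \<ge> \<beta> \<and> \<bar>Re w\<bar> \<le> 1 * \<bar>Im w\<bar> \<Longrightarrow>
       cmod (w * G (pushforward J \<mu>) w - of_real (1 - measure \<mu> {origin})) \<le> e / 2"
      using cauchy_stolz_limit[OF J\<mu>, of "e / 2" 1] m by auto
    have "\<forall>\<^sub>F n in sequentially. \<bar>Im (Z n)\<bar> \<ge> \<beta>" using i by (simp add: filterlim_at_top)
    with r show "\<forall>\<^sub>F n in sequentially. dist (Z n * G (pushforward J \<mu>) (Z n)) (of_real (1 - measure \<mu> {origin})) < e"
    proof eventually_elim
      case (elim n)
      then show ?case using \<beta>[of "Z n"] e by (simp add: dist_norm)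
    qed
  qed
  from tendsto_diff[OF tendsto_const[of 1] this] show ?thesis unfolding eq by simp
qed

text \<open>
  Let \<open>z\<close> tend to \<open>0\<close> along the imaginary axis, with \<open>a = z G \<rho> z\<close> tending to the mass \<open>m\<close> of the image \<open>\<rho>\<close>.
  The stretched point is \<open>w = c z\<close> with \<open>c = 1 + (t - 1) / a\<close>. As \<open>m > 0\<close>, the factor \<open>c\<close> tends to a positive
  number, so \<open>w\<close> approaches the origin nontangentially, and \<open>w G \<mu> w = c a / t\<close> tends to the mass of \<open>\<mu>\<close>.
\<close>

lemma F_infinity_atom:
  assumes \<mu>: "\<mu> \<in> PM" and t: "t \<ge> 1" and ne: "F_infinity t \<mu> \<noteq> dirac None"
    and pos: "measure (F_infinity t \<mu>) {origin} > 0"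
  shows "1 - measure (F_infinity t \<mu>) {origin} = t * (1 - measure \<mu> {origin})"
proof -
  define \<rho> where "\<rho> = F_infinity t \<mu>"
  have \<rho>: "\<rho> \<in> PM" "\<rho> \<noteq> dirac None" using F_infinity_PM[OF \<mu> t] ne by (simp_all add: \<rho>_def)
  define m where "m = measure \<rho> {origin}"
  have m: "m > 0" using pos by (simp add: m_def \<rho>_def)
  define Z where "Z n = - (of_nat (Suc n)) * \<i>" for n
  define z where "z n = 1 / Z n" for n
  have Z: "Im (Z n) = - real (Suc n)" "Re (Z n) = 0" for n by (auto simp: Z_def)
  have Z0: "Z n \<noteq> 0" for n by (auto simp: complex_eq_iff Z)
  have Zi: "filterlim (\<lambda>n. \<bar>Im (Z n)\<bar>) at_top sequentially" unfolding Z(1) by real_asymp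
  define a where "a n = z n * G \<rho> (z n)" for n
  have a: "a \<longlonglongrightarrow> of_real m"
    unfolding a_def z_def m_def by (rule cauchy_atom_limit[OF \<rho>(1) _ _ Zi]) (auto simp: Z)
  have zi: "Im (z n) \<noteq> 0" for n using Z Z0 by (simp add: z_def Im_inverse)
  have G: "G \<rho> (z n) \<noteq> 0" for n by (rule cauchy_nonzero[OF \<rho> zi])
  have an: "a n \<noteq> 0" for n using G zi[of n] by (auto simp: a_def)
  define c where "c n = 1 + of_real (t - 1) / a n" for n
  define w where "w n = expand t (barycentre \<rho> (z n)) (z n)" for n
  have f: "focal \<rho> (z n) (barycentre \<rho> (z n))" for n using zi G by (simp add: focal_iff)
  have fw: "focal \<mu> (w n) (barycentre \<rho> (z n))" for n
    unfolding w_def using F_infinity_focal[OF \<mu> t ne] f by (simp add: \<rho>_def)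
  have wz: "w n = z n * c n" for n
  proof -
    have "w n = z n + of_real (t - 1) / G \<rho> (z n)"
      by (simp add: w_def expand_def barycentre_def algebra_simps diff_divide_distrib)
    also have "1 / G \<rho> (z n) = z n / a n" using zi[of n] by (auto simp: a_def)
    then have "of_real (t - 1) / G \<rho> (z n) = of_real (t - 1) * (z n / a n)" by (metis mult.right_neutral times_divide_eq_right)
    finally show ?thesis by (simp add: c_def algebra_simps)
  qed
  define C where "C = 1 + (t - 1) / m"
  have C: "C > 0" using m t by (simp add: C_def add_pos_nonneg)
  have cC: "c \<longlonglongrightarrow> of_real C"
  proof -
    have "c \<longlonglongrightarrow> 1 + of_real (t - 1) / of_real m"
      unfolding c_def using m by (intro tendsto_intros a) simp
    then show ?thesis by (simp add: C_def)
  qed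
  have wi: "Im (w n) \<noteq> 0" for n using fw by (simp add: focal_def)
  have cn: "c n \<noteq> 0" for n using wi[of n] wz[of n] by auto
  have W: "1 / w n = Z n * (1 / c n)" for n by (simp add: wz z_def)
  have ic: "(\<lambda>n. 1 / c n) \<longlonglongrightarrow> of_real (1 / C)"
    using tendsto_divide[OF tendsto_const[of 1] cC] C by simp
  have re: "(\<lambda>n. Re (1 / c n)) \<longlonglongrightarrow> 1 / C" using tendsto_Re[OF ic] by simp
  have im: "(\<lambda>n. Im (1 / c n)) \<longlonglongrightarrow> 0" using tendsto_Im[OF ic] by simp
  have ev1: "\<forall>\<^sub>F n in sequentially. Re (1 / c n) > 1 / (2 * C)"
    by (rule order_tendstoD(1)[OF re]) (use C in \<open>simp add: field_simps\<close>)
  have ev2: "\<forall>\<^sub>F n in sequentially. \<bar>Im (1 / c n)\<bar> < 1 / (2 * C)"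
    by (rule order_tendstoD(2)[OF tendsto_rabs[OF im]]) (use C in simp)
  have ReW: "Re (1 / w n) = real (Suc n) * Im (1 / c n)" and ImW: "Im (1 / w n) = - (real (Suc n) * Re (1 / c n))" for n
    unfolding W times_complex.sel Z by (simp_all add: algebra_simps)
  have "(\<lambda>n. (1 / (1 / w n)) * G \<mu> (1 / (1 / w n))) \<longlonglongrightarrow> of_real (measure \<mu> {origin})"
  proof (rule cauchy_atom_limit[OF \<mu>])
    show "Im (1 / w n) \<noteq> 0" for n using wi[of n] by (auto simp: Im_inverse)
    show "\<forall>\<^sub>F n in sequentially. \<bar>Re (1 / w n)\<bar> \<le> \<bar>Im (1 / w n)\<bar>"
      using ev1 ev2
    proof eventually_elim
      case (elim n)
      then have "\<bar>Im (1 / c n)\<bar> \<le> \<bar>Re (1 / c n)\<bar>" by linarith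
      then show ?case unfolding ReW ImW abs_minus_cancel abs_mult by (intro mult_left_mono) auto
    qed
    show "filterlim (\<lambda>n. \<bar>Im (1 / w n)\<bar>) at_top sequentially"
    proof (rule filterlim_at_top_mono)
      show "filterlim (\<lambda>n. real (Suc n) * (1 / (2 * C))) at_top sequentially"
        using C by real_asymp
      show "\<forall>\<^sub>F n in sequentially. real (Suc n) * (1 / (2 * C)) \<le> \<bar>Im (1 / w n)\<bar>"
        using ev1
      proof eventually_elim
        case (elim n)
        have "real (Suc n) * (1 / (2 * C)) \<le> real (Suc n) * \<bar>Re (1 / c n)\<bar>"
          using elim by (intro mult_left_mono) auto
        then show ?case unfolding ImW abs_minus_cancel abs_mult by simp
      qed
    qed
  qed
  then have lim1: "(\<lambda>n. w n * G \<mu> (w n)) \<longlonglongrightarrow> of_real (measure \<mu> {origin})" by simp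
  have "w n * G \<mu> (w n) = c n * a n / of_real t" for n
  proof -
    have wk: "w n - barycentre \<rho> (z n) = of_real t * (1 / G \<rho> (z n))"
      by (simp add: w_def expand_def barycentre_def)
    have "G \<mu> (w n) = 1 / (w n - barycentre \<rho> (z n))" using fw[of n] by (simp add: focal_def)
    also have "\<dots> = G \<rho> (z n) / of_real t" unfolding wk by simp
    finally show ?thesis by (simp add: wz a_def)
  qed
  moreover have "(\<lambda>n. c n * a n / of_real t) \<longlonglongrightarrow> of_real C * of_real m / of_real t"
    using t by (intro tendsto_intros cC a) auto
  ultimately have "complex_of_real (measure \<mu> {origin}) = of_real (C * m / t)"
    using LIMSEQ_unique[OF lim1] by simp
  then have "measure \<mu> {origin} = C * m / t" by (simp only: of_real_eq_iff)
  then have "t * measure \<mu> {origin} = C * m" using t by simp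
  also have "\<dots> = m + (t - 1)" using m by (simp add: C_def distrib_right)
  finally have "t * measure \<mu> {origin} = m + (t - 1)" .
  then show ?thesis by (simp add: m_def \<rho>_def algebra_simps)
qed

section \<open>The exchange law\<close>

text \<open>
  Fix the barycentre \<open>k\<close> and use the coordinate \<open>1 / (z - k)\<close>. There the flow at infinity multiplies by
  its exponent, and the flow at the origin multiplies the difference from \<open>-1 / k\<close>, the coordinate of
  \<open>0\<close>, by its exponent. Both compositions are affine, and the relations between \<open>u\<close>, \<open>v\<close>, \<open>u'\<close>, \<open>v'\<close> make
  them equal. Points that are reached by stretching stay in their half-plane, so either composition
  can be computed from the other one, unless both results are Dirac measures at \<open>0\<close> or infinity. In
  that case masses at \<open>0\<close> and at infinity are compared.
\<close>

theorem F_infinity_F_origin: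
  assumes \<sigma>: "\<sigma> \<in> PM" and u: "u \<ge> 1" and v: "v \<ge> 1"
    and v': "v' = 1 + u * (v - 1)" and u': "u' = u * v / v'"
  shows "F_infinity u (F_origin v \<sigma>) = F_origin v' (F_infinity u' \<sigma>)"
proof -
  have "u * (v - 1) \<ge> 0" using u v by simp
  then have v1: "v' \<ge> 1" by (simp add: v')
  have "v' \<le> u * v" using u by (simp add: v' algebra_simps)
  then have u1: "u' \<ge> 1" using v1 by (simp add: u')
  have uv: "u' * v' = u * v" using v1 by (simp add: u')
  define \<pi> where "\<pi> = F_origin v \<sigma>"
  define \<rho> where "\<rho> = F_infinity u' \<sigma>"
  define \<nu>1 where "\<nu>1 = F_infinity u \<pi>"
  define \<nu>2 where "\<nu>2 = F_origin v' \<rho>"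
  have \<pi>: "\<pi> \<in> PM" unfolding \<pi>_def by (rule F_origin_PM[OF \<sigma> v])
  have \<rho>: "\<rho> \<in> PM" unfolding \<rho>_def by (rule F_infinity_PM[OF \<sigma> u1])
  have \<nu>1: "\<nu>1 \<in> PM" unfolding \<nu>1_def by (rule F_infinity_PM[OF \<pi> u])
  have \<nu>2: "\<nu>2 \<in> PM" unfolding \<nu>2_def by (rule F_origin_PM[OF \<rho> v1])
  have paths: "1 / expand v (1 / k) (1 / expand u k z) = expand u' k (1 / expand v' (1 / k) (1 / z))"
    if z: "Im z \<noteq> 0" "Im z * Im k \<le> 0" "k \<noteq> 0" for z k
  proof -
    have 1: "Im (expand u k z) * Im z > 0" by (rule expand_same_side[OF u z(2,1)])
    then have n1: "Im (expand u k z) \<noteq> 0" by auto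
    have "sgn (Im (expand u k z)) = sgn (Im z)" using 1 by (auto simp: sgn_if zero_less_mult_iff)
    then have s1: "Im (expand u k z) * Im k \<le> 0" using z(2) 1
      by (auto simp: zero_less_mult_iff mult_le_0_iff)
    have 2: "Im (expand v (1 / k) (1 / expand u k z)) \<noteq> 0"
      using expand_origin_side(1)[OF s1 n1 v] by auto
    have 3: "Im (expand v' (1 / k) (1 / z)) \<noteq> 0"
      using expand_origin_side(1)[OF z(2,1) v1] by auto
    define y where "y = expand u k z"
    define p where "p = expand v (1 / k) (1 / y)"
    define q where "q = expand v' (1 / k) (1 / z)"
    have nz: "z \<noteq> 0" "y \<noteq> 0" "p \<noteq> 0" "q \<noteq> 0" "k \<noteq> 0"
      using z n1 2 3 by (auto simp: y_def p_def q_def)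
    \<comment> \<open>Both inverted points have the common numerator \<open>D\<close>, since \<open>v' - 1 = u (v - 1)\<close>.\<close>
    define \<delta> where "\<delta> = z - k"
    define D where "D = k + of_real u * (1 - of_real v) * \<delta>"
    have zd: "z = k + \<delta>" by (simp add: \<delta>_def)
    have yd: "y = k + of_real u * \<delta>" by (simp add: y_def expand_def \<delta>_def)
    have V: "complex_of_real v' = 1 + of_real u * (of_real v - 1)" by (simp add: v')
    have UV: "complex_of_real u' * of_real v' = of_real u * of_real v" using uv by (metis of_real_mult)
    have inv: "expand s (1 / k) (1 / x) = (x + of_real s * (k - x)) / (k * x)" if "x \<noteq> 0" for s x
      using that nz(5) by (simp add: expand_def field_simps)
    have "y + of_real v * (k - y) = D" unfolding yd D_def by (simp add: algebra_simps)
    then have p: "p = D / (k * y)" unfolding p_def inv[OF nz(2)] by simp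
    have "z + of_real v' * (k - z) = D" unfolding zd D_def V by (simp add: algebra_simps)
    then have q: "q = D / (k * z)" unfolding q_def inv[OF nz(1)] by simp
    have D: "D \<noteq> 0" using nz(3) p by auto
    have zD: "z - D = of_real v' * \<delta>" unfolding zd D_def V by (simp add: algebra_simps)
    have num: "D + of_real u * of_real v * \<delta> = y" unfolding yd D_def by (simp add: algebra_simps)
    have "expand u' k (1 / q) = k + of_real u' * (k * z / D - k)" by (simp add: expand_def q)
    also have "k * z / D - k = k * (z - D) / D" using D by (simp add: field_simps)
    also have "k + of_real u' * (k * (z - D) / D) = k * (D + (of_real u' * of_real v') * \<delta>) / D"
      unfolding zD using D by (simp add: field_simps)
    also have "\<dots> = k * y / D" unfolding UV num ..
    finally have "1 / p = expand u' k (1 / q)" by (simp add: p)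
    then show ?thesis by (simp add: p_def q_def y_def)
  qed
  have same: "Im a * Im b > 0" if "Im a * Im z > 0" "Im b * Im z > 0" for a b z :: complex
    using that by (auto simp: zero_less_mult_iff)
  have opp: "Im a * Im k \<le> 0" if "Im a * Im z > 0" "Im z * Im k \<le> 0" for a z k :: complex
    using that by (auto simp: zero_less_mult_iff mult_le_0_iff)
  have "\<nu>1 = \<nu>2"
  proof (cases "\<nu>2 \<in> {dirac None, dirac origin}")
    case False
    then have ne: "\<nu>2 \<noteq> dirac None" "\<nu>2 \<noteq> dirac origin" by auto
    show ?thesis unfolding \<nu>1_def
    proof (rule F_infinity_eqI[OF \<pi> \<nu>2 ne(1) u])
      fix z k assume z: "Im z > 0" and f: "focal \<nu>2 z k"
      have zk: "Im z * Im k \<le> 0" by (rule focal_Im[OF \<nu>2 f])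
      have z0: "Im z \<noteq> 0" using z by simp
      note f1 = F_origin_focal[OF \<rho> v1 ne(2)[unfolded \<nu>2_def] f[unfolded \<nu>2_def]]
      have k: "k \<noteq> 0" by (rule f1(1))
      have "\<rho> \<noteq> dirac None" using f1(2) by (auto simp: focal_iff cauchy_dirac)
      from F_infinity_focal[OF \<sigma> u1 this[unfolded \<rho>_def] f1(2)[unfolded \<rho>_def]]
      have "focal \<sigma> (1 / expand v (1 / k) (1 / expand u k z)) k" unfolding paths[OF z0 zk k] .
      moreover have y: "Im (expand u k z) * Im z > 0" by (rule expand_same_side[OF u zk z0])
      moreover have "Im (expand u k z) \<noteq> 0" using y by auto
      note expand_origin_side(1)[OF opp[OF y zk] this v]
      ultimately show "focal \<pi> (expand u k z) k"
        unfolding \<pi>_def by (intro F_origin_focal_point[OF \<sigma> v k])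
    qed
  next
    case T2: True
    show ?thesis
    proof (cases "\<nu>1 \<in> {dirac None, dirac origin}")
      case False
      then have ne: "\<nu>1 \<noteq> dirac None" "\<nu>1 \<noteq> dirac origin" by auto
      show ?thesis
      proof (rule focal_eqI[OF \<nu>1 \<nu>2 ne(1)])
        fix z k assume z: "Im z > 0" and f: "focal \<nu>1 z k"
        have zk: "Im z * Im k \<le> 0" by (rule focal_Im[OF \<nu>1 f])
        have z0: "Im z \<noteq> 0" using z by simp
        have k: "k \<noteq> 0" using focal_zero[OF \<nu>1] f ne by auto
        have fy: "focal \<pi> (expand u k z) k"
          by (rule F_infinity_focal[OF \<pi> u ne(1)[unfolded \<nu>1_def] f[unfolded \<nu>1_def]])
        have "\<pi> \<noteq> dirac origin" using fy k by (auto simp: focal_def cauchy_dirac)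
        from F_origin_focal(2)[OF \<sigma> v this[unfolded \<pi>_def] fy[unfolded \<pi>_def]]
        have fw: "focal \<sigma> (expand u' k (1 / expand v' (1 / k) (1 / z))) k" unfolding paths[OF z0 zk k] .
        have y: "Im (expand u k z) * Im z > 0" by (rule expand_same_side[OF u zk z0])
        have y0: "Im (expand u k z) \<noteq> 0" using y by auto
        have w: "Im (expand u' k (1 / expand v' (1 / k) (1 / z))) * Im z > 0"
          unfolding paths[OF z0 zk k, symmetric]
          using expand_origin_side(2)[OF opp[OF y zk] y0 v] y by (auto simp: zero_less_mult_iff)
        note w1 = expand_origin_side[OF zk z0 v1]
        have "focal \<rho> (1 / expand v' (1 / k) (1 / z)) k"
          unfolding \<rho>_def by (rule F_infinity_focal_point[OF \<sigma> u1 fw same[OF w w1(2)]])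
        then show "focal \<nu>2 z k"
          unfolding \<nu>2_def by (rule F_origin_focal_point[OF \<rho> v1 k _ w1(1)])
      qed
    next
      case T1: True
      have disj: "{None} \<inter> {origin} = {}" by simp
      interpret S: prob_space \<sigma> by (rule prob_measures_prob[OF \<sigma>])
      have sum: "measure \<sigma> {None} + measure \<sigma> {origin} \<le> 1"
        using S.finite_measure_Union[of "{None}" "{origin}"] S.prob_le_1[of "{None} \<union> {origin}"] singleton_sets
          prob_measures_sets[OF \<sigma>] by simp
      \<comment> \<open>The masses at zero and infinity would add up to more than one.\<close>
      have no1: False if "\<nu>2 = dirac None" "\<nu>1 = dirac origin"
      proof -
        have "\<rho> = dirac None" using F_origin_eq_infinity[OF \<rho> v1] that(1) by (simp add: \<nu>2_def)
        then have m1: "u' * measure \<sigma> {None} \<ge> 1" using F_infinity_degenerate_iff[OF \<sigma> u1] by (simp add: \<rho>_def)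
        have "\<pi> = dirac origin" using F_infinity_eq_origin[OF \<pi> u] that(2) by (simp add: \<nu>1_def)
        then have m2: "v * measure \<sigma> {origin} \<ge> 1" using F_origin_degenerate_iff[OF \<sigma> v] by (simp add: \<pi>_def)
        have "1 / u' \<le> measure \<sigma> {None}" "1 / v \<le> measure \<sigma> {origin}"
          using m1 m2 u1 v by (simp_all add: field_simps)
        then have "1 / u' + 1 / v \<le> 1" using sum by linarith
        moreover have "1 / u' = 1 / (u * v) + 1 - 1 / v" using u v v1 by (simp add: u' v' field_simps)
        moreover have "1 / (u * v) > 0" using u v by simp
        ultimately show False by linarith
      qed
      \<comment> \<open>The atom of \<open>\<rho>\<close> at zero comes from an atom of \<open>\<sigma>\<close> that is too large for \<open>\<pi>\<close> not to be degenerate.\<close>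
      have no2: False if "\<nu>2 = dirac origin" "\<nu>1 = dirac None"
      proof -
        have \<pi>0: "\<pi> \<noteq> dirac origin" using that(2) F_infinity_origin[OF u] by (auto simp: \<nu>1_def dirac_eq_iff)
        have r: "v' * measure \<rho> {origin} \<ge> 1" using that(1) F_origin_degenerate_iff[OF \<rho> v1] by (simp add: \<nu>2_def)
        then have pos: "measure \<rho> {origin} > 0" using v1 by (smt (verit) mult_nonneg_nonpos)
        then have "\<rho> \<noteq> dirac None" using singleton_sets by (auto simp: measure_dirac)
        from F_infinity_atom[OF \<sigma> u1 this[unfolded \<rho>_def] pos[unfolded \<rho>_def]]
        have at: "1 - measure \<rho> {origin} = u' * (1 - measure \<sigma> {origin})" by (simp add: \<rho>_def)
        have "v' * (1 - measure \<rho> {origin}) = u * (v * (1 - measure \<sigma> {origin}))"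
          unfolding at using uv by (metis mult.assoc mult.commute)
        then have "u * (v * (1 - measure \<sigma> {origin})) \<le> v' - 1" using r by (simp add: algebra_simps)
        also have "v' - 1 = u * (v - 1)" by (simp add: v')
        finally have "v * (1 - measure \<sigma> {origin}) \<le> v - 1" using u by simp
        then have "v * measure \<sigma> {origin} \<ge> 1" by (simp add: algebra_simps)
        then show False using \<pi>0 F_origin_degenerate_iff[OF \<sigma> v] by (simp add: \<pi>_def)
      qed
      show ?thesis using T1 T2 no1 no2 by auto
    qed
  qed
  then show ?thesis by (simp add: \<nu>1_def \<nu>2_def \<pi>_def \<rho>_def)
qed

lemma F_origin_F_origin:
  assumes \<mu>: "\<mu> \<in> PM" and s: "s \<ge> 1" and t: "t \<ge> 1"
  shows "F_origin s (F_origin t \<mu>) = F_origin (s * t) \<mu>"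
  using F_infinity_F_infinity[OF pushforward_J_PM[OF \<mu>] s t]
  by (simp add: F_origin_def pushforward_J_J F_infinity_PM pushforward_J_PM \<mu> t)

section \<open>From the exchange law to the semigroup\<close>

text \<open>
  The algebraic content of the semigroup property: two semigroups of maps \<open>A\<close>, \<open>B\<close> that satisfy the
  exchange law, where \<open>A\<close> is injective except for the fibre over its fixed point \<open>d\<close>.
\<close>

locale flow_pair =
  fixes P :: "'m set" and A B :: "real \<Rightarrow> 'm \<Rightarrow> 'm" and d :: 'm
  assumes closed_A: "\<mu> \<in> P \<Longrightarrow> t \<ge> 1 \<Longrightarrow> A t \<mu> \<in> P"
    and closed_B: "\<mu> \<in> P \<Longrightarrow> t \<ge> 1 \<Longrightarrow> B t \<mu> \<in> P"
    and A_fixed: "t \<ge> 1 \<Longrightarrow> A t d = d"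
    and A_one: "\<mu> \<in> P \<Longrightarrow> A 1 \<mu> = \<mu>"
    and A_inj: "\<mu> \<in> P \<Longrightarrow> \<nu> \<in> P \<Longrightarrow> t \<ge> 1 \<Longrightarrow> A t \<mu> = A t \<nu> \<Longrightarrow> A t \<mu> \<noteq> d \<Longrightarrow> \<mu> = \<nu>"
    and A_A: "\<mu> \<in> P \<Longrightarrow> s \<ge> 1 \<Longrightarrow> t \<ge> 1 \<Longrightarrow> A s (A t \<mu>) = A (s * t) \<mu>"
    and B_B: "\<mu> \<in> P \<Longrightarrow> s \<ge> 1 \<Longrightarrow> t \<ge> 1 \<Longrightarrow> B s (B t \<mu>) = B (s * t) \<mu>"
    and B_eq: "\<mu> \<in> P \<Longrightarrow> t \<ge> 1 \<Longrightarrow> B t \<mu> = d \<Longrightarrow> \<mu> = d"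
    and exchange: "\<mu> \<in> P \<Longrightarrow> u \<ge> 1 \<Longrightarrow> v \<ge> 1 \<Longrightarrow> v' = 1 + u * (v - 1) \<Longrightarrow> u' = u * v / v' \<Longrightarrow>
      A u (B v \<mu>) = B v' (A u' \<mu>)"
begin

definition divisible :: "'m set" where "divisible = {\<mu> \<in> P. \<mu> \<noteq> d \<and> (\<forall>s>1. \<exists>\<nu>\<in>P. A s \<nu> = \<mu>)}"

definition backward :: "real \<Rightarrow> 'm \<Rightarrow> 'm" where "backward s \<mu> = (THE \<nu>. \<nu> \<in> P \<and> A s \<nu> = \<mu>)"

lemma backward_eqI:
  assumes "\<nu> \<in> P" "A s \<nu> = \<mu>" "\<mu> \<noteq> d" "s \<ge> 1" shows "backward s \<mu> = \<nu>"
  unfolding backward_def using assms A_inj by (intro the_equality) auto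

lemma backward:
  assumes \<mu>: "\<mu> \<in> divisible" and s: "s \<ge> 1" shows "backward s \<mu> \<in> P" "A s (backward s \<mu>) = \<mu>"
proof -
  have "\<exists>\<nu>\<in>P. A s \<nu> = \<mu>"
  proof (cases "s = 1")
    case True
    then show ?thesis using \<mu> A_one by (auto simp: divisible_def)
  qed (use \<mu> s in \<open>auto simp: divisible_def\<close>)
  then obtain \<nu> where \<nu>: "\<nu> \<in> P" "A s \<nu> = \<mu>" by blast
  moreover have "backward s \<mu> = \<nu>" by (rule backward_eqI) (use \<mu> s \<nu> in \<open>auto simp: divisible_def\<close>)
  ultimately show "backward s \<mu> \<in> P" "A s (backward s \<mu>) = \<mu>" by auto
qed

lemma backward_1: "\<mu> \<in> divisible \<Longrightarrow> backward 1 \<mu> = \<mu>"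
  by (rule backward_eqI) (auto simp: divisible_def A_one)

definition evolve :: "real \<Rightarrow> 'm \<Rightarrow> 'm" where "evolve t \<mu> = B (1 + t) (backward (1 + t) \<mu>)"

text \<open>
  The exchange law with \<open>v = (u + t) / u\<close>, for which \<open>v' = 1 + t\<close> and \<open>u' = (u + t) / (1 + t)\<close>. It exhibits a
  preimage of \<open>evolve t \<mu>\<close> under \<open>A u\<close> for every \<open>u\<close>.
\<close>

lemma evolve_shift:
  assumes \<mu>: "\<mu> \<in> divisible" and t: "t \<ge> 0" and u: "u \<ge> 1"
  shows "A u (B ((u + t) / u) (backward (u + t) \<mu>)) = evolve t \<mu>"
proof -
  have ut: "u + t \<ge> 1" using t u by simp
  have q: "(u + t) / (1 + t) \<ge> 1" using t u by simp
  note \<rho> = backward[OF \<mu> ut]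
  have "backward (1 + t) \<mu> = A ((u + t) / (1 + t)) (backward (u + t) \<mu>)"
  proof (rule backward_eqI)
    show "A (1 + t) (A ((u + t) / (1 + t)) (backward (u + t) \<mu>)) = \<mu>"
      using A_A[OF \<rho>(1) _ q, of "1 + t"] t \<rho>(2) by simp
  qed (use closed_A[OF \<rho>(1) q] \<mu> t in \<open>auto simp: divisible_def\<close>)
  moreover have "A u (B ((u + t) / u) (backward (u + t) \<mu>)) = B (1 + t) (A ((u + t) / (1 + t)) (backward (u + t) \<mu>))"
  proof (rule exchange[OF \<rho>(1) u])
    have e: "u * ((u + t) / u) = u + t" using u by simp
    show "(u + t) / u \<ge> 1" using t u by simp
    show "1 + t = 1 + u * ((u + t) / u - 1)" by (simp only: right_diff_distrib e)
    show "(u + t) / (1 + t) = u * ((u + t) / u) / (1 + t)" by (simp only: e)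
  qed
  ultimately show ?thesis by (simp add: evolve_def)
qed

lemma evolve_divisible:
  assumes \<mu>: "\<mu> \<in> divisible" and t: "t \<ge> 0" shows "evolve t \<mu> \<in> divisible"
proof -
  have t1: "1 + t \<ge> 1" using t by simp
  note \<rho> = backward[OF \<mu> t1]
  have P: "evolve t \<mu> \<in> P" unfolding evolve_def by (rule closed_B[OF \<rho>(1) t1])
  have "backward (1 + t) \<mu> \<noteq> d" using \<rho>(2) A_fixed[OF t1] \<mu> by (auto simp: divisible_def)
  then have ne: "evolve t \<mu> \<noteq> d" unfolding evolve_def using B_eq[OF \<rho>(1) t1] by auto
  have "\<exists>\<nu>\<in>P. A u \<nu> = evolve t \<mu>" if "u > 1" for u
  proof
    have u: "u \<ge> 1" using that by simp
    show "A u (B ((u + t) / u) (backward (u + t) \<mu>)) = evolve t \<mu>" by (rule evolve_shift[OF \<mu> t u])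
    show "B ((u + t) / u) (backward (u + t) \<mu>) \<in> P"
      by (rule closed_B[OF backward(1)[OF \<mu>]]) (use t u in auto)
  qed
  then show ?thesis using P ne by (simp add: divisible_def)
qed

text \<open>
  For \<open>u = 1 + t\<close> the preimage just found consists of one step of \<open>B\<close>, which the next step of \<open>B\<close>
  continues.
\<close>

lemma evolve_evolve:
  assumes \<mu>: "\<mu> \<in> divisible" and t: "t \<ge> 0" and s: "s \<ge> 0"
  shows "evolve t (evolve s \<mu>) = evolve (t + s) \<mu>"
proof -
  have t1: "1 + t \<ge> 1" using t by simp
  have st: "1 + t + s \<ge> 1" using s t by simp
  note \<rho> = backward(1)[OF \<mu> st]
  have q: "(1 + t + s) / (1 + t) \<ge> 1" using s t by simp
  have "backward (1 + t) (evolve s \<mu>) = B ((1 + t + s) / (1 + t)) (backward (1 + t + s) \<mu>)"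
    using evolve_divisible[OF \<mu> s] t1
    by (intro backward_eqI closed_B[OF \<rho> q] evolve_shift[OF \<mu> s t1]) (auto simp: divisible_def)
  then have "evolve t (evolve s \<mu>) = B (1 + t) (B ((1 + t + s) / (1 + t)) (backward (1 + t + s) \<mu>))"
    by (simp add: evolve_def)
  also have "\<dots> = B (1 + t + s) (backward (1 + t + s) \<mu>)" using B_B[OF \<rho> t1 q] t by simp
  finally show ?thesis by (simp add: evolve_def add.assoc)
qed

end

lemma flow_pair_infinity_origin: "flow_pair PM F_infinity F_origin (dirac None)"
proof
  show "F_infinity t \<mu> \<in> PM" if "\<mu> \<in> PM" "1 \<le> t" for \<mu> t using that by (rule F_infinity_PM)
  show "F_origin t \<mu> \<in> PM" if "\<mu> \<in> PM" "1 \<le> t" for \<mu> t using that by (rule F_origin_PM)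
  show "F_infinity t (dirac None) = dirac None" if "1 \<le> t" for t using that by (rule F_infinity_dirac_infinity)
  show "F_infinity 1 \<mu> = \<mu>" if "\<mu> \<in> PM" for \<mu> using that by (rule F_infinity_1)
  show "\<mu> = \<nu>" if "\<mu> \<in> PM" "\<nu> \<in> PM" "1 \<le> t" "F_infinity t \<mu> = F_infinity t \<nu>" "F_infinity t \<mu> \<noteq> dirac None"
    for \<mu> \<nu> t using that by (rule F_infinity_inj)
  show "F_infinity s (F_infinity t \<mu>) = F_infinity (s * t) \<mu>" if "\<mu> \<in> PM" "1 \<le> s" "1 \<le> t" for \<mu> s t
    using that by (rule F_infinity_F_infinity)
  show "F_origin s (F_origin t \<mu>) = F_origin (s * t) \<mu>" if "\<mu> \<in> PM" "1 \<le> s" "1 \<le> t" for \<mu> s t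
    using that by (rule F_origin_F_origin)
  show "\<mu> = dirac None" if "\<mu> \<in> PM" "1 \<le> t" "F_origin t \<mu> = dirac None" for \<mu> t
    using that by (rule F_origin_eq_infinity)
  show "F_infinity u (F_origin v \<mu>) = F_origin v' (F_infinity u' \<mu>)"
    if "\<mu> \<in> PM" "1 \<le> u" "1 \<le> v" "v' = 1 + u * (v - 1)" "u' = u * v / v'" for \<mu> u v v' u'
    using that by (rule F_infinity_F_origin)
qed

lemma flow_pair_conjugate:
  assumes "flow_pair P A B d" and S: "\<And>x. x \<in> P \<Longrightarrow> S x \<in> P" "\<And>x. x \<in> P \<Longrightarrow> S' x \<in> P"
    "\<And>x. x \<in> P \<Longrightarrow> S' (S x) = x" "\<And>x. x \<in> P \<Longrightarrow> S (S' x) = x" and d: "d \<in> P"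
    and A': "\<And>t x. x \<in> P \<Longrightarrow> t \<ge> 1 \<Longrightarrow> A' t x = S' (A t (S x))"
    and B': "\<And>t x. x \<in> P \<Longrightarrow> t \<ge> 1 \<Longrightarrow> B' t x = S' (B t (S x))" and d': "d' = S' d"
  shows "flow_pair P A' B' d'"
proof -
  interpret flow_pair P A B d by fact
  have SA: "A' t x \<in> P" "S (A' t x) = A t (S x)" if "x \<in> P" "t \<ge> 1" for t x
    unfolding A'[OF that] using closed_A[OF S(1)[OF that(1)] that(2)] by (simp_all add: S)
  have SB: "B' t x \<in> P" "S (B' t x) = B t (S x)" if "x \<in> P" "t \<ge> 1" for t x
    unfolding B'[OF that] using closed_B[OF S(1)[OF that(1)] that(2)] by (simp_all add: S)
  have injS: "x = y" if "x \<in> P" "y \<in> P" "S x = S y" for x y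
    using arg_cong[OF that(3), of S'] that(1,2) by (simp add: S)
  have d'P: "d' \<in> P" "S d' = d" unfolding d' using d by (simp_all add: S)
  show ?thesis
  proof
    show "A' t \<mu> \<in> P" if "\<mu> \<in> P" "1 \<le> t" for \<mu> t using that by (rule SA(1))
    show "B' t \<mu> \<in> P" if "\<mu> \<in> P" "1 \<le> t" for \<mu> t using that by (rule SB(1))
    show "A' t d' = d'" if "1 \<le> t" for t
      using A'[OF d'P(1) that] d'P(2) A_fixed[OF that] d' by simp
    show "A' 1 \<mu> = \<mu>" if "\<mu> \<in> P" for \<mu>
      using A'[OF that, of 1] A_one[OF S(1)[OF that]] S(3)[OF that] by simp
    show "\<mu> = \<nu>" if a: "\<mu> \<in> P" "\<nu> \<in> P" "1 \<le> t" "A' t \<mu> = A' t \<nu>" "A' t \<mu> \<noteq> d'" for \<mu> \<nu> t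
    proof (rule injS[OF a(1,2)], rule A_inj[OF S(1)[OF a(1)] S(1)[OF a(2)] a(3)])
      show "A t (S \<mu>) = A t (S \<nu>)" using SA(2)[OF a(1,3)] SA(2)[OF a(2,3)] a(4) by simp
      show "A t (S \<mu>) \<noteq> d" using A'[OF a(1,3)] a(5) d' by auto
    qed
    show "\<mu> = d'" if a: "\<mu> \<in> P" "1 \<le> t" "B' t \<mu> = d'" for \<mu> t
    proof (rule injS[OF a(1) d'P(1)])
      have "B t (S \<mu>) = d" using SB(2)[OF a(1,2)] a(3) d'P(2) by simp
      then show "S \<mu> = S d'" using B_eq[OF S(1)[OF a(1)] a(2)] d'P(2) by simp
    qed
    show "A' s (A' t \<mu>) = A' (s * t) \<mu>" if a: "\<mu> \<in> P" "1 \<le> s" "1 \<le> t" for \<mu> s t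
    proof -
      have st: "1 \<le> s * t" using mult_mono[OF a(2,3)] a by simp
      show ?thesis
        unfolding A'[OF SA(1)[OF a(1,3)] a(2)] SA(2)[OF a(1,3)] A_A[OF S(1)[OF a(1)] a(2,3)] A'[OF a(1) st] ..
    qed
    show "B' s (B' t \<mu>) = B' (s * t) \<mu>" if a: "\<mu> \<in> P" "1 \<le> s" "1 \<le> t" for \<mu> s t
    proof -
      have st: "1 \<le> s * t" using mult_mono[OF a(2,3)] a by simp
      show ?thesis
        unfolding B'[OF SB(1)[OF a(1,3)] a(2)] SB(2)[OF a(1,3)] B_B[OF S(1)[OF a(1)] a(2,3)] B'[OF a(1) st] ..
    qed
    show "A' u (B' v \<mu>) = B' v' (A' u' \<mu>)"
      if a: "\<mu> \<in> P" "1 \<le> u" "1 \<le> v" "v' = 1 + u * (v - 1)" "u' = u * v / v'" for \<mu> u v v' u'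
    proof -
      have "u * (v - 1) \<ge> 0" using a(2,3) by simp
      then have v1: "1 \<le> v'" by (simp add: a(4))
      have "v' \<le> u * v" using a(2) by (simp add: a(4) algebra_simps)
      then have u1: "1 \<le> u'" using v1 by (simp add: a(5))
      show ?thesis
        unfolding A'[OF SB(1)[OF a(1,3)] a(2)] SB(2)[OF a(1,3)]
          B'[OF SA(1)[OF a(1) u1] v1] SA(2)[OF a(1) u1] exchange[OF S(1)[OF a(1)] a(2-5)] ..
    qed
  qed
qed

section \<open>Real Moebius transformations\<close>

lemma moebius_eq_J: "moebius_to_infinity (Some (of_real c)) p = J (real_affine 1 (- c) p)"
  by (cases p) auto

lemma real_affine_ext: "real_affine c d ` ext_real_line \<subseteq> ext_real_line"
  using real_affine_real_line by (auto simp: ext_real_line_def)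

lemma moebius_bij:
  assumes "a \<in> ext_real_line"
  obtains T' where "T' \<in> measurable sphere_borel sphere_borel" "T' ` ext_real_line \<subseteq> ext_real_line"
    "\<And>p. T' (moebius_to_infinity a p) = p" "\<And>p. moebius_to_infinity a (T' p) = p"
    "inv (moebius_to_infinity a) = T'" "moebius_to_infinity a ` ext_real_line \<subseteq> ext_real_line"
proof (cases a)
  case None
  show ?thesis
    by (rule that[of "\<lambda>p. p"]) (auto simp: None intro!: inv_equality)
next
  case (Some x)
  then obtain c where c: "a = Some (of_real c)" using assms by (auto simp: Reals_def)
  let ?T' = "real_affine 1 c \<circ> J"
  have 1: "?T' (moebius_to_infinity a p) = p" for p
    unfolding c moebius_eq_J o_def J_J by (cases p) auto
  have 2: "moebius_to_infinity a (?T' p) = p" for p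
  proof -
    have "real_affine 1 (- c) (real_affine 1 c q) = q" for q by (cases q) auto
    then show ?thesis unfolding c moebius_eq_J o_def by simp
  qed
  show ?thesis
  proof (rule that[OF _ _ 1 2])
    show "?T' \<in> measurable sphere_borel sphere_borel" by (rule measurable_comp) measurable
    show "?T' ` ext_real_line \<subseteq> ext_real_line"
      using real_affine_ext[of 1 c] J_ext by (force simp: image_subset_iff)
    show "inv (moebius_to_infinity a) = ?T'" by (rule inv_equality[OF 1 2])
    show "moebius_to_infinity a ` ext_real_line \<subseteq> ext_real_line"
      unfolding c moebius_eq_J using real_affine_ext[of 1 "- c"] J_ext by (force simp: image_subset_iff)
  qed
qed

lemma moebius_center: "moebius_to_infinity a a = None"
  by (cases a) auto

text \<open>
  A translation \<open>x \<mapsto> x + e\<close> after \<open>moebius_to_infinity a\<close> sends \<open>a\<close> to infinity and \<open>b\<close> to \<open>0\<close>. Followed by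
  the inversion it sends \<open>b\<close> to infinity, so it differs from \<open>moebius_to_infinity b\<close> by a real affine map.
\<close>

lemma normalising_map:
  assumes a: "a \<in> ext_real_line" and b: "b \<in> ext_real_line" and "b \<noteq> a"
  obtains e c d :: real where "c \<noteq> 0"
    "\<And>p. J (real_affine 1 e (moebius_to_infinity a p)) = real_affine c d (moebius_to_infinity b p)"
proof (cases a)
  case None
  then obtain \<beta> where \<beta>: "b = Some (of_real \<beta>)" using b \<open>b \<noteq> a\<close> by (cases b) (auto simp: Reals_def)
  have id: "real_affine 1 0 q = q" for q by (cases q) auto
  show ?thesis
    by (rule that[of 1 "- \<beta>" 0]) (simp_all only: id None \<beta> moebius_eq_J moebius_to_infinity.simps(1) one_neq_zero not_False_eq_True simp_thms)
next
  case (Some x)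
  then obtain \<alpha> where \<alpha>: "a = Some (of_real \<alpha>)" using a by (auto simp: Reals_def)
  have id: "real_affine 1 0 q = q" for q by (cases q) auto
  show ?thesis
  proof (cases b)
    case None
    show ?thesis
      by (rule that[of 1 0 "- \<alpha>"]) (simp_all only: id J_J None \<alpha> moebius_eq_J moebius_to_infinity.simps(1) one_neq_zero not_False_eq_True simp_thms)
  next
    case (Some y)
    then obtain \<beta> where \<beta>: "b = Some (of_real \<beta>)" using b by (auto simp: Reals_def)
    \<comment> \<open>With \<open>h = z - \<alpha>\<close> the two sides are \<open>1 / (1 / h - 1 / g)\<close> and an affine function of \<open>1 / (h - g)\<close>.\<close>
    define g where "g = \<beta> - \<alpha>"
    have g: "g \<noteq> 0" using \<open>b \<noteq> a\<close> \<alpha> \<beta> by (simp add: g_def)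
    have \<beta>g: "\<beta> = \<alpha> + g" by (simp add: g_def)
    have key: "J (real_affine 1 (- 1 / g) (moebius_to_infinity a p)) = real_affine (- (g\<^sup>2)) (- g) (moebius_to_infinity b p)" for p
    proof (cases p)
      case None
      then show ?thesis using g by (simp add: \<alpha> \<beta>)
    next
      case (Some z)
      define h where "h = z - of_real \<alpha>"
      have z: "z = of_real \<alpha> + h" by (simp add: h_def)
      consider "h = 0" | "h = of_real g" | "h \<noteq> 0" "h \<noteq> of_real g" by blast
      then show ?thesis
      proof cases
        case 1
        then show ?thesis using g by (simp add: Some z \<alpha> \<beta> \<beta>g power2_eq_square)
      next
        case 2
        then show ?thesis using g by (simp add: Some z \<alpha> \<beta> \<beta>g)
      next
        case 3
        have hg: "h - of_real g \<noteq> 0" "of_real g - h \<noteq> 0" "complex_of_real g \<noteq> 0" using 3 g by auto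
        have e: "1 / h - 1 / of_real g = (of_real g - h) / (h * of_real g)"
          using 3 hg by (simp add: field_simps)
        then have n: "1 / h - 1 / of_real g \<noteq> 0" using 3 hg by simp
        have "1 / (1 / h - 1 / of_real g) = (h * of_real g) / (of_real g - h)" unfolding e by simp
        also have "\<dots> = - ((of_real g)\<^sup>2 * (1 / (h - of_real g))) - of_real g"
          using hg by (simp add: divide_simps) (simp add: power2_eq_square algebra_simps)
        finally have main: "1 / (1 / h - 1 / of_real g) = - ((of_real g)\<^sup>2 * (1 / (h - of_real g))) - of_real g" .
        have L: "moebius_to_infinity a p = Some (1 / h)" using 3 by (simp add: Some z \<alpha>)
        have R: "moebius_to_infinity b p = Some (1 / (h - of_real g))" using 3 by (simp add: Some z \<beta> \<beta>g)
        have "J (real_affine 1 (- 1 / g) (Some (1 / h))) = Some (1 / (1 / h - 1 / of_real g))"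
          using n by simp
        also have "\<dots> = real_affine (- (g\<^sup>2)) (- g) (Some (1 / (h - of_real g)))"
          unfolding main by simp
        finally show ?thesis unfolding L R .
      qed
    qed
    show ?thesis by (rule that[OF _ key]) (use g in simp)
  qed
qed

lemma flow_pair_F_ge1:
  assumes a: "a \<in> ext_real_line" and b: "b \<in> ext_real_line" and "b \<noteq> a"
  shows "flow_pair PM (F_ge1 a) (F_ge1 b) (dirac a)"
proof -
  let ?Ta = "moebius_to_infinity a" and ?Tb = "moebius_to_infinity b"
  obtain Ta' where Ta: "Ta' \<in> measurable sphere_borel sphere_borel" "Ta' ` ext_real_line \<subseteq> ext_real_line"
    "\<And>p. Ta' (?Ta p) = p" "\<And>p. ?Ta (Ta' p) = p" "inv ?Ta = Ta'" "?Ta ` ext_real_line \<subseteq> ext_real_line"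
    by (rule moebius_bij[OF a]) (rule that; assumption)
  obtain Tb' where Tb: "Tb' \<in> measurable sphere_borel sphere_borel" "Tb' ` ext_real_line \<subseteq> ext_real_line"
    "\<And>p. Tb' (?Tb p) = p" "\<And>p. ?Tb (Tb' p) = p" "inv ?Tb = Tb'" "?Tb ` ext_real_line \<subseteq> ext_real_line"
    by (rule moebius_bij[OF b]) (rule that; assumption)
  obtain e c d where cd: "c \<noteq> 0"
    "\<And>p. J (real_affine 1 e (?Ta p)) = real_affine c d (?Tb p)"
    by (rule normalising_map[OF assms]) (rule that; assumption)
  let ?L = "real_affine 1 e" and ?L' = "real_affine 1 (- e)" and ?M = "real_affine c d"
  have LL: "?L' (?L p) = p" "?L (?L' p) = p" for p by (cases p; simp)+
  let ?S = "?L \<circ> ?Ta" and ?S' = "Ta' \<circ> ?L'"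
  note [measurable] = Ta(1) Tb(1)
  have mS: "?S \<in> measurable sphere_borel sphere_borel" "?S' \<in> measurable sphere_borel sphere_borel"
    by (rule measurable_comp; measurable)+
  have sS: "?S ` ext_real_line \<subseteq> ext_real_line" "?S' ` ext_real_line \<subseteq> ext_real_line"
    using real_affine_ext[of 1 e] real_affine_ext[of 1 "- e"] Ta(2,6) by (force simp: image_subset_iff)+
  have pPM: "pushforward T \<mu> \<in> PM" if "\<mu> \<in> PM" "T \<in> measurable sphere_borel sphere_borel" "T ` ext_real_line \<subseteq> ext_real_line" for T \<mu>
    by (rule pushforward_prob_measures[OF that(1,2) ext_real_line_sets ext_real_line_sets that(3)])
  have pT: "pushforward ?Ta \<mu> \<in> PM" "pushforward ?Tb \<mu> \<in> PM" if "\<mu> \<in> PM" for \<mu>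
    using that Ta(6) Tb(6) by (auto intro!: pPM)
  have pp: "pushforward T (pushforward U \<mu>) = pushforward (T \<circ> U) \<mu>"
    if "\<mu> \<in> PM" "T \<in> measurable sphere_borel sphere_borel" "U \<in> measurable sphere_borel sphere_borel" for T U \<mu>
    using that by (intro pushforward_pushforward)
  show ?thesis
  proof (rule flow_pair_conjugate[OF flow_pair_infinity_origin, of "pushforward ?S" "pushforward ?S'"])
    show "pushforward ?S \<mu> \<in> PM" "pushforward ?S' \<mu> \<in> PM" if "\<mu> \<in> PM" for \<mu>
      by (rule pPM[OF that mS(1) sS(1)], rule pPM[OF that mS(2) sS(2)])
    show "pushforward ?S' (pushforward ?S \<mu>) = \<mu>" "pushforward ?S (pushforward ?S' \<mu>) = \<mu>" if "\<mu> \<in> PM" for \<mu>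
      unfolding pp[OF that mS(2,1)] pp[OF that mS]
      by (rule pushforward_id[OF that]; simp add: LL Ta)+
    show "dirac None \<in> PM" by (rule dirac_infinity_PM)
    show "dirac a = pushforward ?S' (dirac None)"
      using Ta(3)[of a] by (simp add: pushforward_dirac[OF mS(2)] moebius_center)
    show "F_ge1 a t \<mu> = pushforward ?S' (F_infinity t (pushforward ?S \<mu>))" if \<mu>: "\<mu> \<in> PM" and t: "t \<ge> 1" for t \<mu>
    proof -
      let ?\<nu> = "F_infinity t (pushforward ?Ta \<mu>)"
      have \<nu>: "?\<nu> \<in> PM" by (rule F_infinity_PM[OF pT(1)[OF \<mu>] t])
      have "pushforward ?S \<mu> = pushforward ?L (pushforward ?Ta \<mu>)"
        by (rule pp[OF \<mu>, symmetric]) measurable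
      then have "F_infinity t (pushforward ?S \<mu>) = pushforward ?L ?\<nu>"
        using F_infinity_real_affine[OF pT(1)[OF \<mu>] t, of 1 e] by simp
      then have "pushforward ?S' (F_infinity t (pushforward ?S \<mu>)) = pushforward (?S' \<circ> ?L) ?\<nu>"
        using pp[OF \<nu> mS(2), of ?L] by simp
      also have "?S' \<circ> ?L = Ta'" by (auto simp: LL)
      finally show ?thesis unfolding F_ge1_def Ta(5) by (rule sym)
    qed
    show "F_ge1 b t \<mu> = pushforward ?S' (F_origin t (pushforward ?S \<mu>))" if \<mu>: "\<mu> \<in> PM" and t: "t \<ge> 1" for t \<mu>
    proof -
      let ?\<nu> = "F_infinity t (pushforward ?Tb \<mu>)"
      have \<nu>: "?\<nu> \<in> PM" by (rule F_infinity_PM[OF pT(2)[OF \<mu>] t])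
      have "pushforward J (pushforward ?S \<mu>) = pushforward (J \<circ> ?S) \<mu>"
        by (rule pp[OF \<mu> moebius_measurable mS(1)])
      also have "J \<circ> ?S = ?M \<circ> ?Tb" using cd(2) by (simp add: fun_eq_iff)
      also have "pushforward (?M \<circ> ?Tb) \<mu> = pushforward ?M (pushforward ?Tb \<mu>)"
        by (rule pp[OF \<mu>, symmetric]) measurable
      finally have "F_infinity t (pushforward J (pushforward ?S \<mu>)) = pushforward ?M ?\<nu>"
        by (simp only: F_infinity_real_affine[OF pT(2)[OF \<mu>] t cd(1)])
      then have "pushforward ?S' (F_origin t (pushforward ?S \<mu>)) = pushforward ?S' (pushforward J (pushforward ?M ?\<nu>))"
        by (simp add: F_origin_def)
      also have "pushforward J (pushforward ?M ?\<nu>) = pushforward (J \<circ> ?M) ?\<nu>"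
        by (rule pp[OF \<nu>]) measurable
      also have "pushforward ?S' (pushforward (J \<circ> ?M) ?\<nu>) = pushforward (?S' \<circ> (J \<circ> ?M)) ?\<nu>"
        by (rule pp[OF \<nu> mS(2)]) (rule measurable_comp; measurable)
      also have "?S' \<circ> (J \<circ> ?M) = Tb'"
      proof
        fix p
        have "J (?M p) = ?L (?Ta (Tb' p))" using cd(2)[of "Tb' p"] by (metis J_J Tb(4))
        then show "(?S' \<circ> (J \<circ> ?M)) p = Tb' p" by (simp add: LL Ta(3))
      qed
      finally show ?thesis unfolding F_ge1_def Tb(5) by (rule sym)
    qed
  qed
qed

theorem proposition6p12:
  fixes a b :: sphere
  assumes "a \<in> ext_real_line" and "b \<in> ext_real_line" and "b \<noteq> a"
  shows "(\<forall>t\<ge>0. B_map b a t \<in> FID a - {dirac a} \<rightarrow> FID a - {dirac a}) \<and>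
         (\<forall>t\<ge>0. \<forall>s\<ge>0. \<forall>\<mu> \<in> FID a - {dirac a}.
            (B_map b a t \<circ> B_map b a s) \<mu> = B_map b a (t + s) \<mu>)"
proof -
  interpret flow_pair PM "F_ge1 a" "F_ge1 b" "dirac a" by (rule flow_pair_F_ge1[OF assms])
  have div: "FID a - {dirac a} = divisible"
  proof -
    have eq: "(\<forall>t. 0 < t \<and> t < 1 \<longrightarrow> (\<exists>\<nu>\<in>PM. F_ge1 a (1 / t) \<nu> = \<mu>)) \<longleftrightarrow> (\<forall>s>1. \<exists>\<nu>\<in>PM. F_ge1 a s \<nu> = \<mu>)" for \<mu>
    proof (intro iffI allI impI)
      fix s :: real assume l: "\<forall>t. 0 < t \<and> t < 1 \<longrightarrow> (\<exists>\<nu>\<in>PM. F_ge1 a (1 / t) \<nu> = \<mu>)" and "s > 1"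
      then show "\<exists>\<nu>\<in>PM. F_ge1 a s \<nu> = \<mu>" using l[rule_format, of "1 / s"] by simp
    next
      fix t :: real assume r: "\<forall>s>1. \<exists>\<nu>\<in>PM. F_ge1 a s \<nu> = \<mu>" and "0 < t \<and> t < 1"
      then show "\<exists>\<nu>\<in>PM. F_ge1 a (1 / t) \<nu> = \<mu>" using r[rule_format, of "1 / t"] by simp
    qed
    show ?thesis
      by (rule set_eqI) (auto simp only: FID_def divisible_def Diff_iff mem_Collect_eq singleton_iff eq)
  qed
  have B: "B_map b a t \<mu> = evolve t \<mu>" if "\<mu> \<in> divisible" "t \<ge> 0" for t \<mu>
  proof -
    have "F_pow a (1 / (1 + t)) \<mu> = backward (1 + t) \<mu>"
    proof (cases "t = 0")
      case True
      then show ?thesis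
        using that(1) backward_1[OF that(1)] by (simp add: F_pow_def divisible_def A_one)
    next
      case False
      then show ?thesis using that(2) by (simp add: F_pow_def backward_def)
    qed
    then show ?thesis using that(2) by (simp add: B_map_def evolve_def F_pow_def[of b])
  qed
  show ?thesis
    unfolding div
  proof (intro conjI allI impI ballI funcsetI)
    fix t :: real and \<mu> assume "t \<ge> 0" "\<mu> \<in> divisible"
    then show "B_map b a t \<mu> \<in> divisible" by (simp add: B evolve_divisible)
  next
    fix t s :: real and \<mu> assume "t \<ge> 0" "s \<ge> 0" "\<mu> \<in> divisible"
    then show "(B_map b a t \<circ> B_map b a s) \<mu> = B_map b a (t + s) \<mu>"
      by (simp add: B evolve_divisible evolve_evolve)
  qed
qed

end
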